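(* For every $n\ge1$, $$\mathrm{Sdet}(G_n^{\mathbb{H}})^2\le_{\mathrm{Lt}}\left|\mathrm{Cdet}\,G_n^{\mathbb{H}}\right|^2.$$
   Context: $\mathbb{H}$ denotes the quaternions. $G_n^{\mathbb{H}}$ is an $n\times n$ matrix with i.i.d. standard quaternionic Gaussian entries: each entry has four independent $N(0,1/4)$ real coordinates. The Cayley determinant is $\mathrm{Cdet}A=\sum_{\sigma\in S_n}\mathrm{sgn}(\sigma)\,a_{1,\sigma(1)}a_{2,\sigma(2)}\cdots a_{n,\sigma(n)}$ (products in this row order). The Study determinant is $\mathrm{Sdet}A=\prod_{j=1}^n\sigma_j(A)$, where $\sigma_1(A),\dots,\sigma_n(A)\ge0$ are the quaternionic singular values of $A$, i.e. $A=U\,\mathrm{diag}(\sigma_1(A),\dots,\sigma_n(A))V^*$ with $U,V\in\mathbb{H}^{n\times n}$ unitary. For nonnegative random variables $U,V$, $U\le_{\mathrm{Lt}}V$ means $\mathbb{E}e^{-sU}\ge\mathbb{E}e^{-sV}$ for all $s\ge0$. *)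

theory Defs
  imports
    "HOL-Probability.Probability"
    "HOL-Combinatorics.Permutations"
    "Jordan_Normal_Form.Matrix"
begin

subsection \<open>Quaternions\<close>

datatype quat = Quat (qRe: real) (qIm1: real) (qIm2: real) (qIm3: real)

lemma quat_eq_iff:
  "x = y \<longleftrightarrow> qRe x = qRe y \<and> qIm1 x = qIm1 y \<and> qIm2 x = qIm2 y \<and> qIm3 x = qIm3 y"
  by (auto intro: quat.expand)

instantiation quat :: ab_group_add
begin

definition "0 = Quat 0 0 0 0"
definition "x + y = Quat (qRe x + qRe y) (qIm1 x + qIm1 y) (qIm2 x + qIm2 y) (qIm3 x + qIm3 y)"
definition "- x = Quat (- qRe x) (- qIm1 x) (- qIm2 x) (- qIm3 x)"
definition "x - y = Quat (qRe x - qRe y) (qIm1 x - qIm1 y) (qIm2 x - qIm2 y) (qIm3 x - qIm3 y)"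

instance
  by standard
    (simp_all add: quat_eq_iff zero_quat_def plus_quat_def uminus_quat_def minus_quat_def)

end

lemma quat_sel_group [simp]:
  "qRe 0 = 0" "qIm1 0 = 0" "qIm2 0 = 0" "qIm3 0 = 0"
  "qRe (x + y) = qRe x + qRe y" "qIm1 (x + y) = qIm1 x + qIm1 y"
  "qIm2 (x + y) = qIm2 x + qIm2 y" "qIm3 (x + y) = qIm3 x + qIm3 y"
  "qRe (- x) = - qRe x" "qIm1 (- x) = - qIm1 x"
  "qIm2 (- x) = - qIm2 x" "qIm3 (- x) = - qIm3 x"
  "qRe (x - y) = qRe x - qRe y" "qIm1 (x - y) = qIm1 x - qIm1 y"
  "qIm2 (x - y) = qIm2 x - qIm2 y" "qIm3 (x - y) = qIm3 x - qIm3 y"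
  by (simp_all add: zero_quat_def plus_quat_def uminus_quat_def minus_quat_def)

instantiation quat :: ring_1
begin

definition "1 = Quat 1 0 0 0"
definition "x * y = Quat
  (qRe x * qRe y - qIm1 x * qIm1 y - qIm2 x * qIm2 y - qIm3 x * qIm3 y)
  (qRe x * qIm1 y + qIm1 x * qRe y + qIm2 x * qIm3 y - qIm3 x * qIm2 y)
  (qRe x * qIm2 y - qIm1 x * qIm3 y + qIm2 x * qRe y + qIm3 x * qIm1 y)
  (qRe x * qIm3 y + qIm1 x * qIm2 y - qIm2 x * qIm1 y + qIm3 x * qRe y)"

instance
  by standard (simp_all add: quat_eq_iff one_quat_def times_quat_def algebra_simps)

end

lemma quat_sel_ring [simp]:
  "qRe 1 = 1" "qIm1 1 = 0" "qIm2 1 = 0" "qIm3 1 = 0"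
  "qRe (x * y) = qRe x * qRe y - qIm1 x * qIm1 y - qIm2 x * qIm2 y - qIm3 x * qIm3 y"
  "qIm1 (x * y) = qRe x * qIm1 y + qIm1 x * qRe y + qIm2 x * qIm3 y - qIm3 x * qIm2 y"
  "qIm2 (x * y) = qRe x * qIm2 y - qIm1 x * qIm3 y + qIm2 x * qRe y + qIm3 x * qIm1 y"
  "qIm3 (x * y) = qRe x * qIm3 y + qIm1 x * qIm2 y - qIm2 x * qIm1 y + qIm3 x * qRe y"
  by (simp_all add: one_quat_def times_quat_def)

instantiation quat :: real_algebra_1
begin

definition "r *\<^sub>R x = Quat (r * qRe x) (r * qIm1 x) (r * qIm2 x) (r * qIm3 x)"

instance
  by standard (simp_all add: quat_eq_iff scaleR_quat_def algebra_simps)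

end

lemma quat_sel_scaleR [simp]:
  "qRe (r *\<^sub>R x) = r * qRe x" "qIm1 (r *\<^sub>R x) = r * qIm1 x"
  "qIm2 (r *\<^sub>R x) = r * qIm2 x" "qIm3 (r *\<^sub>R x) = r * qIm3 x"
  by (simp_all add: scaleR_quat_def)

instantiation quat :: real_inner
begin

definition "inner x y = qRe x * qRe y + qIm1 x * qIm1 y + qIm2 x * qIm2 y + qIm3 x * qIm3 y"
definition "norm (x::quat) = sqrt (inner x x)"
definition "sgn (x::quat) = x /\<^sub>R norm x"
definition "dist (x::quat) y = norm (x - y)"
definition
  "(uniformity :: (quat \<times> quat) filter) = (INF e\<in>{0<..}. principal {(x, y). dist x y < e})"
definition
  "open (U :: quat set) \<longleftrightarrow> (\<forall>x\<in>U. eventually (\<lambda>(x', y). x' = x \<longrightarrow> y \<in> U) uniformity)"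

instance
proof
  fix x y z :: quat and r :: real
  show "inner x y = inner y x"
    by (simp add: inner_quat_def algebra_simps)
  show "inner (x + y) z = inner x z + inner y z"
    by (simp add: inner_quat_def algebra_simps)
  show "inner (r *\<^sub>R x) y = r * inner x y"
    by (simp add: inner_quat_def algebra_simps)
  show "0 \<le> inner x x"
    by (simp add: inner_quat_def)
  show "inner x x = 0 \<longleftrightarrow> x = 0"
    by (simp add: inner_quat_def quat_eq_iff add_nonneg_eq_0_iff)
qed (fact norm_quat_def sgn_quat_def dist_quat_def uniformity_quat_def open_quat_def)+

end

text \<open>The basis \<open>{1, i, j, k}\<close>, so that \<open>x \<bullet> b\<close> for \<open>b \<in> Basis\<close> are the four real coordinates.\<close>

instantiation quat :: euclidean_space
begin

definition "Basis = {Quat 1 0 0 0, Quat 0 1 0 0, Quat 0 0 1 0, Quat 0 0 0 1}"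

instance proof
  show "(Basis :: quat set) \<noteq> {}" "finite (Basis :: quat set)"
    by (simp_all add: Basis_quat_def)
  show "inner u v = (if u = v then 1 else 0)" if "u \<in> Basis" "v \<in> Basis" for u v :: quat
    using that unfolding Basis_quat_def inner_quat_def insert_iff empty_iff by (elim disjE) simp_all
  show "(\<forall>u\<in>Basis. inner x u = 0) \<longleftrightarrow> x = 0" for x :: quat
    by (simp add: Basis_quat_def inner_quat_def) (simp add: quat_eq_iff)
qed

end

lemma euler_four_squares:
  fixes a b c d e f g h :: real
  shows "(a*e-b*f-c*g-d*h)*(a*e-b*f-c*g-d*h) + (a*f+b*e+c*h-d*g)*(a*f+b*e+c*h-d*g)
    + (a*g-b*h+c*e+d*f)*(a*g-b*h+c*e+d*f) + (a*h+b*g-c*f+d*e)*(a*h+b*g-c*f+d*e)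
    = (a*a+b*b+c*c+d*d)*(e*e+f*f+g*g+h*h)"
proof -
  have sq: "(P-Q-Q')*(P-Q-Q') + (R+S-S')*(R+S-S') + (T+W+W')*(T+W+W') + (X-Y+Y')*(X-Y+Y')
      = (P*P+R*R) + ((Q+Q')*(Q+Q')+(S-S')*(S-S')) + (T*T+X*X) + ((W+W')*(W+W')+(Y'-Y)*(Y'-Y))
        + 2 * (- (P*(Q+Q')) + R*(S-S') + T*(W+W') + X*(Y'-Y))"
    for P Q Q' R S S' T W W' X Y Y' :: real
    by (simp add: algebra_simps)
  have 1: "(a*e-b*f)*(a*e-b*f) + (a*f+b*e)*(a*f+b*e) = (a*a+b*b)*(e*e+f*f)"
    by (simp add: algebra_simps)
  have 2: "(c*g+d*h)*(c*g+d*h) + (c*h-d*g)*(c*h-d*g) = (c*c+d*d)*(g*g+h*h)"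
    by (simp add: algebra_simps)
  have 3: "(a*g-b*h)*(a*g-b*h) + (a*h+b*g)*(a*h+b*g) = (a*a+b*b)*(g*g+h*h)"
    by (simp add: algebra_simps)
  have 4: "(c*e+d*f)*(c*e+d*f) + (d*e-c*f)*(d*e-c*f) = (c*c+d*d)*(e*e+f*f)"
    by (simp add: algebra_simps)
  have 5: "- ((a*e-b*f)*(c*g+d*h)) + (a*f+b*e)*(c*h-d*g) + (a*g-b*h)*(c*e+d*f)
      + (a*h+b*g)*(d*e-c*f) = 0"
    by (simp add: algebra_simps)
  have 6: "(a*a+b*b)*(e*e+f*f) + (c*c+d*d)*(g*g+h*h) + (a*a+b*b)*(g*g+h*h)
      + (c*c+d*d)*(e*e+f*f) + 2 * 0 = (a*a+b*b+c*c+d*d)*(e*e+f*f+g*g+h*h)"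
    by (simp add: algebra_simps)
  show ?thesis
    unfolding sq 1 2 3 4 5 by (rule 6)
qed

lemma quat_norm_mult: "norm (x * y) = norm x * norm (y :: quat)"
  unfolding norm_quat_def real_sqrt_mult [symmetric] inner_quat_def quat_sel_ring
    euler_four_squares ..

instance quat :: real_normed_algebra_1
  by standard (simp_all add: quat_norm_mult, simp add: norm_quat_def inner_quat_def)

definition qcnj :: "quat \<Rightarrow> quat" where
  "qcnj x = Quat (qRe x) (- qIm1 x) (- qIm2 x) (- qIm3 x)"

subsection \<open>Quaternionic matrices\<close>

definition qadjoint :: "quat mat \<Rightarrow> quat mat" where
  "qadjoint A = Matrix.mat (dim_col A) (dim_row A) (\<lambda>(i, j). qcnj (A $$ (j, i)))"

definition qunitary :: "nat \<Rightarrow> quat mat \<Rightarrow> bool" where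
  "qunitary n U \<longleftrightarrow>
     U \<in> carrier_mat n n \<and> qadjoint U * U = 1\<^sub>m n \<and> U * qadjoint U = 1\<^sub>m n"

text \<open>Since the entries do not commute, the factors are multiplied in increasing row order.\<close>

definition Cdet :: "quat mat \<Rightarrow> quat" where
  "Cdet A = (\<Sum>p | p permutes {0..<dim_row A}.
     of_int (sign p) * prod_list (map (\<lambda>i. A $$ (i, p i)) [0..<dim_row A]))"

definition is_qsingular_values :: "quat mat \<Rightarrow> real list \<Rightarrow> bool" where
  "is_qsingular_values A s \<longleftrightarrow>
     length s = dim_row A \<and> (\<forall>x\<in>set s. 0 \<le> x) \<and>
     (\<exists>U V. qunitary (dim_row A) U \<and> qunitary (dim_row A) V \<and>
        A = U * mat_diag (dim_row A) (\<lambda>i. of_real (s ! i)) * qadjoint V)"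

text \<open>For square \<open>A\<close> such a list exists and is unique up to order (mathematical facts not
  proved here), so the product below does not depend on the choice.\<close>

definition qsingular_values :: "quat mat \<Rightarrow> real list" where
  "qsingular_values A = (SOME s. is_qsingular_values A s)"

definition Sdet :: "quat mat \<Rightarrow> real" where
  "Sdet A = prod_list (qsingular_values A)"

subsection \<open>Gaussian matrices and the Laplace transform order\<close>

text \<open>\<^const>\<open>normal_density\<close> takes the standard deviation: \<open>1/2\<close> gives variance \<open>1/4\<close>.\<close>

definition std_quat_gaussian :: "'w measure \<Rightarrow> ('w \<Rightarrow> quat) \<Rightarrow> bool" where
  "std_quat_gaussian M X \<longleftrightarrow>
     prob_space.indep_vars M (\<lambda>_. borel) (\<lambda>b w. inner (X w) b) Basis \<and>
     (\<forall>b\<in>Basis. distributed M lborel (\<lambda>w. inner (X w) b) (\<lambda>x. ennreal (normal_density 0 (1/2) x)))"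

definition quat_gaussian_matrix :: "'w measure \<Rightarrow> nat \<Rightarrow> ('w \<Rightarrow> quat mat) \<Rightarrow> bool" where
  "quat_gaussian_matrix M n G \<longleftrightarrow>
     (\<forall>w\<in>space M. G w \<in> carrier_mat n n) \<and>
     prob_space.indep_vars M (\<lambda>_. borel) (\<lambda>ij w. G w $$ ij) ({0..<n} \<times> {0..<n}) \<and>
     (\<forall>i<n. \<forall>j<n. std_quat_gaussian M (\<lambda>w. G w $$ (i, j)))"

text \<open>Measurability and nonnegativity are part of the relation, as it is a relation between
  nonnegative random variables (the Bochner integral of a non-measurable function is 0).\<close>

definition laplace_le :: "'a measure \<Rightarrow> ('a \<Rightarrow> real) \<Rightarrow> 'b measure \<Rightarrow> ('b \<Rightarrow> real) \<Rightarrow> bool" where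
  "laplace_le M U N V \<longleftrightarrow>
     U \<in> borel_measurable M \<and> (AE x in M. 0 \<le> U x) \<and>
     V \<in> borel_measurable N \<and> (AE x in N. 0 \<le> V x) \<and>
     (\<forall>s\<ge>0. (\<integral>x. exp (- s * U x) \<partial>M) \<ge> (\<integral>x. exp (- s * V x) \<partial>N))"

end

theory Submission
  imports Defs "Jordan_Normal_Form.Determinant"
begin

text \<open>
  Let \<open>\<theta>\<close> be the last row of the Gaussian matrix and \<open>X\<close> the rest. Conditionally on \<open>\<theta>\<close>, the law of \<open>Sdet\<^sup>2\<close> is
  that of \<open>\<bar>\<theta>\<bar>\<^sup>2\<close> times the \<open>Sdet\<^sup>2\<close> of a Gaussian matrix of the next smaller size, because quaternionic
  Givens rotations of the columns move \<open>\<theta>\<close> to a multiple of the last unit vector. By induction it suffices to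
  show that \<open>E exp (- s \<bar>Cdet\<bar>\<^sup>2)\<close>, for fixed \<open>\<bar>\<theta>\<bar>\<close>, is largest when \<open>\<theta>\<close> has a single nonzero entry.

  Linearise the exponential as \<open>E\<^sub>\<xi> cos (\<xi> \<bullet> Cdet)\<close> and fix all columns but \<open>i\<close> and \<open>j\<close>. The Cayley determinant is
  real multilinear in the columns, and a term of it uses the last row only once, so as a function of the
  upper parts \<open>a\<close>, \<open>b\<close> of the two columns \<open>\<xi> \<bullet> Cdet\<close> equals \<open>B(a, b) + l(b) + k(a)\<close> with \<open>B\<close> bilinear, \<open>l\<close> linear
  in \<open>b\<close> and in \<open>\<theta>\<^sub>i\<close>, and \<open>k\<close> linear in \<open>a\<close> and in \<open>\<theta>\<^sub>j\<close>. Writing \<open>f(\<theta>\<^sub>i, \<theta>\<^sub>j) = E exp (\<i> (\<xi> \<bullet> Cdet))\<close>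
  for the expectation over \<open>a\<close> and \<open>b\<close>, and rotating two independent copies of \<open>(a, b)\<close> by \<open>\<pi>/4\<close>
  into each other gives \<open>\<bar>f(p, q)\<bar>\<^sup>2 = f(\<surd>2 p, 0) f(0, \<surd>2 q)\<close>, hence \<open>\<bar>f(p, q)\<bar> \<le> (f(\<surd>2 p, 0) + f(0, \<surd>2 q)) / 2\<close>.
  Since Cdet is alternating in the columns, a real rotation of the two columns first makes
  \<open>\<bar>\<theta>\<^sub>i\<bar> = \<bar>\<theta>\<^sub>j\<bar>\<close>, and then this step kills one entry of \<open>\<theta>\<close> without changing \<open>\<bar>\<theta>\<bar>\<close>.
\<close>

no_notation scalar_prod (infix "\<bullet>" 70)

subsection \<open>Conjugation of quaternions\<close>

lemma qcnj_sel [simp]: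
  "qRe (qcnj x) = qRe x" "qIm1 (qcnj x) = - qIm1 x" "qIm2 (qcnj x) = - qIm2 x" "qIm3 (qcnj x) = - qIm3 x"
  by (simp_all add: qcnj_def)

lemma norm_quat_sq: "(norm (x::quat))\<^sup>2 = qRe x * qRe x + qIm1 x * qIm1 x + qIm2 x * qIm2 x + qIm3 x * qIm3 x"
  by (simp add: norm_quat_def inner_quat_def)

lemma mult_qcnj: "x * qcnj x = of_real ((norm x)\<^sup>2)"
  unfolding norm_quat_sq by (simp add: quat_eq_iff of_real_def algebra_simps)

lemma qcnj_mult_self: "qcnj x * x = of_real ((norm x)\<^sup>2)"
  unfolding norm_quat_sq by (simp add: quat_eq_iff of_real_def algebra_simps)

lemma qcnj_mult: "qcnj (x * y) = qcnj y * qcnj x"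
  by (simp add: quat_eq_iff algebra_simps)

lemma qcnj_add: "qcnj (x + y) = qcnj x + qcnj y"
  by (simp add: quat_eq_iff)

lemma qcnj_minus: "qcnj (x - y) = qcnj x - qcnj y"
  by (simp add: quat_eq_iff)

lemma qcnj_uminus: "qcnj (- x) = - qcnj x"
  by (simp add: quat_eq_iff)

lemma qcnj_scaleR: "qcnj (r *\<^sub>R x) = r *\<^sub>R qcnj x"
  by (simp add: quat_eq_iff)

lemma qcnj_qcnj [simp]: "qcnj (qcnj x) = x"
  by (simp add: quat_eq_iff)

lemma qcnj_0 [simp]: "qcnj 0 = 0" and qcnj_1 [simp]: "qcnj 1 = 1"
  by (simp_all add: quat_eq_iff)

lemma qcnj_of_real [simp]: "qcnj (of_real r) = of_real r"
  by (simp add: quat_eq_iff of_real_def)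

lemma qcnj_sum: "qcnj (sum f A) = (\<Sum>a\<in>A. qcnj (f a))"
  by (induction A rule: infinite_finite_induct) (simp_all add: qcnj_add)

lemma norm_qcnj [simp]: "norm (qcnj x) = norm x"
  by (simp add: norm_quat_def inner_quat_def)

lemma DIM_quat [simp]: "DIM(quat) = 4"
  by (simp add: Basis_quat_def)

lemma linear_qcnj: "linear qcnj"
  by (rule linearI) (simp_all add: qcnj_add qcnj_scaleR)

lemma measurable_qcnj [measurable]: "qcnj \<in> borel_measurable borel"
  by (rule borel_measurable_continuous_onI)
     (simp add: linear_continuous_on linear_linear linear_qcnj linear_conv_bounded_linear[symmetric])

subsection \<open>The standard quaternionic Gaussian law\<close>

abbreviation real_gauss :: "real measure" where
  "real_gauss \<equiv> density lborel (\<lambda>x. ennreal (normal_density 0 (1/2) x))"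

text \<open>Built from a product over \<open>Basis\<close>: this matches
  \<open>std_quat_gaussian\<close> and lets characteristic functions factorise.
  \<open>qgauss_eq_density\<close> supplies the rotation invariant form.\<close>

definition qgauss :: "quat measure" where
  "qgauss = distr (\<Pi>\<^sub>M b\<in>Basis. real_gauss) borel (\<lambda>f. \<Sum>b\<in>Basis. f b *\<^sub>R b)"

text \<open>The product of four normal densities of standard deviation 1/2, each being
  \<open>sqrt (2 / pi) * exp (- 2 * x\<^sup>2)\<close>.\<close>

definition qgauss_density :: "quat \<Rightarrow> real" where
  "qgauss_density x = (2 / pi)\<^sup>2 * exp (- 2 * (norm x)\<^sup>2)"

lemma prob_space_real_gauss: "prob_space real_gauss"
  by (rule prob_space_normal_density) simp

lemma prob_space_qgauss: "prob_space qgauss"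
  unfolding qgauss_def
  by (intro prob_space.prob_space_distr prob_space_PiM prob_space_real_gauss) measurable

lemma sets_qgauss [measurable_cong, simp]: "sets qgauss = sets borel"
  and space_qgauss [simp]: "space qgauss = UNIV"
  by (simp_all add: qgauss_def)

text \<open>Both measures agree on boxes, where Tonelli factorises the integral of the product
  density, and values on boxes determine the product measure.\<close>

lemma density_PiM:
  fixes f :: "'i \<Rightarrow> 'a \<Rightarrow> ennreal"
  assumes "finite I" "product_sigma_finite M" "\<And>i. f i \<in> borel_measurable (M i)"
    and "product_sigma_finite (\<lambda>i. density (M i) (f i))"
  shows "PiM I (\<lambda>i. density (M i) (f i)) = density (PiM I M) (\<lambda>x. \<Prod>i\<in>I. f i (x i))"
proof -
  interpret M: product_sigma_finite M by fact
  interpret D: product_sigma_finite "\<lambda>i. density (M i) (f i)" by fact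
  note assms(3)[measurable]
  have "density (PiM I M) (\<lambda>x. \<Prod>i\<in>I. f i (x i)) = PiM I (\<lambda>i. density (M i) (f i))"
  proof (rule D.PiM_eqI)
    show "finite I" by fact
    show "sets (density (PiM I M) (\<lambda>x. \<Prod>i\<in>I. f i (x i))) = sets (PiM I (\<lambda>i. density (M i) (f i)))"
      by (simp, intro sets_PiM_cong) auto
    fix A assume A: "\<And>i. i \<in> I \<Longrightarrow> A i \<in> sets (density (M i) (f i))"
    then have A'[measurable]: "\<And>i. i \<in> I \<Longrightarrow> A i \<in> sets (M i)" by simp
    have "emeasure (density (PiM I M) (\<lambda>x. \<Prod>i\<in>I. f i (x i))) (Pi\<^sub>E I A)
        = (\<integral>\<^sup>+ x. (\<Prod>i\<in>I. f i (x i)) * indicator (Pi\<^sub>E I A) x \<partial>PiM I M)"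
      by (rule emeasure_density) (use \<open>finite I\<close> in \<open>auto intro!: sets_PiM_I_finite\<close>)
    also have "\<dots> = (\<integral>\<^sup>+ x. (\<Prod>i\<in>I. f i (x i) * indicator (A i) (x i)) \<partial>PiM I M)"
    proof (rule nn_integral_cong)
      fix x assume "x \<in> space (PiM I M)"
      then have "x \<in> extensional I" by (auto simp: space_PiM PiE_def)
      then have "indicator (Pi\<^sub>E I A) x = (\<Prod>i\<in>I. indicator (A i) (x i) :: ennreal)"
        using \<open>finite I\<close> by (auto simp: indicator_def PiE_def Pi_def)
      then show "(\<Prod>i\<in>I. f i (x i)) * indicator (Pi\<^sub>E I A) x = (\<Prod>i\<in>I. f i (x i) * indicator (A i) (x i))"
        by (simp add: prod.distrib)
    qed
    also have "\<dots> = (\<Prod>i\<in>I. \<integral>\<^sup>+ x. f i x * indicator (A i) x \<partial>M i)"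
      by (rule M.product_nn_integral_prod) (use \<open>finite I\<close> in auto)
    also have "\<dots> = (\<Prod>i\<in>I. emeasure (density (M i) (f i)) (A i))"
      by (intro prod.cong refl) (simp add: emeasure_density)
    finally show "emeasure (density (PiM I M) (\<lambda>x. \<Prod>i\<in>I. f i (x i))) (Pi\<^sub>E I A)
        = (\<Prod>i\<in>I. emeasure (density (M i) (f i)) (A i))" .
  qed
  then show ?thesis by simp
qed

text \<open>Lebesgue measure on the quaternions is the image of the product of the coordinate
  measures under the map that assembles a quaternion from its coordinates. The product of the
  coordinate densities is a function of the assembled quaternion, so it passes through this
  map.\<close>

lemma qgauss_eq_density: "qgauss = density lborel (\<lambda>x. ennreal (qgauss_density x))"
proof -
  have ps: "product_sigma_finite (\<lambda>_::quat. real_gauss)"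
    by (rule product_sigma_finite.intro) (rule prob_space_imp_sigma_finite[OF prob_space_real_gauss])
  have ps2: "product_sigma_finite (\<lambda>_::quat. lborel :: real measure)"
    by (rule product_sigma_finite.intro) (rule sigma_finite_lborel)
  have dens: "(\<Prod>b\<in>Basis. ennreal (normal_density 0 (1/2) (x \<bullet> b))) = ennreal (qgauss_density x)" for x :: quat
  proof -
    have "(\<Prod>b\<in>Basis. normal_density 0 (1/2) (x \<bullet> b))
      = (\<Prod>b\<in>(Basis::quat set). sqrt (2 / pi)) * (\<Prod>b\<in>Basis. exp (- 2 * (x \<bullet> b)\<^sup>2))"
      unfolding prod.distrib[symmetric]
      by (intro prod.cong refl) (simp add: normal_density_def power2_eq_square real_sqrt_divide field_simps)
    also have "\<dots> = (2 / pi)\<^sup>2 * exp (- 2 * (norm x)\<^sup>2)"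
      unfolding power2_norm_eq_inner euclidean_inner[of x x]
      using power_mult[of "sqrt (2 / pi)" 2 2]
      by (simp add: exp_sum[symmetric] sum_distrib_left power2_eq_square[symmetric] sum_negf)
    finally show ?thesis
      unfolding qgauss_density_def by (simp add: prod_ennreal)
  qed
  have "qgauss = distr (density (\<Pi>\<^sub>M b\<in>Basis. lborel) (\<lambda>f. \<Prod>b\<in>Basis. ennreal (normal_density 0 (1/2) (f b))))
      borel (\<lambda>f. \<Sum>b\<in>Basis. f b *\<^sub>R b)"
    unfolding qgauss_def by (subst density_PiM) (use ps ps2 in auto)
  also have "\<dots> = distr (density (\<Pi>\<^sub>M b\<in>Basis. lborel) (\<lambda>f. ennreal (qgauss_density (\<Sum>b\<in>Basis. f b *\<^sub>R b))))
      borel (\<lambda>f. \<Sum>b\<in>Basis. f b *\<^sub>R b)"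
    by (intro arg_cong[where f="\<lambda>m. distr m borel _"] arg_cong[where f="density _"] ext)
       (simp add: dens[symmetric] inner_sum_left inner_Basis if_distrib[where f="\<lambda>x. _ * x"] cong: if_cong)
  also have "\<dots> = density lborel (\<lambda>x. ennreal (qgauss_density x))"
    unfolding qgauss_density_def
    by (subst density_distr[symmetric]) (auto simp: lborel_eq[where 'a=quat, symmetric])
  finally show ?thesis .
qed

lemma nn_integral_qgauss:
  "f \<in> borel_measurable borel \<Longrightarrow> (\<integral>\<^sup>+x. f x \<partial>qgauss) = (\<integral>\<^sup>+x. ennreal (qgauss_density x) * f x \<partial>lborel)"
  unfolding qgauss_eq_density by (rule nn_integral_density) (auto simp: qgauss_density_def)

section \<open>Rotating two independent Gaussian quaternions\<close>

lemma nn_integral_lborel_affine: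
  fixes t :: "'a::euclidean_space"
  assumes [measurable]: "f \<in> borel_measurable borel" and c: "c \<noteq> 0"
  shows "(\<integral>\<^sup>+x. f x \<partial>lborel) = ennreal (\<bar>c\<bar> ^ DIM('a)) * (\<integral>\<^sup>+x. f (t + c *\<^sub>R x) \<partial>lborel)"
  by (subst lborel_affine[OF c, of t])
     (simp add: nn_integral_density nn_integral_distr nn_integral_cmult)

text \<open>The row \<open>(x, y)\<close> times the matrix with rows \<open>(c, - qcnj s)\<close>
  and \<open>(s, c)\<close>, which is unitary when \<open>c\<^sup>2 + (norm s)\<^sup>2 = 1\<close>.
  Multiplying from the right, it mixes columns of a matrix.\<close>

definition givens :: "real \<Rightarrow> quat \<Rightarrow> quat \<Rightarrow> quat \<Rightarrow> quat \<times> quat" where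
  "givens c s x y = (c *\<^sub>R x + y * s, c *\<^sub>R y - x * qcnj s)"

text \<open>The cross terms cancel because right multiplication by \<open>qcnj s\<close> is the
  adjoint of right multiplication by \<open>s\<close> for the real inner product.\<close>

lemma norm_sq_givens:
  assumes "c\<^sup>2 + (norm s)\<^sup>2 = 1"
  shows "(norm (c *\<^sub>R x + y * s))\<^sup>2 + (norm (c *\<^sub>R y - x * qcnj s))\<^sup>2 = (norm x)\<^sup>2 + (norm y)\<^sup>2"
proof -
  have 1: "x \<bullet> (y * s) = (x * qcnj s) \<bullet> y" for x y s :: quat
    by (simp add: inner_quat_def algebra_simps)
  have 2: "(norm (a + b))\<^sup>2 = (norm a)\<^sup>2 + (norm b)\<^sup>2 + 2 * (a \<bullet> b)"
    "(norm (a - b))\<^sup>2 = (norm a)\<^sup>2 + (norm b)\<^sup>2 - 2 * (b \<bullet> a)" for a b :: quat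
    by (simp_all add: power2_norm_eq_inner inner_add_left inner_add_right inner_diff_left inner_diff_right inner_commute)
  have "(norm (c *\<^sub>R x + y * s))\<^sup>2 + (norm (c *\<^sub>R y - x * qcnj s))\<^sup>2
    = (c\<^sup>2 + (norm s)\<^sup>2) * ((norm x)\<^sup>2 + (norm y)\<^sup>2)"
    unfolding 2 by (simp add: 1 quat_norm_mult power_mult_distrib algebra_simps)
  then show ?thesis using assms by simp
qed

text \<open>For fixed \<open>y\<close> substitute \<open>u = c x + y s\<close>, then for fixed \<open>u\<close> substitute \<open>y = u s\<^sup>* + c v\<close>; the Jacobians
  \<open>c\<^sup>-\<^sup>4\<close> and \<open>c\<^sup>4\<close> cancel.\<close>

lemma nn_integral_qgauss_givens:
  assumes c: "c > 0" and cs: "c\<^sup>2 + (norm s)\<^sup>2 = 1"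
    and F[measurable]: "F \<in> borel_measurable (borel \<Otimes>\<^sub>M borel)"
  shows "(\<integral>\<^sup>+x. \<integral>\<^sup>+y. F (givens c s x y) \<partial>qgauss \<partial>qgauss) = (\<integral>\<^sup>+x. \<integral>\<^sup>+y. F (x, y) \<partial>qgauss \<partial>qgauss)"
proof -
  let ?h = "\<lambda>x. ennreal (qgauss_density x)"
  have [measurable]: "qgauss_density \<in> borel_measurable borel"
    unfolding qgauss_density_def by measurable
  define P where "P x y = ?h x * ?h y * F (givens c s x y)" for x y
  have givens_m[measurable]: "(\<lambda>z. givens c s (fst z) (snd z)) \<in> borel \<Otimes>\<^sub>M borel \<rightarrow>\<^sub>M borel \<Otimes>\<^sub>M borel"
    unfolding givens_def by measurable
  have Pm: "(\<lambda>z. P (fst z) (snd z)) \<in> borel_measurable (borel \<Otimes>\<^sub>M borel)"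
    unfolding P_def by measurable
  have [measurable]: "(\<lambda>x. P (f x) (g x)) \<in> borel_measurable N"
    if [measurable]: "f \<in> borel_measurable N" "g \<in> borel_measurable N" for f g and N :: "'n measure"
    using measurable_compose[OF _ Pm, of "\<lambda>x. (f x, g x)" N] by simp
  have [measurable]: "(\<lambda>x. F (givens c s (f x) (g x))) \<in> borel_measurable N"
    if [measurable]: "f \<in> borel_measurable N" "g \<in> borel_measurable N" for f g and N :: "'n measure"
    using measurable_compose[OF _ givens_m[THEN measurable_compose, OF F], of "\<lambda>x. (f x, g x)" N] by simp
  \<comment> \<open>After both substitutions the arguments of \<open>P\<close> are the inverse
    rotation of \<open>(u, v)\<close>. So \<open>givens\<close> returns \<open>(u, v)\<close>, and
    the joint density is unchanged because it depends only on the sum of the squared norms.\<close>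
  have key: "P ((1/c) *\<^sub>R u - (1/c) *\<^sub>R ((u * qcnj s + c *\<^sub>R v) * s)) (u * qcnj s + c *\<^sub>R v) = ?h u * ?h v * F (u, v)" for u v
  proof -
    have ss: "u * qcnj s * s = (1 - c\<^sup>2) *\<^sub>R u" for u
    proof -
      have "u * qcnj s * s = (norm s)\<^sup>2 *\<^sub>R u"
        by (simp add: mult.assoc qcnj_mult_self of_real_def)
      moreover have "(norm s)\<^sup>2 = 1 - c\<^sup>2" using cs by simp
      ultimately show ?thesis by (simp only:)
    qed
    have ss': "u * s * qcnj s = (1 - c\<^sup>2) *\<^sub>R u" for u
    proof -
      have "u * s * qcnj s = (norm s)\<^sup>2 *\<^sub>R u"
        by (simp add: mult.assoc mult_qcnj of_real_def)
      moreover have "(norm s)\<^sup>2 = 1 - c\<^sup>2" using cs by simp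
      ultimately show ?thesis by (simp only:)
    qed
    have x: "(1/c) *\<^sub>R u - (1/c) *\<^sub>R ((u * qcnj s + c *\<^sub>R v) * s) = c *\<^sub>R u - v * s"
    proof -
      have "(1/c) *\<^sub>R u - (1/c) *\<^sub>R ((1 - c\<^sup>2) *\<^sub>R u + c *\<^sub>R w) = c *\<^sub>R u - w" for w
        using c by (simp add: quat_eq_iff field_simps power2_eq_square)
      moreover have "(u * qcnj s + c *\<^sub>R v) * s = (1 - c\<^sup>2) *\<^sub>R u + c *\<^sub>R (v * s)"
        by (simp add: distrib_right ss)
      ultimately show ?thesis by (simp only:)
    qed
    have 1: "c *\<^sub>R (c *\<^sub>R u - v * s) + (u * qcnj s + c *\<^sub>R v) * s = u"
      by (simp add: distrib_right ss scaleR_diff_right scaleR_left_diff_distrib power2_eq_square)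
    have 2: "c *\<^sub>R (u * qcnj s + c *\<^sub>R v) - (c *\<^sub>R u - v * s) * qcnj s = v"
      by (simp add: left_diff_distrib ss' scaleR_add_right scaleR_left_diff_distrib power2_eq_square)
    have n: "(norm (c *\<^sub>R u - v * s))\<^sup>2 + (norm (u * qcnj s + c *\<^sub>R v))\<^sup>2 = (norm u)\<^sup>2 + (norm v)\<^sup>2"
      using norm_sq_givens[OF cs, of "c *\<^sub>R u - v * s" "u * qcnj s + c *\<^sub>R v"] unfolding 1 2 by simp
    have "qgauss_density (c *\<^sub>R u - v * s) * qgauss_density (u * qcnj s + c *\<^sub>R v) = qgauss_density u * qgauss_density v"
    proof -
      have "exp (- 2 * (norm (c *\<^sub>R u - v * s))\<^sup>2) * exp (- 2 * (norm (u * qcnj s + c *\<^sub>R v))\<^sup>2)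
          = exp (- 2 * (norm u)\<^sup>2) * exp (- 2 * (norm v)\<^sup>2)"
        unfolding exp_add[symmetric] distrib_left[symmetric] using n by (simp only:)
      then show ?thesis unfolding qgauss_density_def by (simp add: algebra_simps)
    qed
    then have "?h (c *\<^sub>R u - v * s) * ?h (u * qcnj s + c *\<^sub>R v) = ?h u * ?h v"
      by (simp add: ennreal_mult[symmetric] qgauss_density_def)
    then show ?thesis unfolding x P_def givens_def 1 2 by simp
  qed
  have "(\<integral>\<^sup>+x. \<integral>\<^sup>+y. F (givens c s x y) \<partial>qgauss \<partial>qgauss) = (\<integral>\<^sup>+x. \<integral>\<^sup>+y. P x y \<partial>lborel \<partial>lborel)"
    by (simp add: nn_integral_qgauss P_def nn_integral_cmult[symmetric] mult.assoc)
  also have "\<dots> = (\<integral>\<^sup>+y. \<integral>\<^sup>+x. P x y \<partial>lborel \<partial>lborel)"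
    by (rule lborel_pair.Fubini') measurable
  also have "\<dots> = (\<integral>\<^sup>+y. ennreal ((1/c)^4) * \<integral>\<^sup>+u. P (- (1/c) *\<^sub>R (y * s) + (1/c) *\<^sub>R u) y \<partial>lborel \<partial>lborel)"
    using c by (intro nn_integral_cong) (subst nn_integral_lborel_affine[where c="1/c" and t="- (1/c) *\<^sub>R (_ * s)"], simp_all)
  also have "\<dots> = ennreal ((1/c)^4) * (\<integral>\<^sup>+y. \<integral>\<^sup>+u. P (- (1/c) *\<^sub>R (y * s) + (1/c) *\<^sub>R u) y \<partial>lborel \<partial>lborel)"
    by (rule nn_integral_cmult) measurable
  also have "(\<integral>\<^sup>+y. \<integral>\<^sup>+u. P (- (1/c) *\<^sub>R (y * s) + (1/c) *\<^sub>R u) y \<partial>lborel \<partial>lborel)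
     = (\<integral>\<^sup>+u. \<integral>\<^sup>+y. P (- (1/c) *\<^sub>R (y * s) + (1/c) *\<^sub>R u) y \<partial>lborel \<partial>lborel)"
    by (rule lborel_pair.Fubini') measurable
  also have "\<dots> = (\<integral>\<^sup>+u. ennreal (c^4) * \<integral>\<^sup>+v. ?h u * ?h v * F (u, v) \<partial>lborel \<partial>lborel)"
  proof (rule nn_integral_cong)
    fix u :: quat
    have "(\<integral>\<^sup>+y. P (- (1/c) *\<^sub>R (y * s) + (1/c) *\<^sub>R u) y \<partial>lborel)
      = ennreal (c^4) * (\<integral>\<^sup>+v. P (- (1/c) *\<^sub>R ((u * qcnj s + c *\<^sub>R v) * s) + (1/c) *\<^sub>R u) (u * qcnj s + c *\<^sub>R v) \<partial>lborel)"
      using c by (subst nn_integral_lborel_affine[where c=c and t="u * qcnj s"]) simp_all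
    then show "(\<integral>\<^sup>+y. P (- (1/c) *\<^sub>R (y * s) + (1/c) *\<^sub>R u) y \<partial>lborel) = ennreal (c^4) * (\<integral>\<^sup>+v. ?h u * ?h v * F (u, v) \<partial>lborel)"
      using key[of u] by (simp add: add.commute)
  qed
  also have "\<dots> = ennreal (c^4) * (\<integral>\<^sup>+u. \<integral>\<^sup>+v. ?h u * ?h v * F (u, v) \<partial>lborel \<partial>lborel)"
    by (rule nn_integral_cmult) measurable
  also have "ennreal ((1/c)^4) * (ennreal (c^4) * (\<integral>\<^sup>+u. \<integral>\<^sup>+v. ?h u * ?h v * F (u, v) \<partial>lborel \<partial>lborel))
      = (\<integral>\<^sup>+u. \<integral>\<^sup>+v. ?h u * ?h v * F (u, v) \<partial>lborel \<partial>lborel)"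
    using c by (simp add: mult.assoc[symmetric] ennreal_mult[symmetric] power_mult_distrib[symmetric])
  also have "\<dots> = (\<integral>\<^sup>+x. \<integral>\<^sup>+y. F (x, y) \<partial>qgauss \<partial>qgauss)"
    by (simp add: nn_integral_qgauss nn_integral_cmult[symmetric] mult.assoc)
  finally show ?thesis .
qed

section \<open>Families of independent Gaussian quaternions\<close>

abbreviation qvec :: "'i set \<Rightarrow> ('i \<Rightarrow> quat) measure" where
  "qvec R \<equiv> \<Pi>\<^sub>M r\<in>R. qgauss"

lemma prob_space_qvec: "prob_space (qvec R)"
  by (intro prob_space_PiM prob_space_qgauss)

lemma product_sigma_finite_qgauss: "product_sigma_finite (\<lambda>_::'i. qgauss)"
  by (rule product_sigma_finite.intro) (rule prob_space_imp_sigma_finite[OF prob_space_qgauss])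

lemma measurable_qgauss_eq_borel: "measurable N qgauss = measurable N borel"
  by (rule measurable_cong_sets) simp_all

lemma measurable_qvec_component:
  "r \<in> R \<Longrightarrow> f \<in> N \<rightarrow>\<^sub>M qvec R \<Longrightarrow> (\<lambda>x. f x r) \<in> borel_measurable N"
  using measurable_compose[OF _ measurable_component_singleton[of r R "\<lambda>_. qgauss"], of f N]
  by (simp add: measurable_qgauss_eq_borel)

subsection \<open>Characteristic functions\<close>

lemma integrable_iexp:
  assumes "prob_space M" and [measurable]: "f \<in> borel_measurable M"
  shows "integrable M (\<lambda>x. iexp (f x))"
proof -
  interpret prob_space M by fact
  show ?thesis
  proof (rule integrable_const_bound[where B=1])
    show "AE x in M. cmod (iexp (f x)) \<le> 1" by simp
  qed measurable
qed

text \<open>Substituting \<open>x / 2\<close> for \<open>x\<close> reduces this to the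
  characteristic function of the standard normal law at \<open>t / 2\<close>.\<close>

lemma integral_iexp_real_gauss:
  "(CLINT x|real_gauss. iexp (t * x)) = complex_of_real (exp (- t\<^sup>2 / 8))"
proof -
  have "(CLINT x|real_gauss. iexp (t * x)) = (CLINT x|lborel. normal_density 0 (1/2) x *\<^sub>R iexp (t * x))"
    by (rule integral_density) auto
  also have "\<dots> = (1/2) *\<^sub>R (CLINT x|lborel. normal_density 0 (1/2) (x / 2) *\<^sub>R iexp (t * (x / 2)))"
    using lborel_integral_real_affine[of "1/2" "\<lambda>x. normal_density 0 (1/2) x *\<^sub>R iexp (t * x)" 0] by simp
  also have "\<dots> = (CLINT x|lborel. (1/2) *\<^sub>R normal_density 0 (1/2) (x / 2) *\<^sub>R iexp (t * (x / 2)))"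
    by (rule integral_scaleR_right[symmetric])
  also have "\<dots> = (CLINT x|lborel. std_normal_density x *\<^sub>R iexp ((t / 2) * x))"
    by (intro Bochner_Integration.integral_cong refl)
       (simp add: normal_density_def real_sqrt_divide real_sqrt_mult power_divide field_simps)
  also have "\<dots> = char std_normal_distribution (t / 2)"
    unfolding char_def by (rule integral_density[symmetric]) auto
  also have "\<dots> = complex_of_real (exp (- t\<^sup>2 / 8))"
    by (simp add: char_std_normal_distribution power_divide)
  finally show ?thesis .
qed

lemma integral_iexp_qgauss:
  "(CLINT x|qgauss. iexp (v \<bullet> x)) = complex_of_real (exp (- (norm v)\<^sup>2 / 8))"
proof -
  interpret product_sigma_finite "\<lambda>_::quat. real_gauss"
    by (rule product_sigma_finite.intro) (rule prob_space_imp_sigma_finite[OF prob_space_real_gauss])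
  interpret R: prob_space real_gauss by (rule prob_space_real_gauss)
  have "(CLINT x|qgauss. iexp (v \<bullet> x))
      = (CLINT f|(\<Pi>\<^sub>M b\<in>Basis. real_gauss). iexp (v \<bullet> (\<Sum>b\<in>Basis. f b *\<^sub>R b)))"
    unfolding qgauss_def by (rule integral_distr) auto
  also have "\<dots> = (CLINT f|(\<Pi>\<^sub>M b\<in>(Basis::quat set). real_gauss). \<Prod>b\<in>Basis. iexp ((v \<bullet> b) * f b))"
    by (simp add: inner_sum_right exp_sum[symmetric] sum_distrib_left mult.commute)
  also have "\<dots> = (\<Prod>b\<in>Basis. CLINT x|real_gauss. iexp ((v \<bullet> b) * x))"
  proof (rule product_integral_prod)
    show "complex_integrable real_gauss (\<lambda>x. iexp ((v \<bullet> b) * x))" for b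
      by (rule integrable_iexp[OF prob_space_real_gauss]) measurable
  qed simp
  also have "\<dots> = complex_of_real (\<Prod>b\<in>Basis. exp (- (v \<bullet> b)\<^sup>2 / 8))"
    unfolding integral_iexp_real_gauss by simp
  also have "(\<Prod>b\<in>Basis. exp (- (v \<bullet> b)\<^sup>2 / 8)) = exp (- (norm v)\<^sup>2 / 8)"
    unfolding power2_norm_eq_inner euclidean_inner[of v v]
    by (simp add: exp_sum[symmetric] sum_negf sum_divide_distrib[symmetric] power2_eq_square)
  finally show ?thesis .
qed

text \<open>The complex exponential factorises over the independent coordinates, each contributing
  \<open>integral_iexp_qgauss\<close>; the real part is taken only afterwards.\<close>

lemma integral_cos_qvec:
  assumes "finite R"
  shows "(\<integral>a. cos (k + (\<Sum>r\<in>R. v r \<bullet> a r)) \<partial>qvec R) = cos k * exp (- (\<Sum>r\<in>R. (norm (v r))\<^sup>2) / 8)"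
proof -
  interpret product_sigma_finite "\<lambda>_::'a. qgauss" by (rule product_sigma_finite_qgauss)
  interpret Q: prob_space qgauss by (rule prob_space_qgauss)
  interpret P: prob_space "qvec R" by (rule prob_space_qvec)
  have "(CLINT a|qvec R. iexp (k + (\<Sum>r\<in>R. v r \<bullet> a r)))
      = (CLINT a|qvec R. iexp k * (\<Prod>r\<in>R. iexp (v r \<bullet> a r)))"
    using assms by (simp add: exp_sum[symmetric] exp_add[symmetric] sum_distrib_left distrib_left)
  also have "\<dots> = iexp k * (CLINT a|qvec R. (\<Prod>r\<in>R. iexp (v r \<bullet> a r)))"
    by simp
  also have "(CLINT a|qvec R. (\<Prod>r\<in>R. iexp (v r \<bullet> a r))) = (\<Prod>r\<in>R. CLINT x|qgauss. iexp (v r \<bullet> x))"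
  proof (rule product_integral_prod)
    show "complex_integrable qgauss (\<lambda>x. iexp (v r \<bullet> x))" for r
      by (rule integrable_iexp[OF prob_space_qgauss]) measurable
  qed fact
  also have "\<dots> = complex_of_real (\<Prod>r\<in>R. exp (- (norm (v r))\<^sup>2 / 8))"
    unfolding integral_iexp_qgauss by simp
  also have "(\<Prod>r\<in>R. exp (- (norm (v r))\<^sup>2 / 8)) = exp (- (\<Sum>r\<in>R. (norm (v r))\<^sup>2) / 8)"
    using assms by (simp add: exp_sum[symmetric] sum_negf sum_divide_distrib[symmetric])
  finally have *: "(CLINT a|qvec R. iexp (k + (\<Sum>r\<in>R. v r \<bullet> a r))) = iexp k * exp (- (\<Sum>r\<in>R. (norm (v r))\<^sup>2) / 8)"
    by simp
  have "(\<integral>a. cos (k + (\<Sum>r\<in>R. v r \<bullet> a r)) \<partial>qvec R) = (\<integral>a. Re (iexp (k + (\<Sum>r\<in>R. v r \<bullet> a r))) \<partial>qvec R)"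
    by (simp only: Re_exp) simp
  also have "\<dots> = Re (CLINT a|qvec R. iexp (k + (\<Sum>r\<in>R. v r \<bullet> a r)))"
    by (intro integral_Re integrable_iexp prob_space_qvec borel_measurable_add borel_measurable_const
        borel_measurable_sum borel_measurable_inner measurable_qvec_component measurable_ident) auto
  also have "\<dots> = cos k * exp (- (\<Sum>r\<in>R. (norm (v r))\<^sup>2) / 8)"
    unfolding * by (simp add: Re_exp)
  finally show ?thesis .
qed

text \<open>The Gaussian characteristic function read backwards. The frequency scale
  \<open>sqrt (8 * s)\<close> cancels the factor 1/8 in its exponent. It replaces the squared norm
  by a phase that is linear in \<open>z\<close>.\<close>

lemma exp_norm_eq_integral_cos:
  "exp (- s * (norm z)\<^sup>2) = (\<integral>\<xi>. cos ((sqrt (8 * s) *\<^sub>R \<xi>) \<bullet> z) \<partial>qgauss)" if "s \<ge> 0"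
proof -
  interpret Q: prob_space qgauss by (rule prob_space_qgauss)
  have "(\<integral>\<xi>. cos ((sqrt (8 * s) *\<^sub>R \<xi>) \<bullet> z) \<partial>qgauss) = (\<integral>\<xi>. Re (iexp ((sqrt (8 * s) *\<^sub>R z) \<bullet> \<xi>)) \<partial>qgauss)"
    by (simp only: Re_exp) (simp add: inner_commute)
  also have "\<dots> = Re (CLINT \<xi>|qgauss. iexp ((sqrt (8 * s) *\<^sub>R z) \<bullet> \<xi>))"
    by (intro integral_Re integrable_iexp prob_space_qgauss) measurable
  also have "\<dots> = exp (- s * (norm z)\<^sup>2)"
    unfolding integral_iexp_qgauss using that by (simp add: power_mult_distrib)
  finally show ?thesis by simp
qed

subsection \<open>Rotation invariance of Gaussian columns\<close>

text \<open>The restriction to \<open>R\<close> keeps both rotated columns extensional, that is,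
  inside the space of \<open>qvec R\<close>.\<close>

definition givens_col :: "'i set \<Rightarrow> real \<Rightarrow> quat \<Rightarrow> ('i \<Rightarrow> quat) \<times> ('i \<Rightarrow> quat) \<Rightarrow> ('i \<Rightarrow> quat) \<times> ('i \<Rightarrow> quat)" where
  "givens_col R c s z = (\<lambda>r\<in>R. fst (givens c s (fst z r) (snd z r)), \<lambda>r\<in>R. snd (givens c s (fst z r) (snd z r)))"

lemma measurable_givens_col [measurable]: "givens_col R c s \<in> qvec R \<Otimes>\<^sub>M qvec R \<rightarrow>\<^sub>M qvec R \<Otimes>\<^sub>M qvec R"
  unfolding givens_col_def givens_def fst_conv snd_conv
  by (intro measurable_Pair measurable_restrict)
     (auto simp: measurable_qgauss_eq_borel
       intro!: borel_measurable_add borel_measurable_diff borel_measurable_scaleR borel_measurable_times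
         borel_measurable_const measurable_qvec_component measurable_fst measurable_snd)

text \<open>Splits coordinate \<open>r\<close> off both vectors and, by Tonelli, moves the two
  scalar integrals innermost, where the invariance for a single pair applies.\<close>

lemma nn_integral_qvec_insert2:
  fixes R :: "'i set"
  assumes R: "finite R" "r \<notin> R"
    and F[measurable]: "F \<in> borel_measurable (qvec (insert r R) \<Otimes>\<^sub>M qvec (insert r R))"
  shows "(\<integral>\<^sup>+a. \<integral>\<^sup>+b. F (a, b) \<partial>qvec (insert r R) \<partial>qvec (insert r R))
    = (\<integral>\<^sup>+a. \<integral>\<^sup>+b. \<integral>\<^sup>+x. \<integral>\<^sup>+y. F (a(r := x), b(r := y)) \<partial>qgauss \<partial>qgauss \<partial>qvec R \<partial>qvec R)"
proof -
  interpret product_sigma_finite "\<lambda>_::'i. qgauss" by (rule product_sigma_finite_qgauss)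
  interpret Q: sigma_finite_measure qgauss by (rule prob_space_imp_sigma_finite[OF prob_space_qgauss])
  interpret C: sigma_finite_measure "qvec R" by (rule prob_space_imp_sigma_finite[OF prob_space_qvec])
  interpret C': sigma_finite_measure "qvec (insert r R)" by (rule prob_space_imp_sigma_finite[OF prob_space_qvec])
  interpret QC: pair_sigma_finite qgauss "qvec R" ..
  have [measurable]: "(\<lambda>w. (f w)(r := g w)) \<in> N \<rightarrow>\<^sub>M qvec (insert r R)"
    if [measurable]: "f \<in> N \<rightarrow>\<^sub>M qvec R" "g \<in> N \<rightarrow>\<^sub>M borel" for f g and N :: "'n measure"
    by (rule measurable_fun_upd[where J=R]) auto
  have "(\<integral>\<^sup>+a. \<integral>\<^sup>+b. F (a, b) \<partial>qvec (insert r R) \<partial>qvec (insert r R))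
    = (\<integral>\<^sup>+a. \<integral>\<^sup>+x. \<integral>\<^sup>+b. F (a(r := x), b) \<partial>qvec (insert r R) \<partial>qgauss \<partial>qvec R)"
    by (rule product_nn_integral_insert[OF R]) measurable
  also have "\<dots> = (\<integral>\<^sup>+a. \<integral>\<^sup>+x. \<integral>\<^sup>+b. \<integral>\<^sup>+y. F (a(r := x), b(r := y)) \<partial>qgauss \<partial>qvec R \<partial>qgauss \<partial>qvec R)"
    by (intro nn_integral_cong product_nn_integral_insert[OF R]) measurable
  also have "\<dots> = (\<integral>\<^sup>+a. \<integral>\<^sup>+b. \<integral>\<^sup>+x. \<integral>\<^sup>+y. F (a(r := x), b(r := y)) \<partial>qgauss \<partial>qgauss \<partial>qvec R \<partial>qvec R)"
    by (intro nn_integral_cong QC.Fubini'[symmetric]) measurable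
  finally show ?thesis .
qed

text \<open>The rotation acts on each coordinate pair separately. In the induction step the new pair
  is rotated back with the others fixed, and the induction hypothesis is applied to the function
  with that pair integrated out.\<close>

lemma nn_integral_givens_col:
  fixes R :: "'i set"
  assumes "finite R" and c: "c > 0" and cs: "c\<^sup>2 + (norm s)\<^sup>2 = 1"
    and "F \<in> borel_measurable (qvec R \<Otimes>\<^sub>M qvec R)"
  shows "(\<integral>\<^sup>+a. \<integral>\<^sup>+b. F (givens_col R c s (a, b)) \<partial>qvec R \<partial>qvec R) = (\<integral>\<^sup>+a. \<integral>\<^sup>+b. F (a, b) \<partial>qvec R \<partial>qvec R)"
  using assms(1,4)
proof (induction R arbitrary: F rule: finite_induct)
  case empty
  show ?case
  proof (intro nn_integral_cong)
    fix a b assume "a \<in> space (qvec ({}::'i set))" "b \<in> space (qvec ({}::'i set))"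
    then have "a = (\<lambda>x. undefined)" "b = (\<lambda>x. undefined)" by (simp_all add: space_PiM)
    then show "F (givens_col {} c s (a, b)) = F (a, b)" by (simp add: givens_col_def restrict_def)
  qed
next
  case (insert r R)
  note F[measurable] = insert.prems
  interpret Q: sigma_finite_measure qgauss by (rule prob_space_imp_sigma_finite[OF prob_space_qgauss])
  interpret C: sigma_finite_measure "qvec R" by (rule prob_space_imp_sigma_finite[OF prob_space_qvec])
  have [measurable]: "(\<lambda>w. (f w)(r := g w)) \<in> N \<rightarrow>\<^sub>M qvec (insert r R)"
    if [measurable]: "f \<in> N \<rightarrow>\<^sub>M qvec R" "g \<in> N \<rightarrow>\<^sub>M borel" for f g and N :: "'n measure"
    by (rule measurable_fun_upd[where J=R]) auto
  have eq: "givens_col (insert r R) c s (a(r := x), b(r := y)) =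
     ((fst (givens_col R c s (a, b)))(r := fst (givens c s x y)), (snd (givens_col R c s (a, b)))(r := snd (givens c s x y)))"
    for a b x y
    using \<open>r \<notin> R\<close> by (auto simp: givens_col_def fun_eq_iff restrict_def)
  have "(\<integral>\<^sup>+a. \<integral>\<^sup>+b. F (givens_col (insert r R) c s (a, b)) \<partial>qvec (insert r R) \<partial>qvec (insert r R))
    = (\<integral>\<^sup>+a. \<integral>\<^sup>+b. \<integral>\<^sup>+x. \<integral>\<^sup>+y. F (givens_col (insert r R) c s (a(r := x), b(r := y))) \<partial>qgauss \<partial>qgauss \<partial>qvec R \<partial>qvec R)"
    using nn_integral_qvec_insert2[OF insert.hyps, of "\<lambda>z. F (givens_col (insert r R) c s z)"] by simp
  also have "\<dots> = (\<integral>\<^sup>+a. \<integral>\<^sup>+b. \<integral>\<^sup>+x. \<integral>\<^sup>+y. F ((fst (givens_col R c s (a, b)))(r := x), (snd (givens_col R c s (a, b)))(r := y)) \<partial>qgauss \<partial>qgauss \<partial>qvec R \<partial>qvec R)"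
  proof (rule nn_integral_cong, rule nn_integral_cong)
    fix a b assume ab[simp]: "a \<in> space (qvec R)" "b \<in> space (qvec R)"
    then have "(a, b) \<in> space (qvec R \<Otimes>\<^sub>M qvec R)" by (simp add: space_pair_measure)
    then have g: "givens_col R c s (a, b) \<in> space (qvec R \<Otimes>\<^sub>M qvec R)"
      by (rule measurable_space[OF measurable_givens_col])
    then have [measurable]: "(\<lambda>w. fst (givens_col R c s (a, b))) \<in> N \<rightarrow>\<^sub>M qvec R"
      "(\<lambda>w. snd (givens_col R c s (a, b))) \<in> N \<rightarrow>\<^sub>M qvec R" for N :: "'n measure"
      by (auto simp: space_pair_measure)
    have "(\<integral>\<^sup>+x. \<integral>\<^sup>+y. (\<lambda>z. F ((fst (givens_col R c s (a, b)))(r := fst z), (snd (givens_col R c s (a, b)))(r := snd z))) (givens c s x y) \<partial>qgauss \<partial>qgauss)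
      = (\<integral>\<^sup>+x. \<integral>\<^sup>+y. (\<lambda>z. F ((fst (givens_col R c s (a, b)))(r := fst z), (snd (givens_col R c s (a, b)))(r := snd z))) (x, y) \<partial>qgauss \<partial>qgauss)"
      by (rule nn_integral_qgauss_givens[OF c cs]) measurable
    then show "(\<integral>\<^sup>+x. \<integral>\<^sup>+y. F (givens_col (insert r R) c s (a(r := x), b(r := y))) \<partial>qgauss \<partial>qgauss)
       = (\<integral>\<^sup>+x. \<integral>\<^sup>+y. F ((fst (givens_col R c s (a, b)))(r := x), (snd (givens_col R c s (a, b)))(r := y)) \<partial>qgauss \<partial>qgauss)"
      unfolding eq by simp
  qed
  also have "\<dots> = (\<integral>\<^sup>+a. \<integral>\<^sup>+b. \<integral>\<^sup>+x. \<integral>\<^sup>+y. F (a(r := x), b(r := y)) \<partial>qgauss \<partial>qgauss \<partial>qvec R \<partial>qvec R)"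
    using insert.IH[of "\<lambda>z. \<integral>\<^sup>+x. \<integral>\<^sup>+y. F ((fst z)(r := x), (snd z)(r := y)) \<partial>qgauss \<partial>qgauss"] by simp
  also have "\<dots> = (\<integral>\<^sup>+a. \<integral>\<^sup>+b. F (a, b) \<partial>qvec (insert r R) \<partial>qvec (insert r R))"
    by (rule nn_integral_qvec_insert2[OF insert.hyps F, symmetric])
  finally show ?case .
qed

lemma distr_givens_col:
  assumes "finite R" "c > 0" "c\<^sup>2 + (norm s)\<^sup>2 = 1"
  shows "distr (qvec R \<Otimes>\<^sub>M qvec R) (qvec R \<Otimes>\<^sub>M qvec R) (givens_col R c s) = qvec R \<Otimes>\<^sub>M qvec R"
proof (rule measure_eqI)
  interpret C: sigma_finite_measure "qvec R" by (rule prob_space_imp_sigma_finite[OF prob_space_qvec])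
  fix A assume "A \<in> sets (distr (qvec R \<Otimes>\<^sub>M qvec R) (qvec R \<Otimes>\<^sub>M qvec R) (givens_col R c s))"
  then have [measurable]: "A \<in> sets (qvec R \<Otimes>\<^sub>M qvec R)" by simp
  have "emeasure (distr (qvec R \<Otimes>\<^sub>M qvec R) (qvec R \<Otimes>\<^sub>M qvec R) (givens_col R c s)) A
     = (\<integral>\<^sup>+z. indicator A z \<partial>distr (qvec R \<Otimes>\<^sub>M qvec R) (qvec R \<Otimes>\<^sub>M qvec R) (givens_col R c s))"
    by simp
  also have "\<dots> = (\<integral>\<^sup>+z. indicator A (givens_col R c s z) \<partial>(qvec R \<Otimes>\<^sub>M qvec R))"
    by (rule nn_integral_distr) measurable
  also have "\<dots> = (\<integral>\<^sup>+a. \<integral>\<^sup>+b. indicator A (givens_col R c s (a, b)) \<partial>qvec R \<partial>qvec R)"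
    by (rule C.nn_integral_fst[symmetric]) measurable
  also have "\<dots> = (\<integral>\<^sup>+a. \<integral>\<^sup>+b. indicator A (a, b) \<partial>qvec R \<partial>qvec R)"
    by (rule nn_integral_givens_col[OF assms]) measurable
  also have "\<dots> = (\<integral>\<^sup>+z. indicator A z \<partial>(qvec R \<Otimes>\<^sub>M qvec R))"
    by (rule C.nn_integral_fst) measurable
  also have "\<dots> = emeasure (qvec R \<Otimes>\<^sub>M qvec R) A" by simp
  finally show "emeasure (distr (qvec R \<Otimes>\<^sub>M qvec R) (qvec R \<Otimes>\<^sub>M qvec R) (givens_col R c s)) A = emeasure (qvec R \<Otimes>\<^sub>M qvec R) A" .
qed simp

section \<open>The merging inequality for one Gaussian vector\<close>

lemma integral_pair_product:
  fixes u :: "'a \<Rightarrow> real" and v :: "'b \<Rightarrow> real"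
  assumes "prob_space A" "prob_space B"
    and [measurable]: "u \<in> borel_measurable A" "v \<in> borel_measurable B"
    and bd: "\<And>x. \<bar>u x\<bar> \<le> 1" "\<And>x. \<bar>v x\<bar> \<le> 1"
  shows "(\<integral>x. u x \<partial>A) * (\<integral>y. v y \<partial>B) = (\<integral>z. u (fst z) * v (snd z) \<partial>(A \<Otimes>\<^sub>M B))"
    and "integrable (A \<Otimes>\<^sub>M B) (\<lambda>z. u (fst z) * v (snd z))"
proof -
  interpret A: prob_space A by fact
  interpret B: prob_space B by fact
  interpret AB: pair_prob_space A B ..
  show int: "integrable (A \<Otimes>\<^sub>M B) (\<lambda>z. u (fst z) * v (snd z))"
    by (rule AB.integrable_const_bound[where B=1]) (use bd in \<open>auto simp: abs_mult intro!: mult_le_one\<close>)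
  have "(\<integral>z. u (fst z) * v (snd z) \<partial>(A \<Otimes>\<^sub>M B)) = (\<integral>x. \<integral>y. u (fst (x, y)) * v (snd (x, y)) \<partial>B \<partial>A)"
    by (rule AB.integral_fst'[OF int, symmetric])
  then show "(\<integral>x. u x \<partial>A) * (\<integral>y. v y \<partial>B) = (\<integral>z. u (fst z) * v (snd z) \<partial>(A \<Otimes>\<^sub>M B))"
    by simp
qed

text \<open>Here \<open>a\<close> is already integrated out. With \<open>z = E exp (\<i> l(b)) exp (- \<Sum>\<^sub>j \<bar>W\<^sub>j b + n\<^sub>j\<bar>\<^sup>2 / 8)\<close>, the expectation \<open>\<bar>z\<bar>\<^sup>2\<close>
  over two independent copies of \<open>b\<close> factorises after rotating them by \<open>\<pi>/4\<close>; the claim is then AM-GM.\<close>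

lemma qvec_merge_inequality:
  fixes l :: "('i \<Rightarrow> quat) \<Rightarrow> real" and W :: "'j \<Rightarrow> ('i \<Rightarrow> quat) \<Rightarrow> quat"
  assumes R: "finite R" and S: "finite S"
    and [measurable]: "l \<in> borel_measurable (qvec R)" "\<And>j. j \<in> S \<Longrightarrow> W j \<in> borel_measurable (qvec R)"
    and l: "\<And>p q x y. l (\<lambda>r\<in>R. p *\<^sub>R x r + q *\<^sub>R y r) = p * l x + q * l y"
    and W: "\<And>j p q x y. j \<in> S \<Longrightarrow> W j (\<lambda>r\<in>R. p *\<^sub>R x r + q *\<^sub>R y r) = p *\<^sub>R W j x + q *\<^sub>R W j y"
  shows "(\<integral>b. cos (l b) * exp (- (\<Sum>j\<in>S. (norm (W j b + n j))\<^sup>2) / 8) \<partial>qvec R)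
    \<le> ((\<integral>b. cos (sqrt 2 * l b) * exp (- (\<Sum>j\<in>S. (norm (W j b))\<^sup>2) / 8) \<partial>qvec R)
      + (\<integral>b. exp (- (\<Sum>j\<in>S. (norm (W j b + sqrt 2 *\<^sub>R n j))\<^sup>2) / 8) \<partial>qvec R)) / 2"
proof -
  let ?K = "qvec R"
  interpret P: prob_space ?K by (rule prob_space_qvec)
  define E where "E m b = exp (- (\<Sum>j\<in>S. (norm (W j b + m j))\<^sup>2) / 8)" for m b
  have Em[measurable]: "E m \<in> borel_measurable ?K" for m
    unfolding E_def by measurable
  have Epos: "E m b > 0" and E1: "E m b \<le> 1" for m b
    by (auto simp: E_def sum_nonneg)
  have E_abs: "\<bar>E m b\<bar> \<le> 1" for m b
    using Epos[of m b] E1[of m b] by simp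
  have bd: "\<bar>cos t * E m b\<bar> \<le> 1" "\<bar>sin t * E m b\<bar> \<le> 1" for t m b
    using E_abs[of m b] by (auto simp: abs_mult intro!: mult_le_one)
  \<comment> \<open>\<open>f\<close> and \<open>g\<close> are the real and imaginary parts of the
    characteristic integral. \<open>x\<close> and \<open>y\<close> are the two factors into which
    its squared modulus splits after the rotation.\<close>
  define f g x y where "f = (\<integral>b. cos (l b) * E n b \<partial>?K)" and "g = (\<integral>b. sin (l b) * E n b \<partial>?K)"
    and "x = (\<integral>b. cos (sqrt 2 * l b) * E (\<lambda>_. 0) b \<partial>?K)" and "y = (\<integral>b. E (\<lambda>j. sqrt 2 *\<^sub>R n j) b \<partial>?K)"
  \<comment> \<open>With the copies \<open>(a + b) / sqrt 2\<close> and
    \<open>(b - a) / sqrt 2\<close>, the phase difference involves only \<open>a\<close>, while the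
    shifts \<open>n j\<close> end up entirely with \<open>b\<close>.\<close>
  have rot: "cos (l (fst z) - l (snd z)) * (E n (fst z) * E n (snd z))
      = (cos (sqrt 2 * l a) * E (\<lambda>_. 0) a) * E (\<lambda>j. sqrt 2 *\<^sub>R n j) b"
    if z: "z = givens_col R (1 / sqrt 2) (of_real (1 / sqrt 2)) (a, b)" for a b z
  proof -
    have z1: "fst z = (\<lambda>r\<in>R. (1 / sqrt 2) *\<^sub>R a r + (1 / sqrt 2) *\<^sub>R b r)"
      and z2: "snd z = (\<lambda>r\<in>R. (1 / sqrt 2) *\<^sub>R b r + (- 1 / sqrt 2) *\<^sub>R a r)"
      unfolding z givens_col_def givens_def qcnj_of_real by (auto simp: of_real_def)
    have "l (fst z) - l (snd z) = (2 / sqrt 2) * l a"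
      unfolding z1 z2 l by (simp add: field_simps)
    then have 1: "l (fst z) - l (snd z) = sqrt 2 * l a"
      by (simp add: real_div_sqrt)
    have "(norm (W j (fst z) + n j))\<^sup>2 + (norm (W j (snd z) + n j))\<^sup>2 = (norm (W j a))\<^sup>2 + (norm (W j b + sqrt 2 *\<^sub>R n j))\<^sup>2"
      if "j \<in> S" for j
    proof -
      \<comment> \<open>The parallelogram law for the vectors \<open>(1/r) *\<^sub>R B + N\<close>
        and \<open>(1/r) *\<^sub>R A\<close>, with \<open>r\<close> standing for
        \<open>sqrt 2\<close>.\<close>
      have id: "(norm ((1/r) *\<^sub>R A + (1/r) *\<^sub>R B + N))\<^sup>2 + (norm ((1/r) *\<^sub>R B + (- 1/r) *\<^sub>R A + N))\<^sup>2
          = (norm A)\<^sup>2 + (norm (B + r *\<^sub>R N))\<^sup>2" if r: "r > 0" "r * r = 2" for r and A B N :: quat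
      proof -
        define p where "p = 1 / r"
        have pp: "p * p = 1 / 2" and p: "2 * p = r" "-1/r = -p" "1/r = p"
          using r by (auto simp: p_def field_simps)
        have "(norm (p *\<^sub>R A + p *\<^sub>R B + N))\<^sup>2 + (norm (p *\<^sub>R B + (- p) *\<^sub>R A + N))\<^sup>2
            = 2 * (p * p) * (A \<bullet> A) + 2 * (p * p) * (B \<bullet> B) + 4 * p * (B \<bullet> N) + 2 * (N \<bullet> N)"
          unfolding power2_norm_eq_inner
          by (simp add: inner_add_left inner_add_right inner_diff_left inner_diff_right inner_commute[of B A] inner_commute[of N A] inner_commute[of N B] distrib_left right_diff_distrib)
        also have "\<dots> = (A \<bullet> A) + (B \<bullet> B) + 2 * (2 * p) * (B \<bullet> N) + 2 * (N \<bullet> N)"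
          unfolding pp by simp
        also have "\<dots> = (A \<bullet> A) + (B \<bullet> B) + 2 * r * (B \<bullet> N) + (r * r) * (N \<bullet> N)"
          unfolding p r ..
        also have "\<dots> = (norm A)\<^sup>2 + (norm (B + r *\<^sub>R N))\<^sup>2"
          unfolding power2_norm_eq_inner
          by (simp add: inner_add_left inner_add_right inner_commute[of N B] distrib_left)
        finally show ?thesis unfolding p .
      qed
      show ?thesis unfolding z1 z2 W[OF that] using id[of "sqrt 2"] by simp
    qed
    then have 2: "(\<Sum>j\<in>S. (norm (W j (fst z) + n j))\<^sup>2) + (\<Sum>j\<in>S. (norm (W j (snd z) + n j))\<^sup>2)
      = (\<Sum>j\<in>S. (norm (W j a))\<^sup>2) + (\<Sum>j\<in>S. (norm (W j b + sqrt 2 *\<^sub>R n j))\<^sup>2)"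
      unfolding sum.distrib[symmetric] by (intro sum.cong) auto
    have "E n (fst z) * E n (snd z) = E (\<lambda>_. 0) a * E (\<lambda>j. sqrt 2 *\<^sub>R n j) b"
      unfolding E_def exp_add[symmetric] add_0_right by (rule arg_cong[where f=exp]) (use 2 in linarith)
    then show ?thesis unfolding 1 by simp
  qed
  have c: "(1 / sqrt 2)\<^sup>2 + (norm (of_real (1 / sqrt 2) :: quat))\<^sup>2 = 1"
    by (simp add: power_divide)
  have "f\<^sup>2 \<le> f * f + g * g" by (simp add: power2_eq_square)
  also have "\<dots> = (\<integral>z. (cos (l (fst z)) * E n (fst z)) * (cos (l (snd z)) * E n (snd z)) \<partial>(?K \<Otimes>\<^sub>M ?K))
     + (\<integral>z. (sin (l (fst z)) * E n (fst z)) * (sin (l (snd z)) * E n (snd z)) \<partial>(?K \<Otimes>\<^sub>M ?K))"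
    unfolding f_def g_def
    by (intro arg_cong2[where f="(+)"] integral_pair_product(1) prob_space_qvec bd) measurable
  also have "\<dots> = (\<integral>z. (cos (l (fst z)) * E n (fst z)) * (cos (l (snd z)) * E n (snd z))
     + (sin (l (fst z)) * E n (fst z)) * (sin (l (snd z)) * E n (snd z)) \<partial>(?K \<Otimes>\<^sub>M ?K))"
    by (intro Bochner_Integration.integral_add[symmetric] integral_pair_product(2) prob_space_qvec bd) measurable
  also have "\<dots> = (\<integral>z. cos (l (fst z) - l (snd z)) * (E n (fst z) * E n (snd z)) \<partial>(?K \<Otimes>\<^sub>M ?K))"
    by (simp add: cos_diff algebra_simps)
  also have "\<dots> = (\<integral>z. cos (l (fst z) - l (snd z)) * (E n (fst z) * E n (snd z))
      \<partial>distr (?K \<Otimes>\<^sub>M ?K) (?K \<Otimes>\<^sub>M ?K) (givens_col R (1 / sqrt 2) (of_real (1 / sqrt 2))))"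
    by (subst distr_givens_col[OF R _ c]) auto
  also have "\<dots> = (\<integral>z. (cos (sqrt 2 * l (fst z)) * E (\<lambda>_. 0) (fst z)) * E (\<lambda>j. sqrt 2 *\<^sub>R n j) (snd z) \<partial>(?K \<Otimes>\<^sub>M ?K))"
    by (subst integral_distr, measurable) (rule Bochner_Integration.integral_cong[OF refl], rule rot, simp)
  also have "\<dots> = x * y"
    unfolding x_def y_def by (intro integral_pair_product(1)[symmetric] prob_space_qvec bd E_abs) measurable
  finally have fxy: "f\<^sup>2 \<le> x * y" .
  \<comment> \<open>The sign of \<open>x\<close>, an integral of an oscillating function, is not
    visible directly. It follows from \<open>0 \<le> x * y\<close> once \<open>y\<close> is known to
    be strictly positive, and then the square root may be taken in the AM-GM bound.\<close>
  have "integrable ?K (E (\<lambda>j. sqrt 2 *\<^sub>R n j))"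
    by (rule P.integrable_const_bound[where B=1]) (auto simp: E_abs)
  then have "(\<integral>b. 0 \<partial>?K) < y"
    unfolding y_def using Epos by (intro P.integral_less_AE_space) (auto simp: P.emeasure_space_1)
  then have "y > 0" by simp
  moreover have "0 \<le> x * y" using fxy zero_le_power2[of f] by linarith
  ultimately have "x \<ge> 0" by (simp add: zero_le_mult_iff)
  have "f\<^sup>2 \<le> ((x + y) / 2)\<^sup>2"
    using fxy sum_squares_bound[of x y] by (simp add: power2_eq_square field_simps)
  then have "f \<le> (x + y) / 2"
    by (rule power2_le_imp_le) (use \<open>x \<ge> 0\<close> \<open>y > 0\<close> in simp)
  then show ?thesis unfolding f_def x_def y_def E_def by simp
qed

subsection \<open>The Cayley determinant as a function of its columns\<close>

text \<open>The Cayley determinant of an entry function, so that columns can be replaced and the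
  size lowered without matrix dimensions.\<close>

definition cdet :: "nat \<Rightarrow> (nat \<Rightarrow> nat \<Rightarrow> quat) \<Rightarrow> quat" where
  "cdet n A = (\<Sum>p | p permutes {0..<n}. of_int (sign p) * prod_list (map (\<lambda>i. A i (p i)) [0..<n]))"

lemma cdet_cong:
  assumes "\<And>i j. i < n \<Longrightarrow> j < n \<Longrightarrow> A i j = B i j"
  shows "cdet n A = cdet n B"
  unfolding cdet_def
proof (intro sum.cong refl arg_cong2[where f="(*)"] arg_cong[where f=prod_list] map_cong)
  fix p i assume "p \<in> {p. p permutes {0..<n}}" "i \<in> set [0..<n]"
  then have "i < n" "p i < n" by (auto dest: permutes_in_image[of p "{0..<n}" i])
  then show "A i (p i) = B i (p i)" by (rule assms)
qed

lemma Cdet_eq_cdet: "A \<in> carrier_mat n n \<Longrightarrow> Cdet A = cdet n (\<lambda>i j. A $$ (i, j))"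
  by (simp add: Cdet_def cdet_def)

text \<open>Only the factor at \<open>i\<close> differs, and the factors to its left and right are
  common, so the two distributive laws suffice without commutativity.\<close>

lemma prod_list_map_add:
  fixes f g h :: "'b \<Rightarrow> 'a::ring_1"
  assumes "distinct xs" "i \<in> set xs" "h i = f i + g i"
    and "\<And>j. j \<in> set xs \<Longrightarrow> j \<noteq> i \<Longrightarrow> f j = h j \<and> g j = h j"
  shows "prod_list (map h xs) = prod_list (map f xs) + prod_list (map g xs)"
  using assms
proof (induction xs)
  case (Cons a xs)
  show ?case
  proof (cases "a = i")
    case True
    have eq: "f x = h x \<and> g x = h x" if "x \<in> set xs" for x
      using Cons.prems True that by (metis distinct.simps(2) list.set_intros(2))
    then have "prod_list (map f xs) = prod_list (map h xs)" "prod_list (map g xs) = prod_list (map h xs)"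
      using eq by (auto intro!: arg_cong[where f=prod_list])
    then show ?thesis using True Cons.prems by (simp add: distrib_right)
  next
    case False
    then show ?thesis using Cons by (simp add: distrib_left)
  qed
qed simp

lemma prod_list_map_scaleR:
  fixes f h :: "'b \<Rightarrow> 'a::real_algebra_1"
  assumes "distinct xs" "i \<in> set xs" "h i = r *\<^sub>R f i"
    and "\<And>j. j \<in> set xs \<Longrightarrow> j \<noteq> i \<Longrightarrow> f j = h j"
  shows "prod_list (map h xs) = r *\<^sub>R prod_list (map f xs)"
  using assms
proof (induction xs)
  case (Cons a xs)
  show ?case
  proof (cases "a = i")
    case True
    have eq: "f x = h x" if "x \<in> set xs" for x
      using Cons.prems True that by (metis distinct.simps(2) list.set_intros(2))
    then have "prod_list (map f xs) = prod_list (map h xs)"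
      by (auto intro!: arg_cong[where f=prod_list])
    then show ?thesis using True Cons.prems by simp
  next
    case False
    then show ?thesis using Cons by simp
  qed
qed simp

lemma prod_list_eq_0: "0 \<in> set xs \<Longrightarrow> prod_list xs = (0 :: 'a::ring_1)"
  by (induction xs) auto

definition set_col :: "(nat \<Rightarrow> nat \<Rightarrow> quat) \<Rightarrow> nat \<Rightarrow> (nat \<Rightarrow> quat) \<Rightarrow> nat \<Rightarrow> nat \<Rightarrow> quat" where
  "set_col A k x = (\<lambda>i j. if j = k then x i else A i j)"

lemma permutes_inv_index:
  fixes p :: "nat \<Rightarrow> nat"
  assumes "p permutes {0..<n}" "k < n"
  shows "Hilbert_Choice.inv p k < n" "\<And>i. p i = k \<longleftrightarrow> i = Hilbert_Choice.inv p k"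
  using assms permutes_in_image[OF permutes_inv[OF assms(1)], of k] permutes_inverses[OF assms(1)]
  by auto

text \<open>The term of a permutation \<open>p\<close> meets column \<open>k\<close> exactly once,
  in row \<open>inv p k\<close>.\<close>

lemma cdet_set_col_add:
  assumes "k < n"
  shows "cdet n (set_col A k (\<lambda>i. x i + y i)) = cdet n (set_col A k x) + cdet n (set_col A k y)"
  unfolding cdet_def sum.distrib[symmetric] distrib_left[symmetric]
  by (intro sum.cong refl arg_cong2[where f="(*)"] prod_list_map_add[where i="Hilbert_Choice.inv _ k"])
     (use permutes_inv_index[OF _ assms] in \<open>auto simp: set_col_def\<close>)

lemma cdet_set_col_scaleR:
  assumes "k < n"
  shows "cdet n (set_col A k (\<lambda>i. r *\<^sub>R x i)) = r *\<^sub>R cdet n (set_col A k x)"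
  unfolding cdet_def scaleR_sum_right mult_scaleR_right[symmetric]
  by (intro sum.cong refl arg_cong2[where f="(*)"] prod_list_map_scaleR[where i="Hilbert_Choice.inv _ k"])
     (use permutes_inv_index[OF _ assms] in \<open>auto simp: set_col_def\<close>)

lemma cdet_set_col_lincomb:
  assumes "k < n"
  shows "cdet n (set_col A k (\<lambda>i. p *\<^sub>R x i + q *\<^sub>R y i)) = p *\<^sub>R cdet n (set_col A k x) + q *\<^sub>R cdet n (set_col A k y)"
  using assms by (simp add: cdet_set_col_add cdet_set_col_scaleR)

lemma cdet_set_col_sum:
  assumes "k < n" "finite S"
  shows "cdet n (set_col A k (\<lambda>i. \<Sum>r\<in>S. x r i)) = (\<Sum>r\<in>S. cdet n (set_col A k (x r)))"
  using assms(2)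
proof (induction S rule: finite_induct)
  case empty
  show ?case using cdet_set_col_scaleR[OF assms(1), of A 0 "\<lambda>_. 0"] by simp
next
  case (insert r S)
  then show ?case by (simp add: cdet_set_col_add[OF assms(1)])
qed

text \<open>The rows fix the order of the noncommuting factors, so exchanging two columns merely
  reindexes the sum by composing each permutation with a transposition, which flips its
  sign.\<close>

lemma cdet_swap:
  assumes "i < n" "j < n" "i \<noteq> j"
  shows "cdet n (\<lambda>r k. A r (Transposition.transpose i j k)) = - cdet n A"
proof -
  have t: "Transposition.transpose i j permutes {0..<n}" by (rule permutes_swap_id) (use assms in auto)
  have "cdet n (\<lambda>r k. A r (Transposition.transpose i j k)) = (\<Sum>p | p permutes {0..<n}. - (of_int (sign p) * prod_list (map (\<lambda>r. A r (p r)) [0..<n])))"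
    unfolding cdet_def
  proof (rule sum.reindex_bij_witness[where i="\<lambda>p. Transposition.transpose i j \<circ> p" and j="\<lambda>p. Transposition.transpose i j \<circ> p"])
    fix p assume p: "p \<in> {p. p permutes {0..<n}}"
    then have "permutation p" by (auto intro: permutation_permutes[THEN iffD2])
    then have s: "sign (Transposition.transpose i j \<circ> p) = - sign p"
      using assms by (simp add: sign_compose permutation_swap_id sign_swap_id)
    show "- (of_int (sign (Transposition.transpose i j \<circ> p)) * prod_list (map (\<lambda>r. A r ((Transposition.transpose i j \<circ> p) r)) [0..<n]))
        = of_int (sign p) * prod_list (map (\<lambda>i'. A i' (Transposition.transpose i j (p i'))) [0..<n])"
      unfolding s by simp
  qed (use t in \<open>auto simp: fun_eq_iff intro: permutes_compose\<close>)
  then show ?thesis by (simp add: cdet_def sum_negf)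
qed

lemma cdet_swap_cols:
  assumes "i < n" "j < n" "i \<noteq> j"
  shows "cdet n (set_col (set_col A i y) j x) = - cdet n (set_col (set_col A i x) j y)"
proof -
  have "set_col (set_col A i y) j x = (\<lambda>r k. set_col (set_col A i x) j y r (Transposition.transpose i j k))"
    using assms(3) by (auto simp: set_col_def fun_eq_iff transpose_def)
  then show ?thesis using cdet_swap[OF assms, of "set_col (set_col A i x) j y"] by simp
qed

lemma cdet_eq_cols:
  assumes "i < n" "j < n" "i \<noteq> j"
  shows "cdet n (set_col (set_col A i x) j x) = 0"
proof -
  have "cdet n (set_col (set_col A i x) j x) = - cdet n (set_col (set_col A i x) j x)"
    by (rule cdet_swap_cols[OF assms])
  then show ?thesis by (simp add: quat_eq_iff)
qed

lemma set_col_commute: "i \<noteq> j \<Longrightarrow> set_col (set_col A i x) j y = set_col (set_col A j y) i x"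
  by (auto simp: set_col_def fun_eq_iff)

text \<open>Real coefficients can be pulled out of the ordered products. Bilinear and alternating in
  the two columns, the value is multiplied by the determinant \<open>c\<^sup>2 + s\<^sup>2\<close>
  of the real rotation.\<close>

lemma cdet_rotate_cols:
  assumes "i < n" "j < n" "i \<noteq> j" "c\<^sup>2 + s\<^sup>2 = 1"
  shows "cdet n (set_col (set_col A i (\<lambda>r. c *\<^sub>R x r + s *\<^sub>R y r)) j (\<lambda>r. c *\<^sub>R y r + (- s) *\<^sub>R x r))
    = cdet n (set_col (set_col A i x) j y)"
proof -
  define C where "C x y = cdet n (set_col (set_col A i x) j y)" for x y
  have l: "C (\<lambda>r. p *\<^sub>R x r + q *\<^sub>R y r) z = p *\<^sub>R C x z + q *\<^sub>R C y z" for p q x y z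
    unfolding C_def set_col_commute[OF assms(3)] by (rule cdet_set_col_lincomb) fact
  have r: "C z (\<lambda>r. p *\<^sub>R x r + q *\<^sub>R y r) = p *\<^sub>R C z x + q *\<^sub>R C z y" for p q x y z
    unfolding C_def by (rule cdet_set_col_lincomb) fact
  have "C (\<lambda>r. c *\<^sub>R x r + s *\<^sub>R y r) (\<lambda>r. c *\<^sub>R y r + (- s) *\<^sub>R x r) = (c\<^sup>2 + s\<^sup>2) *\<^sub>R C x y"
    unfolding l r using cdet_eq_cols[OF assms(1-3), of A] cdet_swap_cols[OF assms(1-3), of A y x]
    by (simp add: C_def power2_eq_square algebra_simps)
  then show ?thesis using assms(4) by (simp add: C_def)
qed

text \<open>Each permutation meets the columns \<open>i\<close> and \<open>j\<close> in two
  different rows, at least one of which is not \<open>m\<close> and contributes a zero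
  factor.\<close>

lemma cdet_two_unit_cols:
  assumes "i < n" "j < n" "i \<noteq> j" "\<And>r. r \<noteq> m \<Longrightarrow> x r = 0" "\<And>r. r \<noteq> m \<Longrightarrow> y r = 0"
  shows "cdet n (set_col (set_col A i x) j y) = 0"
  unfolding cdet_def
proof (intro sum.neutral ballI)
  fix p assume "p \<in> {p. p permutes {0..<n}}"
  then have p: "p permutes {0..<n}" by simp
  note i = permutes_inv_index[OF p assms(1)] and j = permutes_inv_index[OF p assms(2)]
  have "Hilbert_Choice.inv p i \<noteq> Hilbert_Choice.inv p j" using assms(3) i(2) j(2) by metis
  then obtain r where "r < n" "r \<noteq> m" "r = Hilbert_Choice.inv p i \<or> r = Hilbert_Choice.inv p j"
    using i(1) j(1) by metis
  then have "set_col (set_col A i x) j y r (p r) = 0"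
    using assms i(2) j(2) by (auto simp: set_col_def)
  then have "prod_list (map (\<lambda>r. set_col (set_col A i x) j y r (p r)) [0..<n]) = 0"
    using \<open>r < n\<close> by (intro prod_list_eq_0) (auto simp: image_iff intro!: bexI[of _ r])
  then show "of_int (sign p) * prod_list (map (\<lambda>r. set_col (set_col A i x) j y r (p r)) [0..<n]) = 0"
    by simp
qed

text \<open>Only permutations fixing \<open>m\<close> survive. In the row order the last row gives
  the rightmost factor, so \<open>A m m\<close> comes out on the right.\<close>

lemma cdet_last_row:
  assumes "\<And>j. j < m \<Longrightarrow> A m j = 0"
  shows "cdet (Suc m) A = cdet m A * A m m"
proof -
  have "cdet (Suc m) A = (\<Sum>p | p permutes {0..<m}. of_int (sign p) * prod_list (map (\<lambda>i. A i (p i)) [0..<Suc m]))"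
    unfolding cdet_def
  proof (rule sum.mono_neutral_right)
    show "finite {p. p permutes {0..<Suc m}}" by (rule finite_permutations) simp
    show "{p. p permutes {0..<m}} \<subseteq> {p. p permutes {0..<Suc m}}"
      by (auto elim: permutes_subset)
    show "\<forall>p\<in>{p. p permutes {0..<Suc m}} - {p. p permutes {0..<m}}.
        of_int (sign p) * prod_list (map (\<lambda>i. A i (p i)) [0..<Suc m]) = 0"
    proof
      fix p assume p: "p \<in> {p. p permutes {0..<Suc m}} - {p. p permutes {0..<m}}"
      have "p m \<noteq> m"
      proof
        assume "p m = m"
        then have "p permutes {0..<m}"
          using p permutes_superset[of p "{0..<Suc m}" "{0..<m}"] by (auto simp: less_Suc_eq)
        then show False using p by simp
      qed
      moreover have "p m < Suc m" using p permutes_in_image[of p "{0..<Suc m}" m] by auto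
      ultimately have "A m (p m) = 0" by (intro assms) simp
      then show "of_int (sign p) * prod_list (map (\<lambda>i. A i (p i)) [0..<Suc m]) = 0" by simp
    qed
  qed
  also have "\<dots> = cdet m A * A m m"
    unfolding cdet_def sum_distrib_right
  proof (intro sum.cong refl)
    fix p assume "p \<in> {p. p permutes {0..<m}}"
    then have "p m = m" by (simp add: permutes_not_in)
    then show "of_int (sign p) * prod_list (map (\<lambda>i. A i (p i)) [0..<Suc m])
      = of_int (sign p) * prod_list (map (\<lambda>i. A i (p i)) [0..<m]) * A m m"
      by (simp add: mult.assoc)
  qed
  finally show ?thesis .
qed

lemma measurable_prod_list [measurable (raw)]:
  fixes f :: "'b \<Rightarrow> 'a \<Rightarrow> quat"
  assumes "\<And>i. i \<in> set xs \<Longrightarrow> f i \<in> borel_measurable N"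
  shows "(\<lambda>w. prod_list (map (\<lambda>i. f i w) xs)) \<in> borel_measurable N"
  using assms by (induction xs) auto

lemma measurable_cdet:
  assumes "\<And>i j. i < n \<Longrightarrow> j < n \<Longrightarrow> (\<lambda>w. A w i j) \<in> borel_measurable N"
  shows "(\<lambda>w. cdet n (A w)) \<in> borel_measurable N"
  unfolding cdet_def
proof (intro borel_measurable_sum borel_measurable_times borel_measurable_const measurable_prod_list)
  fix p i assume "p \<in> {p. p permutes {0..<n}}" "i \<in> set [0..<n]"
  then have "i < n" "p i < n" by (auto dest: permutes_in_image[of p "{0..<n}" i])
  then show "(\<lambda>w. A w i (p i)) \<in> borel_measurable N" by (rule assms)
qed

section \<open>Gaussian matrices sampled by columns\<close>

abbreviation qcols :: "nat \<Rightarrow> nat set \<Rightarrow> (nat \<Rightarrow> nat \<Rightarrow> quat) measure" where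
  "qcols m C \<equiv> \<Pi>\<^sub>M j\<in>C. qvec {..<m}"

lemma prob_space_qcols: "prob_space (qcols m C)"
  by (intro prob_space_PiM prob_space_qvec)

lemma product_sigma_finite_qvec: "product_sigma_finite (\<lambda>_::nat. qvec {..<m::nat})"
  by (rule product_sigma_finite.intro) (rule prob_space_imp_sigma_finite[OF prob_space_qvec])

lemma measurable_qcols_entry:
  "f \<in> N \<rightarrow>\<^sub>M qcols m C \<Longrightarrow> j \<in> C \<Longrightarrow> r < m \<Longrightarrow> (\<lambda>w. f w j r) \<in> borel_measurable N"
  by (rule measurable_qvec_component[where R="{..<m}"])
     (auto intro: measurable_compose[OF _ measurable_component_singleton])

text \<open>A sample \<open>X\<close> of \<open>qcols m C\<close> is indexed by column first: \<open>X j i\<close> is the entry in row \<open>i\<close> and column \<open>j\<close>.\<close>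

definition rotate_cols :: "nat \<Rightarrow> nat \<Rightarrow> nat \<Rightarrow> real \<Rightarrow> quat \<Rightarrow> (nat \<Rightarrow> nat \<Rightarrow> quat) \<Rightarrow> nat \<Rightarrow> nat \<Rightarrow> quat" where
  "rotate_cols m i j c s X = X(i := fst (givens_col {..<m} c s (X i, X j)), j := snd (givens_col {..<m} c s (X i, X j)))"

lemma measurable_rotate_cols:
  assumes "i \<in> C" "j \<in> C"
  shows "rotate_cols m i j c s \<in> qcols m C \<rightarrow>\<^sub>M qcols m C"
proof -
  have [measurable]: "(\<lambda>X. X i) \<in> qcols m C \<rightarrow>\<^sub>M qvec {..<m}" "(\<lambda>X. X j) \<in> qcols m C \<rightarrow>\<^sub>M qvec {..<m}"
    by (rule measurable_component_singleton, fact)+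
  have g: "(\<lambda>X. givens_col {..<m} c s (X i, X j)) \<in> qcols m C \<rightarrow>\<^sub>M qvec {..<m} \<Otimes>\<^sub>M qvec {..<m}"
    by (rule measurable_compose[OF _ measurable_givens_col]) measurable
  show ?thesis
    unfolding rotate_cols_def[abs_def]
    by (rule measurable_fun_upd[where J=C], use assms in blast, rule measurable_fun_upd[where J=C], use assms in blast)
       (auto intro: measurable_compose[OF g measurable_fst] measurable_compose[OF g measurable_snd])
qed

text \<open>Tonelli isolates the columns \<open>i\<close> and \<open>j\<close>; with all other
  columns fixed this is \<open>nn_integral_givens_col\<close>.\<close>

lemma distr_rotate_cols:
  assumes C: "finite C" "i \<in> C" "j \<in> C" "i \<noteq> j" and c: "c > 0" and cs: "c\<^sup>2 + (norm s)\<^sup>2 = 1"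
  shows "distr (qcols m C) (qcols m C) (rotate_cols m i j c s) = qcols m C"
proof (rule measure_eqI)
  interpret product_sigma_finite "\<lambda>_::nat. qvec {..<m::nat}" by (rule product_sigma_finite_qvec)
  interpret K: sigma_finite_measure "qvec {..<m}" by (rule prob_space_imp_sigma_finite[OF prob_space_qvec])
  note [measurable] = measurable_rotate_cols[OF C(2,3)]
  define D where "D = C - {i, j}"
  have D: "C = insert j (insert i D)" "finite D" "i \<notin> D" "j \<notin> insert i D"
    using C by (auto simp: D_def)
  have expand: "(\<integral>\<^sup>+X. F X \<partial>qcols m C) = (\<integral>\<^sup>+X. \<integral>\<^sup>+a. \<integral>\<^sup>+b. F (X(i := a, j := b)) \<partial>qvec {..<m} \<partial>qvec {..<m} \<partial>qcols m D)"
    if [measurable]: "F \<in> borel_measurable (qcols m C)" for F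
  proof -
    note F = that[unfolded D(1)]
    have [measurable]: "(\<lambda>w. (f w)(j := g w)) \<in> N \<rightarrow>\<^sub>M qcols m (insert j (insert i D))"
      if "f \<in> N \<rightarrow>\<^sub>M qcols m (insert i D)" "g \<in> N \<rightarrow>\<^sub>M qvec {..<m}" for f g and N :: "'n measure"
      by (rule measurable_fun_upd[where J="insert i D", OF _ that]) auto
    have "(\<integral>\<^sup>+X. F X \<partial>qcols m C) = (\<integral>\<^sup>+X. \<integral>\<^sup>+b. F (X(j := b)) \<partial>qvec {..<m} \<partial>qcols m (insert i D))"
      unfolding D(1) by (rule product_nn_integral_insert) (use D F in auto)
    also have "\<dots> = (\<integral>\<^sup>+X. \<integral>\<^sup>+a. \<integral>\<^sup>+b. F ((X(i := a))(j := b)) \<partial>qvec {..<m} \<partial>qvec {..<m} \<partial>qcols m D)"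
    proof (rule product_nn_integral_insert)
      show "(\<lambda>X. \<integral>\<^sup>+b. F (X(j := b)) \<partial>qvec {..<m}) \<in> borel_measurable (qcols m (insert i D))"
        using F by measurable
    qed (use D in auto)
    finally show ?thesis by simp
  qed
  fix A assume "A \<in> sets (distr (qcols m C) (qcols m C) (rotate_cols m i j c s))"
  then have [measurable]: "A \<in> sets (qcols m C)" by simp
  let ?K = "qvec {..<m}"
  have "emeasure (distr (qcols m C) (qcols m C) (rotate_cols m i j c s)) A
     = (\<integral>\<^sup>+X. indicator A X \<partial>distr (qcols m C) (qcols m C) (rotate_cols m i j c s))"
    by simp
  also have "\<dots> = (\<integral>\<^sup>+X. indicator A (rotate_cols m i j c s X) \<partial>qcols m C)"
    by (rule nn_integral_distr) measurable
  also have "\<dots> = (\<integral>\<^sup>+X. \<integral>\<^sup>+a. \<integral>\<^sup>+b. indicator A (rotate_cols m i j c s (X(i := a, j := b))) \<partial>?K \<partial>?K \<partial>qcols m D)"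
    by (rule expand) measurable
  also have "\<dots> = (\<integral>\<^sup>+X. \<integral>\<^sup>+a. \<integral>\<^sup>+b. indicator A (X(i := a, j := b)) \<partial>?K \<partial>?K \<partial>qcols m D)"
  proof (rule nn_integral_cong)
    fix X assume X: "X \<in> space (qcols m D)"
    have eq: "rotate_cols m i j c s (X(i := a, j := b)) = X(i := fst (givens_col {..<m} c s (a, b)), j := snd (givens_col {..<m} c s (a, b)))" for a b
      using C(4) by (auto simp: rotate_cols_def fun_eq_iff)
    have "(\<lambda>z. (X(i := fst z))(j := snd z)) \<in> ?K \<Otimes>\<^sub>M ?K \<rightarrow>\<^sub>M qcols m (insert j (insert i D))"
      by (rule measurable_fun_upd[where J="insert i D"], blast, rule measurable_fun_upd[where J=D], blast) (use X in auto)
    then have "(\<lambda>z. indicator A (X(i := fst z, j := snd z)) :: ennreal) \<in> borel_measurable (?K \<Otimes>\<^sub>M ?K)"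
      unfolding D(1)[symmetric] by measurable
    from nn_integral_givens_col[OF _ c cs this]
    show "(\<integral>\<^sup>+a. \<integral>\<^sup>+b. indicator A (rotate_cols m i j c s (X(i := a, j := b))) \<partial>?K \<partial>?K)
      = (\<integral>\<^sup>+a. \<integral>\<^sup>+b. indicator A (X(i := a, j := b)) \<partial>?K \<partial>?K)"
      unfolding eq by simp
  qed
  also have "\<dots> = (\<integral>\<^sup>+X. indicator A X \<partial>qcols m C)"
    by (rule expand[symmetric]) measurable
  also have "\<dots> = emeasure (qcols m C) A" by simp
  finally show "emeasure (distr (qcols m C) (qcols m C) (rotate_cols m i j c s)) A = emeasure (qcols m C) A" .
qed simp

lemma integral_rotate_cols:
  fixes F :: "(nat \<Rightarrow> nat \<Rightarrow> quat) \<Rightarrow> real"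
  assumes "finite C" "i \<in> C" "j \<in> C" "i \<noteq> j" "c > 0" "c\<^sup>2 + (norm s)\<^sup>2 = 1" "F \<in> borel_measurable (qcols m C)"
  shows "(\<integral>X. F (rotate_cols m i j c s X) \<partial>qcols m C) = (\<integral>X. F X \<partial>qcols m C)"
  using integral_distr[OF measurable_rotate_cols[OF assms(2,3), of m c s] assms(7)]
  unfolding distr_rotate_cols[OF assms(1-6)] by simp

text \<open>The Gaussian matrix conditioned on its last row \<theta>. The indices of
  \<open>X\<close> are exchanged because samples are stored by columns while \<open>cdet\<close>
  reads the row first.\<close>

definition add_row :: "nat \<Rightarrow> (nat \<Rightarrow> quat) \<Rightarrow> (nat \<Rightarrow> nat \<Rightarrow> quat) \<Rightarrow> nat \<Rightarrow> nat \<Rightarrow> quat" where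
  "add_row m \<theta> X = (\<lambda>i j. if i = m then \<theta> j else X j i)"

lemma measurable_cdet_add_row:
  assumes "f \<in> N \<rightarrow>\<^sub>M qcols m {..<Suc m}"
  shows "(\<lambda>w. cdet (Suc m) (add_row m \<theta> (f w))) \<in> borel_measurable N"
  unfolding add_row_def
  by (rule measurable_cdet) (auto intro!: measurable_qcols_entry[OF assms] simp: less_Suc_eq)

subsection \<open>Merging two entries of the last row\<close>

text \<open>With \<open>unit_col\<close> this splits a column into its random upper part and its
  fixed last entry, both defined on all rows so that they can be added.\<close>

definition zero_ext :: "nat \<Rightarrow> (nat \<Rightarrow> quat) \<Rightarrow> nat \<Rightarrow> quat" where
  "zero_ext m b = (\<lambda>r. if r < m then b r else 0)"

definition unit_col :: "nat \<Rightarrow> quat \<Rightarrow> nat \<Rightarrow> quat" where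
  "unit_col r q = (\<lambda>i. if i = r then q else 0)"

text \<open>For fixed \<open>b\<close> the phase is affine in \<open>a\<close>. Its constant part
  comes from \<open>p\<close> and does not involve \<open>q\<close>, because no term contains two
  entries of the last row. The coefficient \<open>v r y\<close> represents the real functional
  sending \<open>q\<close> to \<open>\<eta> \<bullet> C (unit_col r q) y\<close>, so
  \<open>integral_cos_qvec\<close> integrates \<open>a\<close> out.\<close>

lemma col_integral_cos:
  fixes A :: "nat \<Rightarrow> nat \<Rightarrow> quat" and \<eta> p q :: quat
  assumes ij: "i < Suc m" "j < Suc m" "i \<noteq> j"
  defines "C \<equiv> \<lambda>x y. cdet (Suc m) (set_col (set_col A i x) j y)"
  defines "v \<equiv> \<lambda>r y. \<Sum>e\<in>Basis. (\<eta> \<bullet> C (unit_col r e) y) *\<^sub>R e"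
  shows "(\<integral>a. cos (\<eta> \<bullet> C (a(m := p)) (b(m := q))) \<partial>qvec {..<m})
    = cos (\<eta> \<bullet> C (unit_col m p) (zero_ext m b)) *
      exp (- (\<Sum>r<m. (norm (v r (zero_ext m b) + v r (unit_col m q)))\<^sup>2) / 8)"
proof -
  have C_cong: "C x y = C x' y'" if "\<And>r. r < Suc m \<Longrightarrow> x r = x' r" "\<And>r. r < Suc m \<Longrightarrow> y r = y' r" for x y x' y'
    unfolding C_def by (rule cdet_cong) (use that in \<open>auto simp: set_col_def\<close>)
  have Cl_add: "C (\<lambda>r. x r + x' r) y = C x y + C x' y" for x x' y
    unfolding C_def set_col_commute[OF ij(3)] by (rule cdet_set_col_add) fact
  have Cr_add: "C x (\<lambda>r. y r + y' r) = C x y + C x y'" for x y y'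
    unfolding C_def by (rule cdet_set_col_add) fact
  have Cl_scale: "C (\<lambda>r. t *\<^sub>R x r) y = t *\<^sub>R C x y" for t x y
    unfolding C_def set_col_commute[OF ij(3)] by (rule cdet_set_col_scaleR) fact
  have Cl_sum: "C (\<lambda>r. \<Sum>k\<in>S. x k r) y = (\<Sum>k\<in>S. C (x k) y)" if "finite S" for S :: "'s set" and x y
    unfolding C_def set_col_commute[OF ij(3)] by (rule cdet_set_col_sum) fact+
  have v_inner: "\<eta> \<bullet> C (unit_col r q) y = v r y \<bullet> q" for r q y
  proof -
    have "unit_col r q = (\<lambda>k. \<Sum>e\<in>Basis. (q \<bullet> e) *\<^sub>R unit_col r e k)"
      by (auto simp: unit_col_def fun_eq_iff euclidean_representation)
    then have "C (unit_col r q) y = (\<Sum>e\<in>Basis. (q \<bullet> e) *\<^sub>R C (unit_col r e) y)"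
      by (simp only: Cl_sum[OF finite_Basis] Cl_scale)
    then show ?thesis
      by (simp add: v_def inner_sum_right inner_sum_left inner_commute mult.commute)
  qed
  have v_add: "v r (\<lambda>k. y k + y' k) = v r y + v r y'" for r y y'
    by (simp add: v_def Cr_add inner_add_right scaleR_add_left sum.distrib)
  have b: "C x (b(m := q)) = C x (\<lambda>r. zero_ext m b r + unit_col m q r)" for x
    by (rule C_cong) (auto simp: zero_ext_def unit_col_def)
  have a: "C (a(m := p)) y = C (unit_col m p) y + (\<Sum>r<m. C (unit_col r (a r)) y)" for a y
  proof -
    have "C (a(m := p)) y = C (\<lambda>k. unit_col m p k + (\<Sum>r<m. unit_col r (a r) k)) y"
      by (rule C_cong) (auto simp: unit_col_def)
    then show ?thesis by (simp only: Cl_add Cl_sum[OF finite_lessThan])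
  qed
  have z: "C (unit_col m p) (unit_col m q) = 0"
    unfolding C_def by (rule cdet_two_unit_cols[OF ij, where m=m]) (auto simp: unit_col_def)
  have T: "\<eta> \<bullet> C (a(m := p)) (b(m := q)) = \<eta> \<bullet> C (unit_col m p) (zero_ext m b)
      + (\<Sum>r<m. (v r (zero_ext m b) + v r (unit_col m q)) \<bullet> a r)" for a
    unfolding b a inner_add_right inner_sum_right v_inner v_add Cr_add z
    by (simp add: inner_add_left sum.distrib)
  show ?thesis unfolding T by (rule integral_cos_qvec) simp
qed

text \<open>\<open>qvec_merge_inequality\<close> with \<open>l\<close> the phase contributed by
  \<open>p\<close>, \<open>W r\<close> the upper part of \<open>b\<close> seen through
  \<open>v r\<close>, and \<open>n r = v r (unit_col m q)\<close>. Setting one of \<open>p\<close>,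
  \<open>q\<close> to zero and scaling the other by \<open>sqrt 2\<close> yields exactly the two
  integrals on its right-hand side.\<close>

lemma col_merge_inequality:
  fixes A :: "nat \<Rightarrow> nat \<Rightarrow> quat" and \<eta> p q :: quat
  assumes ij: "i < Suc m" "j < Suc m" "i \<noteq> j"
  defines "C \<equiv> \<lambda>x y. cdet (Suc m) (set_col (set_col A i x) j y)"
  shows "(\<integral>b. \<integral>a. cos (\<eta> \<bullet> C (a(m := p)) (b(m := q))) \<partial>qvec {..<m} \<partial>qvec {..<m})
    \<le> ((\<integral>b. \<integral>a. cos (\<eta> \<bullet> C (a(m := sqrt 2 *\<^sub>R p)) (b(m := 0))) \<partial>qvec {..<m} \<partial>qvec {..<m})
      + (\<integral>b. \<integral>a. cos (\<eta> \<bullet> C (a(m := 0)) (b(m := sqrt 2 *\<^sub>R q))) \<partial>qvec {..<m} \<partial>qvec {..<m})) / 2"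
proof -
  define v where "v r y = (\<Sum>e\<in>Basis. (\<eta> \<bullet> C (unit_col r e) y) *\<^sub>R e)" for r y
  have int: "(\<integral>a. cos (\<eta> \<bullet> C (a(m := p)) (b(m := q))) \<partial>qvec {..<m})
    = cos (\<eta> \<bullet> C (unit_col m p) (zero_ext m b)) *
      exp (- (\<Sum>r<m. (norm (v r (zero_ext m b) + v r (unit_col m q)))\<^sup>2) / 8)" for p q b
    unfolding v_def C_def by (rule col_integral_cos[OF ij])
  have Cr: "C x (\<lambda>r. p *\<^sub>R y r + q *\<^sub>R y' r) = p *\<^sub>R C x y + q *\<^sub>R C x y'" for p q x y y'
    unfolding C_def by (rule cdet_set_col_lincomb) fact
  have Cl: "C (\<lambda>r. p *\<^sub>R x r + q *\<^sub>R x' r) y = p *\<^sub>R C x y + q *\<^sub>R C x' y" for p q x x' y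
    unfolding C_def set_col_commute[OF ij(3)] by (rule cdet_set_col_lincomb) fact
  have C0: "C (unit_col m 0) y = 0" for y
    using Cl[of 0 "unit_col m 0" 0 "unit_col m 0" y] by (simp add: unit_col_def)
  have Csq: "C (unit_col m (sqrt 2 *\<^sub>R p)) y = sqrt 2 *\<^sub>R C (unit_col m p) y" for y
  proof -
    have "unit_col m (sqrt 2 *\<^sub>R p) = (\<lambda>r. sqrt 2 *\<^sub>R unit_col m p r + 0 *\<^sub>R unit_col m p r)"
      by (auto simp: unit_col_def)
    then show ?thesis using Cl[of "sqrt 2" "unit_col m p" 0 "unit_col m p" y] by (simp only:) simp
  qed
  have v_lin: "v r (\<lambda>k. p *\<^sub>R y k + q *\<^sub>R y' k) = p *\<^sub>R v r y + q *\<^sub>R v r y'" for p q r y y'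
    by (simp add: v_def Cr inner_add_right scaleR_add_left scaleR_sum_right sum.distrib)
  have v0: "v r (unit_col m 0) = 0" for r
    using v_lin[of r 0 "unit_col m 0" 0 "unit_col m 0"] by (simp add: unit_col_def)
  have vsq: "v r (unit_col m (sqrt 2 *\<^sub>R q)) = sqrt 2 *\<^sub>R v r (unit_col m q)" for r
  proof -
    have "unit_col m (sqrt 2 *\<^sub>R q) = (\<lambda>r. sqrt 2 *\<^sub>R unit_col m q r + 0 *\<^sub>R unit_col m q r)"
      by (auto simp: unit_col_def)
    then show ?thesis using v_lin[of r "sqrt 2" "unit_col m q" 0 "unit_col m q"] by (simp only:) simp
  qed
  have ze: "zero_ext m (\<lambda>r\<in>{..<m}. p *\<^sub>R x r + q *\<^sub>R y r) = (\<lambda>r. p *\<^sub>R zero_ext m x r + q *\<^sub>R zero_ext m y r)" for p q x y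
    by (auto simp: zero_ext_def fun_eq_iff)
  have Cm[measurable]: "(\<lambda>b. C x (zero_ext m b)) \<in> borel_measurable (qvec {..<m})" for x
    unfolding C_def
  proof (rule measurable_cdet)
    fix r k
    show "(\<lambda>b. set_col (set_col A i x) j (zero_ext m b) r k) \<in> borel_measurable (qvec {..<m})"
      by (cases "k = j"; cases "r < m")
         (auto simp: set_col_def zero_ext_def intro!: measurable_qvec_component[where R="{..<m}"])
  qed
  have "(\<integral>b. cos (\<eta> \<bullet> C (unit_col m p) (zero_ext m b)) *
      exp (- (\<Sum>r<m. (norm (v r (zero_ext m b) + v r (unit_col m q)))\<^sup>2) / 8) \<partial>qvec {..<m})
    \<le> ((\<integral>b. cos (sqrt 2 * (\<eta> \<bullet> C (unit_col m p) (zero_ext m b))) *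
      exp (- (\<Sum>r<m. (norm (v r (zero_ext m b)))\<^sup>2) / 8) \<partial>qvec {..<m})
      + (\<integral>b. exp (- (\<Sum>r<m. (norm (v r (zero_ext m b) + sqrt 2 *\<^sub>R v r (unit_col m q)))\<^sup>2) / 8) \<partial>qvec {..<m})) / 2"
  proof (rule qvec_merge_inequality)
    show "(\<lambda>b. v r (zero_ext m b)) \<in> borel_measurable (qvec {..<m})" for r
      unfolding v_def by measurable
  qed (auto simp: ze Cr v_lin inner_add_right)
  then show ?thesis
    unfolding int by (simp add: C0 Csq v0 vsq)
qed

lemma (in prob_space) integrable_abs_le_1:
  fixes f :: "'a \<Rightarrow> real"
  assumes "f \<in> borel_measurable M" "\<And>x. \<bar>f x\<bar> \<le> 1"
  shows "integrable M f"
  by (rule integrable_const_bound[where B=1]) (use assms in auto)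

lemma (in prob_space) abs_integral_le_1:
  fixes f :: "'a \<Rightarrow> real"
  assumes "f \<in> borel_measurable M" "\<And>x. \<bar>f x\<bar> \<le> 1"
  shows "\<bar>\<integral>x. f x \<partial>M\<bar> \<le> 1"
proof -
  have "\<bar>\<integral>x. f x \<partial>M\<bar> \<le> (\<integral>x. \<bar>f x\<bar> \<partial>M)" by (rule integral_abs_bound)
  also have "\<dots> \<le> (\<integral>x. 1 \<partial>M)"
    by (rule integral_mono) (use assms integrable_abs_le_1[OF assms] in auto)
  finally show ?thesis by (simp add: prob_space)
qed

text \<open>Fubini with the columns \<open>i\<close> and \<open>j\<close> innermost. The second
  claim allows a pointwise inequality between the inner integrals to be integrated over the other
  columns.\<close>

lemma integral_qcols_insert2:
  fixes F :: "(nat \<Rightarrow> nat \<Rightarrow> quat) \<Rightarrow> real"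
  assumes D: "finite D" "i \<notin> D" "j \<notin> D" "i \<noteq> j"
    and F: "F \<in> borel_measurable (qcols m (insert i (insert j D)))" and F1: "\<And>X. \<bar>F X\<bar> \<le> 1"
  shows "(\<integral>X. F X \<partial>qcols m (insert i (insert j D)))
      = (\<integral>X. \<integral>b. \<integral>a. F (X(j := b, i := a)) \<partial>qvec {..<m} \<partial>qvec {..<m} \<partial>qcols m D)"
    and "integrable (qcols m D) (\<lambda>X. \<integral>b. \<integral>a. F (X(j := b, i := a)) \<partial>qvec {..<m} \<partial>qvec {..<m})"
proof -
  interpret product_sigma_finite "\<lambda>_::nat. qvec {..<m::nat}" by (rule product_sigma_finite_qvec)
  interpret K: prob_space "qvec {..<m}" by (rule prob_space_qvec)
  interpret P1: prob_space "qcols m (insert i (insert j D))" by (rule prob_space_qcols)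
  interpret P2: prob_space "qcols m (insert j D)" by (rule prob_space_qcols)
  interpret P3: prob_space "qcols m D" by (rule prob_space_qcols)
  let ?K = "qvec {..<m}"
  define H where "H Y = (\<integral>a. F (Y(i := a)) \<partial>?K)" for Y
  have Fi[measurable]: "(\<lambda>w. F ((f w)(i := g w))) \<in> borel_measurable N"
    if "f \<in> N \<rightarrow>\<^sub>M qcols m (insert j D)" "g \<in> N \<rightarrow>\<^sub>M ?K" for f g and N :: "'n measure"
    by (rule measurable_compose[OF measurable_fun_upd[where J="insert j D", OF _ that] F]) auto
  have upd_j[measurable]: "(\<lambda>w. (f w)(j := g w)) \<in> N \<rightarrow>\<^sub>M qcols m (insert j D)"
    if "f \<in> N \<rightarrow>\<^sub>M qcols m D" "g \<in> N \<rightarrow>\<^sub>M ?K" for f g and N :: "'n measure"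
    by (rule measurable_fun_upd[where J=D, OF _ that]) auto
  have Hm: "H \<in> borel_measurable (qcols m (insert j D))"
    unfolding H_def by measurable
  have H1: "\<bar>H Y\<bar> \<le> 1" for Y
  \<comment> \<open>For a \<open>Y\<close> whose section is not integrable the Bochner integral is
    0, so the bound holds for every \<open>Y\<close>.\<close>
  proof (cases "integrable ?K (\<lambda>a. F (Y(i := a)))")
    case True
    then show ?thesis unfolding H_def by (intro K.abs_integral_le_1 F1) auto
  next
    case False
    then show ?thesis unfolding H_def by (simp add: not_integrable_integral_eq)
  qed
  have "(\<integral>X. F X \<partial>qcols m (insert i (insert j D))) = (\<integral>Y. H Y \<partial>qcols m (insert j D))"
    unfolding H_def
    by (rule product_integral_insert) (use D P1.integrable_abs_le_1[OF F F1] in auto)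
  also have "\<dots> = (\<integral>X. \<integral>b. H (X(j := b)) \<partial>?K \<partial>qcols m D)"
    by (rule product_integral_insert) (use D P2.integrable_abs_le_1[OF Hm H1] in auto)
  finally show "(\<integral>X. F X \<partial>qcols m (insert i (insert j D)))
      = (\<integral>X. \<integral>b. \<integral>a. F (X(j := b, i := a)) \<partial>?K \<partial>?K \<partial>qcols m D)"
    unfolding H_def by (simp add: fun_upd_twist[OF D(4)])
  have "integrable (qcols m D) (\<lambda>X. \<integral>b. H (X(j := b)) \<partial>?K)"
  proof (rule P3.integrable_const_bound[where B=1])
    show "AE X in qcols m D. norm (\<integral>b. H (X(j := b)) \<partial>?K) \<le> 1"
    proof (rule AE_I2)
      fix X
      show "norm (\<integral>b. H (X(j := b)) \<partial>?K) \<le> 1"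
      proof (cases "integrable ?K (\<lambda>b. H (X(j := b)))")
        case True
        then show ?thesis using K.abs_integral_le_1[OF _ H1, of "\<lambda>b. X(j := b)"] by auto
      next
        case False
        then show ?thesis by (simp add: not_integrable_integral_eq)
      qed
    qed
    show "(\<lambda>X. \<integral>b. H (X(j := b)) \<partial>?K) \<in> borel_measurable (qcols m D)"
      using Hm by measurable
  qed
  then show "integrable (qcols m D) (\<lambda>X. \<integral>b. \<integral>a. F (X(j := b, i := a)) \<partial>?K \<partial>?K)"
    unfolding H_def by simp
qed

text \<open>\<open>col_merge_inequality\<close> holds for every choice of the other columns and is
  then integrated over them.\<close>

lemma row_merge_cos:
  fixes \<eta> :: quat
  assumes ij: "i < Suc m" "j < Suc m" "i \<noteq> j"
  defines "T \<equiv> \<lambda>\<theta>. \<integral>X. cos (\<eta> \<bullet> cdet (Suc m) (add_row m \<theta> X)) \<partial>qcols m {..<Suc m}"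
  shows "T \<theta> \<le> (T (\<theta>(i := sqrt 2 *\<^sub>R \<theta> i, j := 0)) + T (\<theta>(i := 0, j := sqrt 2 *\<^sub>R \<theta> j))) / 2"
proof -
  let ?K = "qvec {..<m}"
  define D where "D = {..<Suc m} - {i, j}"
  have D: "{..<Suc m} = insert i (insert j D)" "finite D" "i \<notin> D" "j \<notin> D"
    using ij by (auto simp: D_def)
  define F where "F \<theta> X = cos (\<eta> \<bullet> cdet (Suc m) (add_row m \<theta> X))" for \<theta> X
  have Fm: "F \<theta> \<in> borel_measurable (qcols m (insert i (insert j D)))" for \<theta>
  proof -
    have [measurable]: "(\<lambda>X. cdet (Suc m) (add_row m \<theta> X)) \<in> borel_measurable (qcols m {..<Suc m})"
      by (rule measurable_cdet_add_row) (simp add: measurable_ident_sets)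
    show ?thesis unfolding F_def D(1)[symmetric] by measurable
  qed
  have F1: "\<bar>F \<theta> X\<bar> \<le> 1" for \<theta> X by (simp add: F_def)
  define f where "f \<theta> X = (\<integral>b. \<integral>a. F \<theta> (X(j := b, i := a)) \<partial>?K \<partial>?K)" for \<theta> X
  have T: "T \<theta> = (\<integral>X. f \<theta> X \<partial>qcols m D)" and int: "integrable (qcols m D) (f \<theta>)" for \<theta>
    using integral_qcols_insert2[OF D(2-4) ij(3) Fm[of \<theta>] F1]
    unfolding T_def f_def D(1) F_def by simp_all
  let ?\<theta>1 = "\<theta>(i := sqrt 2 *\<^sub>R \<theta> i, j := 0)" and ?\<theta>2 = "\<theta>(i := 0, j := sqrt 2 *\<^sub>R \<theta> j)"
  have "f \<theta> X \<le> (f ?\<theta>1 X + f ?\<theta>2 X) / 2" for X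
  proof -
    define C where "C x y = cdet (Suc m) (set_col (set_col (add_row m \<theta> X) i x) j y)" for x y
    \<comment> \<open>The three last rows differ only at \<open>i\<close> and \<open>j\<close>, in
      the two columns being replaced, so one base matrix serves for all of them.\<close>
    have eq: "cdet (Suc m) (add_row m \<theta>' (X(j := b, i := a))) = C (a(m := \<theta>' i)) (b(m := \<theta>' j))"
      if "\<And>k. k \<noteq> i \<Longrightarrow> k \<noteq> j \<Longrightarrow> \<theta>' k = \<theta> k" for \<theta>' a b
      unfolding C_def using that ij(3) by (intro cdet_cong) (auto simp: add_row_def set_col_def)
    have "f \<theta> X = (\<integral>b. \<integral>a. cos (\<eta> \<bullet> C (a(m := \<theta> i)) (b(m := \<theta> j))) \<partial>?K \<partial>?K)"
      unfolding f_def F_def by (simp add: eq)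
    moreover have "f ?\<theta>1 X = (\<integral>b. \<integral>a. cos (\<eta> \<bullet> C (a(m := sqrt 2 *\<^sub>R \<theta> i)) (b(m := 0))) \<partial>?K \<partial>?K)"
      unfolding f_def F_def using ij(3) by (subst eq) auto
    moreover have "f ?\<theta>2 X = (\<integral>b. \<integral>a. cos (\<eta> \<bullet> C (a(m := 0)) (b(m := sqrt 2 *\<^sub>R \<theta> j))) \<partial>?K \<partial>?K)"
      unfolding f_def F_def using ij(3) by (subst eq) auto
    ultimately show ?thesis
      using col_merge_inequality[OF ij, of \<eta> "add_row m \<theta> X" "\<theta> i" "\<theta> j"] unfolding C_def by simp
  qed
  then have "T \<theta> \<le> (\<integral>X. (f ?\<theta>1 X + f ?\<theta>2 X) / 2 \<partial>qcols m D)"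
    unfolding T by (intro integral_mono int) (auto intro!: Bochner_Integration.integrable_add int)
  also have "\<dots> = (T ?\<theta>1 + T ?\<theta>2) / 2"
    unfolding T using int by simp
  finally show ?thesis .
qed

section \<open>Laplace transform of the Cayley determinant for a fixed last row\<close>

definition cdet_laplace :: "nat \<Rightarrow> real \<Rightarrow> (nat \<Rightarrow> quat) \<Rightarrow> real" where
  "cdet_laplace m s \<theta> = (\<integral>X. exp (- s * (norm (cdet (Suc m) (add_row m \<theta> X)))\<^sup>2) \<partial>qcols m {..<Suc m})"

text \<open>\<open>exp_norm_eq_integral_cos\<close> writes the transform as an average of cosines;
  after exchanging the integrals, \<open>row_merge_cos\<close> applies at each frequency.\<close>

lemma row_merge:
  assumes ij: "i < Suc m" "j < Suc m" "i \<noteq> j" and s: "s \<ge> 0"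
  shows "cdet_laplace m s \<theta> \<le> (cdet_laplace m s (\<theta>(i := sqrt 2 *\<^sub>R \<theta> i, j := 0))
    + cdet_laplace m s (\<theta>(i := 0, j := sqrt 2 *\<^sub>R \<theta> j))) / 2"
proof -
  let ?P = "qcols m {..<Suc m}"
  interpret Q: prob_space qgauss by (rule prob_space_qgauss)
  interpret P: prob_space ?P by (rule prob_space_qcols)
  interpret PQ: pair_prob_space ?P qgauss ..
  define T where "T \<xi> \<theta> = (\<integral>X. cos ((sqrt (8 * s) *\<^sub>R \<xi>) \<bullet> cdet (Suc m) (add_row m \<theta> X)) \<partial>?P)" for \<xi> \<theta>
  have m[measurable]: "(\<lambda>X. cdet (Suc m) (add_row m \<theta> X)) \<in> borel_measurable ?P" for \<theta>
    by (rule measurable_cdet_add_row) (simp add: measurable_ident_sets)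
  have "cdet_laplace m s \<theta> = (\<integral>X. \<integral>\<xi>. cos ((sqrt (8 * s) *\<^sub>R \<xi>) \<bullet> cdet (Suc m) (add_row m \<theta> X)) \<partial>qgauss \<partial>?P)" for \<theta>
    unfolding cdet_laplace_def exp_norm_eq_integral_cos[OF s] ..
  also have "\<dots> \<theta> = (\<integral>\<xi>. T \<xi> \<theta> \<partial>qgauss)" for \<theta>
    unfolding T_def
  proof (rule PQ.Fubini_integral[symmetric])
    show "integrable (?P \<Otimes>\<^sub>M qgauss) (\<lambda>(X, \<xi>). cos ((sqrt (8 * s) *\<^sub>R \<xi>) \<bullet> cdet (Suc m) (add_row m \<theta> X)))"
      by (rule PQ.integrable_abs_le_1) auto
  qed
  finally have L: "cdet_laplace m s \<theta> = (\<integral>\<xi>. T \<xi> \<theta> \<partial>qgauss)" for \<theta> .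
  have int: "integrable qgauss (\<lambda>\<xi>. T \<xi> \<theta>)" for \<theta>
  proof (rule Q.integrable_abs_le_1)
    show "(\<lambda>\<xi>. T \<xi> \<theta>) \<in> borel_measurable qgauss" unfolding T_def by measurable
    show "\<bar>T \<xi> \<theta>\<bar> \<le> 1" for \<xi> unfolding T_def by (rule P.abs_integral_le_1) auto
  qed
  let ?\<theta>1 = "\<theta>(i := sqrt 2 *\<^sub>R \<theta> i, j := 0)" and ?\<theta>2 = "\<theta>(i := 0, j := sqrt 2 *\<^sub>R \<theta> j)"
  have "cdet_laplace m s \<theta> \<le> (\<integral>\<xi>. (T \<xi> ?\<theta>1 + T \<xi> ?\<theta>2) / 2 \<partial>qgauss)"
    unfolding L
  proof (intro integral_mono int)
    show "T \<xi> \<theta> \<le> (T \<xi> ?\<theta>1 + T \<xi> ?\<theta>2) / 2" for \<xi>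
      unfolding T_def by (rule row_merge_cos[OF ij])
  qed (use int in auto)
  also have "\<dots> = (cdet_laplace m s ?\<theta>1 + cdet_laplace m s ?\<theta>2) / 2"
    unfolding L using int by simp
  finally show ?thesis .
qed

text \<open>Rotating the columns of \<open>X\<close> along with the row leaves both
  \<open>cdet\<close> and the law of \<open>X\<close> unchanged.\<close>

lemma cdet_laplace_rotate:
  assumes ij: "i < Suc m" "j < Suc m" "i \<noteq> j" and c: "c > 0" "c\<^sup>2 + t\<^sup>2 = 1"
  shows "cdet_laplace m s (\<theta>(i := c *\<^sub>R \<theta> i + t *\<^sub>R \<theta> j, j := c *\<^sub>R \<theta> j + (- t) *\<^sub>R \<theta> i)) = cdet_laplace m s \<theta>"
proof -
  let ?\<theta>' = "\<theta>(i := c *\<^sub>R \<theta> i + t *\<^sub>R \<theta> j, j := c *\<^sub>R \<theta> j + (- t) *\<^sub>R \<theta> i)"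
  let ?P = "qcols m {..<Suc m}"
  have cs: "c\<^sup>2 + (norm (of_real t :: quat))\<^sup>2 = 1" using c by simp
  have [measurable]: "(\<lambda>X. cdet (Suc m) (add_row m \<theta> X)) \<in> borel_measurable ?P" for \<theta>
    by (rule measurable_cdet_add_row) (simp add: measurable_ident_sets)
  have eq: "cdet (Suc m) (add_row m ?\<theta>' (rotate_cols m i j c (of_real t) X)) = cdet (Suc m) (add_row m \<theta> X)" for X
  proof -
    let ?A = "add_row m \<theta> X"
    let ?x = "\<lambda>r. ?A r i" and ?y = "\<lambda>r. ?A r j"
    have "cdet (Suc m) (add_row m ?\<theta>' (rotate_cols m i j c (of_real t) X))
      = cdet (Suc m) (set_col (set_col ?A i (\<lambda>r. c *\<^sub>R ?x r + t *\<^sub>R ?y r)) j (\<lambda>r. c *\<^sub>R ?y r + (- t) *\<^sub>R ?x r))"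
      using ij(3)
      by (intro cdet_cong)
         (auto simp: add_row_def set_col_def rotate_cols_def givens_col_def givens_def less_Suc_eq of_real_def qcnj_scaleR)
    also have "\<dots> = cdet (Suc m) (set_col (set_col ?A i ?x) j ?y)"
      by (rule cdet_rotate_cols[OF ij c(2)])
    also have "set_col (set_col ?A i ?x) j ?y = ?A"
      by (auto simp: set_col_def fun_eq_iff)
    finally show ?thesis .
  qed
  have "cdet_laplace m s ?\<theta>' = (\<integral>X. exp (- s * (norm (cdet (Suc m) (add_row m ?\<theta>' (rotate_cols m i j c (of_real t) X))))\<^sup>2) \<partial>?P)"
    unfolding cdet_laplace_def
    by (rule integral_rotate_cols[symmetric]) (use ij c cs in auto)
  then show ?thesis unfolding eq cdet_laplace_def .
qed

text \<open>A rotation by a right angle exchanges the two norms, so their difference changes sign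
  between the angles 0 and \<open>pi/2\<close> and vanishes in between.\<close>

lemma ex_equalizing_rotation:
  fixes p q :: "'a::real_inner"
  obtains c t :: real where "c > 0" "c\<^sup>2 + t\<^sup>2 = 1" "norm (c *\<^sub>R p + t *\<^sub>R q) = norm (c *\<^sub>R q + (- t) *\<^sub>R p)"
proof -
  define f where "f x = norm (cos x *\<^sub>R p + sin x *\<^sub>R q) - norm (cos x *\<^sub>R q + (- sin x) *\<^sub>R p)" for x :: real
  have cont: "continuous_on {0..pi/2} f"
    unfolding f_def by (intro continuous_intros)
  have f0: "f 0 = norm p - norm q" and f1: "f (pi/2) = norm q - norm p"
    by (simp_all add: f_def)
  have "\<exists>x. 0 \<le> x \<and> x \<le> pi/2 \<and> f x = 0"
  proof (cases "f 0 \<le> 0")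
    case True
    then show ?thesis using IVT'[of f 0 0 "pi/2"] cont f0 f1 by simp
  next
    case False
    then show ?thesis using IVT2'[of f "pi/2" 0 0] cont f0 f1 by simp
  qed
  then obtain x where x: "0 \<le> x" "x \<le> pi/2" "f x = 0" by blast
  show ?thesis
  \<comment> \<open>At \<open>pi/2\<close> the cosine would violate \<open>c > 0\<close>. The norms
    of \<open>p\<close> and \<open>q\<close> then agree already, and the identity rotation
    serves.\<close>
  proof (cases "x = pi/2")
    case True
    have "norm p = norm q" using x(3) f1 unfolding True by simp
    then show ?thesis by (intro that[of 1 0]) simp_all
  next
    case False
    then have "cos x > 0" using x by (intro cos_gt_zero_pi) auto
    then show ?thesis using x by (intro that[of "cos x" "sin x"]) (simp_all add: f_def)
  qed
qed

lemma norm_sq_rotate: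
  fixes p q :: "'a::real_inner"
  assumes "c\<^sup>2 + t\<^sup>2 = 1"
  shows "(norm (c *\<^sub>R p + t *\<^sub>R q))\<^sup>2 + (norm (c *\<^sub>R q + (- t) *\<^sub>R p))\<^sup>2 = (norm p)\<^sup>2 + (norm q)\<^sup>2"
proof -
  have "(norm (c *\<^sub>R p + t *\<^sub>R q))\<^sup>2 + (norm (c *\<^sub>R q + (- t) *\<^sub>R p))\<^sup>2 = (c\<^sup>2 + t\<^sup>2) * ((norm p)\<^sup>2 + (norm q)\<^sup>2)"
    unfolding power2_norm_eq_inner
    by (simp add: inner_add_left inner_add_right inner_diff_left inner_diff_right inner_commute[of q p] power2_eq_square algebra_simps)
  then show ?thesis using assms by simp
qed

lemma sum_norm_sq_upd2:
  fixes \<theta> :: "nat \<Rightarrow> 'a::real_normed_vector"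
  assumes "k < m"
  shows "(\<Sum>j<Suc m. (norm ((\<theta>(k := a, m := b)) j))\<^sup>2) = (\<Sum>j\<in>{..<m} - {k}. (norm (\<theta> j))\<^sup>2) + ((norm a)\<^sup>2 + (norm b)\<^sup>2)"
proof -
  have "(\<Sum>j<m. (norm ((\<theta>(k := a, m := b)) j))\<^sup>2) = (norm a)\<^sup>2 + (\<Sum>j\<in>{..<m} - {k}. (norm (\<theta> j))\<^sup>2)"
    using assms by (subst sum.remove[of _ k]) (auto intro!: sum.cong)
  then show ?thesis by simp
qed

text \<open>Induction on the bound \<open>k\<close> below which entries other than entry
  \<open>m\<close> may be nonzero. Each step equalises the norms of entries \<open>k\<close> and
  \<open>m\<close> by a real rotation and merges both into entry \<open>m\<close>, keeping the total
  squared norm.\<close>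

lemma cdet_laplace_le:
  assumes s: "s \<ge> 0"
  shows "cdet_laplace m s \<theta>
    \<le> (\<integral>X. exp (- s * (\<Sum>j<Suc m. (norm (\<theta> j))\<^sup>2) * (norm (cdet m (\<lambda>i j. X j i)))\<^sup>2) \<partial>qcols m {..<Suc m})"
proof -
  \<comment> \<open>The transform for a last row whose weight, of squared norm \<open>u\<close>,
    sits entirely in entry \<open>m\<close>.\<close>
  define G where "G u = (\<integral>X. exp (- s * u * (norm (cdet m (\<lambda>i j. X j i)))\<^sup>2) \<partial>qcols m {..<Suc m})" for u
  have "cdet_laplace m s \<theta> \<le> G (\<Sum>j<Suc m. (norm (\<theta> j))\<^sup>2)"
    if "k \<le> m" "\<And>j. k \<le> j \<Longrightarrow> j < m \<Longrightarrow> \<theta> j = 0" for k \<theta>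
    using that
  proof (induction k arbitrary: \<theta>)
    case 0
    then have \<theta>: "\<theta> j = 0" if "j < m" for j using that by simp
    have "cdet (Suc m) (add_row m \<theta> X) = cdet m (\<lambda>i j. X j i) * \<theta> m" for X
    proof -
      have "cdet (Suc m) (add_row m \<theta> X) = cdet m (add_row m \<theta> X) * \<theta> m"
        using \<theta> by (subst cdet_last_row) (auto simp: add_row_def)
      also have "cdet m (add_row m \<theta> X) = cdet m (\<lambda>i j. X j i)"
        by (rule cdet_cong) (simp add: add_row_def)
      finally show ?thesis .
    qed
    moreover have "(\<Sum>j<Suc m. (norm (\<theta> j))\<^sup>2) = (norm (\<theta> m))\<^sup>2"
      using \<theta> by simp
    ultimately show ?case
      by (simp add: cdet_laplace_def G_def quat_norm_mult power_mult_distrib mult_ac)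
  next
    case (Suc k)
    then have k: "k < m" by simp
    then have km: "k < Suc m" "m < Suc m" "k \<noteq> m" by auto
    obtain c t :: real where ct: "c > 0" "c\<^sup>2 + t\<^sup>2 = 1"
      and nrm: "norm (c *\<^sub>R \<theta> k + t *\<^sub>R \<theta> m) = norm (c *\<^sub>R \<theta> m + (- t) *\<^sub>R \<theta> k)"
      by (rule ex_equalizing_rotation)
    define a b where "a = c *\<^sub>R \<theta> k + t *\<^sub>R \<theta> m" and "b = c *\<^sub>R \<theta> m + (- t) *\<^sub>R \<theta> k"
    have ab: "norm a = norm b" "(norm a)\<^sup>2 + (norm b)\<^sup>2 = (norm (\<theta> k))\<^sup>2 + (norm (\<theta> m))\<^sup>2"
      unfolding a_def b_def using nrm norm_sq_rotate[OF ct(2), of "\<theta> k" "\<theta> m"] by auto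
    define N where "N = (\<Sum>j<Suc m. (norm (\<theta> j))\<^sup>2)"
    have N: "(\<Sum>j<Suc m. (norm ((\<theta>(k := x, m := y)) j))\<^sup>2) = N"
      if "(norm x)\<^sup>2 + (norm y)\<^sup>2 = (norm (\<theta> k))\<^sup>2 + (norm (\<theta> m))\<^sup>2" for x y
      using sum_norm_sq_upd2[OF k, of \<theta> x y] sum_norm_sq_upd2[OF k, of \<theta> "\<theta> k" "\<theta> m"] that
      by (simp add: N_def)
    have IH: "cdet_laplace m s (\<theta>(k := 0, m := y)) \<le> G N" if "(norm y)\<^sup>2 = (norm (\<theta> k))\<^sup>2 + (norm (\<theta> m))\<^sup>2" for y
    proof -
      have "cdet_laplace m s (\<theta>(k := 0, m := y)) \<le> G (\<Sum>j<Suc m. (norm ((\<theta>(k := 0, m := y)) j))\<^sup>2)"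
      proof (rule Suc.IH)
        show "(\<theta>(k := 0, m := y)) j = 0" if "k \<le> j" "j < m" for j
          using that Suc.prems(2)[of j] by (cases "j = k") auto
      qed (use k in simp)
      then show ?thesis using that by (subst (asm) N) auto
    qed
    have "cdet_laplace m s \<theta> = cdet_laplace m s (\<theta>(k := a, m := b))"
      unfolding a_def b_def by (rule cdet_laplace_rotate[OF km ct, symmetric])
    also have "\<dots> \<le> (cdet_laplace m s (\<theta>(k := sqrt 2 *\<^sub>R a, m := 0)) + cdet_laplace m s (\<theta>(k := 0, m := sqrt 2 *\<^sub>R b))) / 2"
      using row_merge[OF km s, of "\<theta>(k := a, m := b)"] km by (simp add: fun_upd_twist[of m k])
    \<comment> \<open>One of the merged rows carries its weight at \<open>k\<close>. A quarter turn
      would move it to \<open>m\<close> but has \<open>c = 0\<close>; two rotations by an eighth of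
      a turn do it instead, through the entries \<open>(a, - a)\<close>.\<close>
    also have "cdet_laplace m s (\<theta>(k := sqrt 2 *\<^sub>R a, m := 0)) = cdet_laplace m s (\<theta>(k := 0, m := - (sqrt 2 *\<^sub>R a)))"
    proof -
      define r where "r = 1 / sqrt 2"
      have r: "r > 0" "r\<^sup>2 + r\<^sup>2 = 1" "r * sqrt 2 = 1" "r + r = sqrt 2"
        by (auto simp: r_def power_divide real_div_sqrt)
      have e: "- (r *\<^sub>R a) - r *\<^sub>R a = - (sqrt 2 *\<^sub>R a)"
        unfolding r(4)[symmetric] scaleR_add_left by simp
      have "cdet_laplace m s (\<theta>(k := sqrt 2 *\<^sub>R a, m := 0)) = cdet_laplace m s (\<theta>(k := a, m := - a))"
        using cdet_laplace_rotate[OF km r(1,2), of s "\<theta>(k := sqrt 2 *\<^sub>R a, m := 0)"] km r(3)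
        by (simp add: fun_upd_twist[of m k])
      also have "\<dots> = cdet_laplace m s (\<theta>(k := 0, m := - (sqrt 2 *\<^sub>R a)))"
        using cdet_laplace_rotate[OF km r(1,2), of s "\<theta>(k := a, m := - a)"] km r(4)
        by (simp add: fun_upd_twist[of m k] e)
      finally show ?thesis .
    qed
    \<comment> \<open>Since \<open>norm a = norm b\<close>, scaling either by \<open>sqrt 2\<close>
      carries the combined weight of the old entries \<open>k\<close> and \<open>m\<close>. This is
      what the equalising rotation was for.\<close>
    also have "(\<dots> + cdet_laplace m s (\<theta>(k := 0, m := sqrt 2 *\<^sub>R b))) / 2 \<le> (G N + G N) / 2"
      using ab by (intro divide_right_mono add_mono IH) (simp_all add: power_mult_distrib)
    finally show ?case by (simp add: N_def)
  qed
  from this[of m \<theta>] show ?thesis by (simp add: G_def)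
qed

subsection \<open>The complex representation of quaternionic matrices\<close>

text \<open>Writing \<open>q = z + w j\<close> with complex \<open>z\<close> and \<open>w\<close>,
  these are the entries of the usual complex 2 by 2 matrix of \<open>q\<close>, with rows
  \<open>(z, w)\<close> and \<open>(- cnj w, cnj z)\<close>.\<close>

definition qblock :: "quat \<Rightarrow> nat \<Rightarrow> nat \<Rightarrow> complex" where
  "qblock q a b =
    (if a = 0 then if b = 0 then Complex (qRe q) (qIm1 q) else Complex (qIm2 q) (qIm3 q)
     else if b = 0 then Complex (- qIm2 q) (qIm3 q) else Complex (qRe q) (- qIm1 q))"

lemma qblock_mult: "qblock (x * y) a b = qblock x a 0 * qblock y 0 b + qblock x a 1 * qblock y 1 b"
  by (auto simp: qblock_def complex_eq_iff algebra_simps)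

lemma qblock_add: "qblock (x + y) a b = qblock x a b + qblock y a b"
  by (auto simp: qblock_def complex_eq_iff)

lemma qblock_0 [simp]: "qblock 0 a b = 0"
  by (auto simp: qblock_def complex_eq_iff)

lemma qblock_sum: "qblock (sum f S) a b = (\<Sum>k\<in>S. qblock (f k) a b)"
  by (induction S rule: infinite_finite_induct) (simp_all add: qblock_add)

lemma qblock_of_real: "a < 2 \<Longrightarrow> b < 2 \<Longrightarrow> qblock (of_real r) a b = (if a = b then of_real r else 0)"
  by (auto simp: qblock_def complex_eq_iff of_real_def less_2_cases_iff)

lemma qblock_qcnj: "a < 2 \<Longrightarrow> b < 2 \<Longrightarrow> qblock (qcnj q) a b = cnj (qblock q b a)"
  by (auto simp: qblock_def complex_eq_iff less_2_cases_iff)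

text \<open>Each entry is replaced in place by its 2 by 2 block. This embedding is multiplicative,
  and zeros of the quaternionic matrix become zero blocks in the same position.\<close>

definition study :: "quat mat \<Rightarrow> complex mat" where
  "study A = Matrix.mat (2 * dim_row A) (2 * dim_col A)
     (\<lambda>(r, s). qblock (A $$ (r div 2, s div 2)) (r mod 2) (s mod 2))"

lemma study_carrier [simp]: "A \<in> carrier_mat n m \<Longrightarrow> study A \<in> carrier_mat (2 * n) (2 * m)"
  by (simp add: study_def)

lemma study_index:
  "A \<in> carrier_mat n m \<Longrightarrow> r < 2 * n \<Longrightarrow> s < 2 * m \<Longrightarrow>
    study A $$ (r, s) = qblock (A $$ (r div 2, s div 2)) (r mod 2) (s mod 2)"
  by (auto simp: study_def)

lemma sum_double: "(\<Sum>t<2 * n. f t) = (\<Sum>k<n. f (2 * k) + f (2 * k + 1))"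
  for f :: "nat \<Rightarrow> 'a::comm_monoid_add"
  by (induction n) (simp_all add: add.assoc)

lemma prod_double: "(\<Prod>t<2 * n. f t) = (\<Prod>k<n. f (2 * k) * f (2 * k + 1))"
  for f :: "nat \<Rightarrow> 'a::comm_monoid_mult"
  by (induction n) (simp_all add: mult.assoc)

lemma index_mult_mat_sum:
  "A \<in> carrier_mat n k \<Longrightarrow> B \<in> carrier_mat k m \<Longrightarrow> i < n \<Longrightarrow> j < m \<Longrightarrow>
    (A * B) $$ (i, j) = (\<Sum>l<k. A $$ (i, l) * B $$ (l, j))"
  by (auto simp: scalar_prod_def atLeast0LessThan intro!: sum.cong)

lemma study_mult:
  assumes A: "A \<in> carrier_mat n k" and B: "B \<in> carrier_mat k m"
  shows "study (A * B) = study A * study B"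
proof (rule eq_matI)
  have AB: "A * B \<in> carrier_mat n m" using A B by simp
  show d: "dim_row (study (A * B)) = dim_row (study A * study B)"
    "dim_col (study (A * B)) = dim_col (study A * study B)"
    using A B by (simp_all add: study_def)
  fix r s assume "r < dim_row (study A * study B)" "s < dim_col (study A * study B)"
  then have r: "r < 2 * n" and s: "s < 2 * m" using A B by (simp_all add: study_def)
  then have r2: "r div 2 < n" and s2: "s div 2 < m" by auto
  have "study (A * B) $$ (r, s) = (\<Sum>l<k. qblock (A $$ (r div 2, l) * B $$ (l, s div 2)) (r mod 2) (s mod 2))"
    by (simp only: study_index[OF AB r s] index_mult_mat_sum[OF A B r2 s2] qblock_sum)
  also have "\<dots> = (\<Sum>l<k. study A $$ (r, 2 * l) * study B $$ (2 * l, s) + study A $$ (r, 2 * l + 1) * study B $$ (2 * l + 1, s))"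
    by (intro sum.cong refl)
       (simp add: qblock_mult study_index[OF A r] study_index[OF B _ s])
  also have "\<dots> = (\<Sum>t<2 * k. study A $$ (r, t) * study B $$ (t, s))"
    by (rule sum_double[symmetric])
  also have "\<dots> = (study A * study B) $$ (r, s)"
    by (rule index_mult_mat_sum[symmetric]) (use A B r s in simp_all)
  finally show "study (A * B) $$ (r, s) = (study A * study B) $$ (r, s)" .
qed

text \<open>This is the square of the product of the singular values, expressed as a polynomial
  determinant; the modulus makes it real and nonnegative by construction.\<close>

definition sdet :: "quat mat \<Rightarrow> real" where
  "sdet A = cmod (det (study A))"

lemma sdet_mult: "A \<in> carrier_mat n n \<Longrightarrow> B \<in> carrier_mat n n \<Longrightarrow> sdet (A * B) = sdet A * sdet B"
  unfolding sdet_def by (simp add: study_mult det_mult[of _ "2 * n"] norm_mult)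

lemma qadjoint_carrier [simp]: "A \<in> carrier_mat n m \<Longrightarrow> qadjoint A \<in> carrier_mat m n"
  by (simp add: qadjoint_def)

lemma qadjoint_index: "A \<in> carrier_mat n m \<Longrightarrow> i < m \<Longrightarrow> j < n \<Longrightarrow> qadjoint A $$ (i, j) = qcnj (A $$ (j, i))"
  by (auto simp: qadjoint_def)

lemma qadjoint_qadjoint: "qadjoint (qadjoint A) = A"
  by (rule eq_matI) (auto simp: qadjoint_def)

lemma qadjoint_mult:
  assumes A: "A \<in> carrier_mat n k" and B: "B \<in> carrier_mat k m"
  shows "qadjoint (A * B) = qadjoint B * qadjoint A"
proof (rule eq_matI)
  fix i j assume "i < dim_row (qadjoint B * qadjoint A)" "j < dim_col (qadjoint B * qadjoint A)"
  then have ij: "i < m" "j < n" using A B by (simp_all add: qadjoint_def)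
  have "qadjoint (A * B) $$ (i, j) = qcnj ((A * B) $$ (j, i))"
    by (rule qadjoint_index) (use A B ij in auto)
  also have "\<dots> = (\<Sum>l<k. qadjoint B $$ (i, l) * qadjoint A $$ (l, j))"
    unfolding index_mult_mat_sum[OF A B ij(2,1)] qcnj_sum
    by (intro sum.cong refl) (simp add: qcnj_mult qadjoint_index[OF A] qadjoint_index[OF B] ij)
  also have "\<dots> = (qadjoint B * qadjoint A) $$ (i, j)"
    by (rule index_mult_mat_sum[symmetric]) (use A B ij in simp_all)
  finally show "qadjoint (A * B) $$ (i, j) = (qadjoint B * qadjoint A) $$ (i, j)" .
qed (use A B in \<open>simp_all add: qadjoint_def\<close>)

text \<open>\<open>study\<close> turns the quaternionic adjoint into the conjugate
  transpose.\<close>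

lemma sdet_qadjoint:
  assumes A: "A \<in> carrier_mat n n"
  shows "sdet (qadjoint A) = sdet A"
proof -
  interpret cnj: comm_ring_hom cnj by unfold_locales auto
  have "study (qadjoint A) = map_mat cnj (transpose_mat (study A))"
  proof (rule eq_matI)
    fix r s assume "r < dim_row (map_mat cnj (transpose_mat (study A)))" "s < dim_col (map_mat cnj (transpose_mat (study A)))"
    then have rs: "r < 2 * n" "s < 2 * n" using A by (simp_all add: study_def)
    then have "r div 2 < n" "s div 2 < n" by auto
    with rs show "study (qadjoint A) $$ (r, s) = map_mat cnj (transpose_mat (study A)) $$ (r, s)"
      using study_carrier[OF A]
      by (simp add: study_index[OF qadjoint_carrier[OF A]] study_index[OF A] qadjoint_index[OF A] qblock_qcnj)
  qed (use A in \<open>simp_all add: study_def qadjoint_def\<close>)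
  then show ?thesis
    using det_transpose[OF study_carrier[OF A]] by (simp add: sdet_def)
qed

text \<open>A real diagonal entry appears twice on the diagonal of the complex matrix, hence the
  squares.\<close>

lemma sdet_diag: "sdet (mat_diag n (\<lambda>i. of_real (s i))) = (\<Prod>i<n. (s i)\<^sup>2)"
proof -
  let ?D = "mat_diag n (\<lambda>i. of_real (s i)) :: quat mat"
  have D: "?D \<in> carrier_mat n n" by (simp add: mat_diag_def)
  have idx: "study ?D $$ (r, t) = (if r = t then of_real (s (r div 2)) else 0)" if "r < 2 * n" "t < 2 * n" for r t
  proof -
    have "r div 2 < n" "t div 2 < n" using that by auto
    then have "?D $$ (r div 2, t div 2) = (if r div 2 = t div 2 then of_real (s (t div 2)) else 0)"
      by (simp add: mat_diag_def)
    moreover have "r = t \<longleftrightarrow> r div 2 = t div 2 \<and> r mod 2 = t mod 2"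
      by (metis div_mult_mod_eq)
    ultimately show ?thesis
      using study_index[OF D that] by (auto simp: qblock_of_real)
  qed
  have dimD: "dim_row (study ?D) = 2 * n" by (simp add: study_def mat_diag_def)
  have "det (study ?D) = prod_list (diag_mat (study ?D))"
  proof (rule det_upper_triangular)
    show "upper_triangular (study ?D)"
    proof (unfold upper_triangular_def, intro allI impI)
      fix i j assume "i < dim_row (study ?D)" "j < i"
      then have "i < 2 * n" "j < 2 * n" by (simp_all add: study_def mat_diag_def)
      then show "study ?D $$ (i, j) = 0" using idx \<open>j < i\<close> by simp
    qed
  qed (rule study_carrier[OF D])
  also have "\<dots> = (\<Prod>r<2 * n. of_real (s (r div 2)))"
    using study_carrier[OF D] by (auto simp: prod_list_diag_prod atLeast0LessThan idx dimD intro!: prod.cong)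
  also have "\<dots> = of_real (\<Prod>i<n. (s i)\<^sup>2)"
    unfolding prod_double by (simp add: power2_eq_square)
  finally show ?thesis
    unfolding sdet_def by (simp only: norm_of_real) (simp add: prod_nonneg abs_prod)
qed

lemma sdet_one: "sdet (1\<^sub>m n) = 1"
proof -
  have "(1\<^sub>m n :: quat mat) = mat_diag n (\<lambda>i. of_real 1)"
    by (rule eq_matI) (auto simp: mat_diag_def)
  then show ?thesis using sdet_diag[of n "\<lambda>_. 1"] by simp
qed

lemma sdet_nonneg [simp]: "0 \<le> sdet A"
  by (simp add: sdet_def)

lemma sdet_qunitary: "qunitary n U \<Longrightarrow> sdet U = 1"
proof -
  assume "qunitary n U"
  then have U: "U \<in> carrier_mat n n" "U * qadjoint U = 1\<^sub>m n" by (auto simp: qunitary_def)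
  have "sdet U * sdet U = sdet (U * qadjoint U)"
    using sdet_mult[OF U(1) qadjoint_carrier[OF U(1)]] by (simp only: sdet_qadjoint[OF U(1)])
  then have "sdet U * sdet U = 1" by (simp only: U sdet_one)
  then have "(sdet U)\<^sup>2 = 1\<^sup>2" by (simp add: power2_eq_square)
  then show "sdet U = 1" by (simp only: power2_eq_iff_nonneg sdet_nonneg zero_le_one)
qed

lemma qunitary_qadjoint: "qunitary n U \<Longrightarrow> qunitary n (qadjoint U)"
  by (auto simp: qunitary_def qadjoint_qadjoint)

lemma qunitary_mult:
  assumes "qunitary n U" "qunitary n V"
  shows "qunitary n (U * V)"
proof -
  have c: "U \<in> carrier_mat n n" "V \<in> carrier_mat n n" "qadjoint U \<in> carrier_mat n n" "qadjoint V \<in> carrier_mat n n"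
    using assms by (auto simp: qunitary_def)
  have uv: "qadjoint U * U = 1\<^sub>m n" "U * qadjoint U = 1\<^sub>m n" "qadjoint V * V = 1\<^sub>m n" "V * qadjoint V = 1\<^sub>m n"
    using assms by (auto simp: qunitary_def)
  note assoc = assoc_mult_mat[of _ n n _ n _ n]
  have "qadjoint V * qadjoint U * (U * V) = qadjoint V * (qadjoint U * (U * V))"
    by (rule assoc) (use c in auto)
  also have "qadjoint U * (U * V) = qadjoint U * U * V"
    by (rule assoc[symmetric]) (use c in auto)
  finally have 1: "qadjoint V * qadjoint U * (U * V) = 1\<^sub>m n"
    by (simp only: uv left_mult_one_mat[OF c(2)])
  have "U * V * (qadjoint V * qadjoint U) = U * (V * (qadjoint V * qadjoint U))"
    by (rule assoc[OF c(1,2) mult_carrier_mat[OF c(4,3)]])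
  also have "V * (qadjoint V * qadjoint U) = V * qadjoint V * qadjoint U"
    by (rule assoc[symmetric]) (use c in auto)
  finally have 2: "U * V * (qadjoint V * qadjoint U) = 1\<^sub>m n"
    by (simp only: uv left_mult_one_mat[OF c(3)])
  show ?thesis
    using 1 2 c by (simp add: qunitary_def qadjoint_mult[of U n n V n])
qed

text \<open>The unitary factors have \<open>sdet\<close> equal to 1. As the left-hand side does not
  mention \<open>s\<close>, the nonnegative product is the same for every admissible list, so the
  choice made in \<open>qsingular_values\<close> is harmless.\<close>

lemma sdet_eq_singular_values:
  assumes A: "A \<in> carrier_mat n n" and s: "is_qsingular_values A s"
  shows "sdet A = (prod_list s)\<^sup>2"
proof -
  from s A obtain U V where len: "length s = n" and U: "qunitary n U" and V: "qunitary n V"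
    and eq: "A = U * mat_diag n (\<lambda>i. of_real (s ! i)) * qadjoint V"
    unfolding is_qsingular_values_def by auto
  have c: "U \<in> carrier_mat n n" "mat_diag n (\<lambda>i. of_real (s ! i) :: quat) \<in> carrier_mat n n" "qadjoint V \<in> carrier_mat n n"
    using U V by (auto simp: qunitary_def mat_diag_def)
  have "sdet A = sdet U * sdet (mat_diag n (\<lambda>i. of_real (s ! i))) * sdet (qadjoint V)"
    unfolding eq using c by (simp add: sdet_mult[of _ n])
  also have "\<dots> = (\<Prod>i<n. s ! i)\<^sup>2"
    by (simp add: sdet_qunitary[OF U] sdet_qunitary[OF qunitary_qadjoint[OF V]] sdet_diag prod_power_distrib)
  also have "(\<Prod>i<n. s ! i) = prod_list s"
    using len by (simp add: prod.list_conv_set_nth atLeast0LessThan)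
  finally show ?thesis .
qed

text \<open>Multiplying by the adjoint gives a real diagonal matrix, where \<open>sdet_diag\<close>
  applies; both sides are nonnegative, so squares may be compared.\<close>

lemma sdet_1x1: "sdet (Matrix.mat 1 1 (\<lambda>_. t)) = (norm t)\<^sup>2"
proof -
  let ?T = "Matrix.mat 1 1 (\<lambda>_. t)"
  have T: "?T \<in> carrier_mat 1 1" by simp
  have "?T * qadjoint ?T = mat_diag 1 (\<lambda>i. of_real ((norm t)\<^sup>2))"
    by (rule eq_matI) (auto simp: qadjoint_def mat_diag_def scalar_prod_def mult_qcnj)
  then have "sdet (?T * qadjoint ?T) = ((norm t)\<^sup>2)\<^sup>2"
    using sdet_diag[of 1 "\<lambda>_. (norm t)\<^sup>2"] by (simp only:) simp
  moreover have "sdet (?T * qadjoint ?T) = sdet ?T * sdet ?T"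
    using sdet_mult[OF T qadjoint_carrier[OF T]] by (simp only: sdet_qadjoint[OF T])
  ultimately have "sdet ?T * sdet ?T = ((norm t)\<^sup>2)\<^sup>2" by (simp only:)
  then have "(sdet ?T)\<^sup>2 = ((norm t)\<^sup>2)\<^sup>2" by (simp add: power2_eq_square)
  then show ?thesis by (subst (asm) power2_eq_iff_nonneg) simp_all
qed

text \<open>The zeros of the last row make the complex matrix block upper triangular, with the 2 by
  2 block of \<open>A m m\<close> in the corner.\<close>

lemma sdet_last_row:
  assumes "\<And>j. j < m \<Longrightarrow> A m j = 0"
  shows "sdet (Matrix.mat (Suc m) (Suc m) (\<lambda>(i, j). A i j)) = sdet (Matrix.mat m m (\<lambda>(i, j). A i j)) * (norm (A m m))\<^sup>2"
proof -
  let ?A = "Matrix.mat (Suc m) (Suc m) (\<lambda>(i, j). A i j)" and ?B = "Matrix.mat m m (\<lambda>(i, j). A i j)"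
    and ?T = "Matrix.mat 1 1 (\<lambda>_. A m m)" and ?C = "Matrix.mat m 1 (\<lambda>(i, j). A i m)"
  have cA: "?A \<in> carrier_mat (Suc m) (Suc m)" and cB: "?B \<in> carrier_mat m m" and cT: "?T \<in> carrier_mat 1 1"
    and cC: "?C \<in> carrier_mat m 1" by auto
  have "study ?A = four_block_mat (study ?B) (study ?C) (0\<^sub>m 2 (2 * m)) (study ?T)"
  proof (rule eq_matI)
    fix r s assume "r < dim_row (four_block_mat (study ?B) (study ?C) (0\<^sub>m 2 (2 * m)) (study ?T))"
      "s < dim_col (four_block_mat (study ?B) (study ?C) (0\<^sub>m 2 (2 * m)) (study ?T))"
    then have rs: "r < 2 * Suc m" "s < 2 * Suc m" by (simp_all add: study_def)
    then have rs': "r div 2 < Suc m" "s div 2 < Suc m" by auto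
    have *: "k div 2 < m" if "k < 2 * m" for k using that by auto
    have **: "k div 2 = m \<and> (k - 2 * m) mod 2 = k mod 2 \<and> (k - 2 * m) div 2 = 0" if "\<not> k < 2 * m" "k < 2 * Suc m" for k
    proof -
      from that have "k = 2 * m \<or> k = 2 * m + 1" by auto
      then show ?thesis by auto
    qed
    show "study ?A $$ (r, s) = four_block_mat (study ?B) (study ?C) (0\<^sub>m 2 (2 * m)) (study ?T) $$ (r, s)"
      using rs rs' *[of r] *[of s] **[of r] **[of s] assms
      by (auto simp: study_index[OF cA] study_index[OF cB] study_index[OF cC] study_index[OF cT] study_def)
  qed (auto simp: study_def)
  then have "det (study ?A) = det (study ?B) * det (study ?T)"
    using study_carrier[OF cB] study_carrier[OF cC] study_carrier[OF cT]
    by (simp add: det_four_block_mat_lower_left_zero[of _ "2 * m" _ 2])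
  then show ?thesis using sdet_1x1[of "A m m"] by (simp add: sdet_def norm_mult)
qed

text \<open>The Leibniz expansion is polynomial in the real coordinates of the entries.
  Measurability of the squared \<open>Sdet\<close> is obtained this way, as a list picked by
  \<open>SOME\<close> gives no access to it.\<close>

lemma measurable_sdet:
  assumes "\<And>i j. i < n \<Longrightarrow> j < n \<Longrightarrow> (\<lambda>w. A w i j) \<in> borel_measurable N"
  shows "(\<lambda>w. sdet (Matrix.mat n n (\<lambda>(i, j). A w i j))) \<in> borel_measurable N"
proof -
  have sel: "(\<lambda>w. qRe (f w)) \<in> borel_measurable N" "(\<lambda>w. qIm1 (f w)) \<in> borel_measurable N"
    "(\<lambda>w. qIm2 (f w)) \<in> borel_measurable N" "(\<lambda>w. qIm3 (f w)) \<in> borel_measurable N"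
    if [measurable]: "f \<in> borel_measurable N" for f
  proof -
    have "qRe x = x \<bullet> Quat 1 0 0 0" "qIm1 x = x \<bullet> Quat 0 1 0 0" "qIm2 x = x \<bullet> Quat 0 0 1 0" "qIm3 x = x \<bullet> Quat 0 0 0 1" for x
      by (simp_all add: inner_quat_def)
    then show "(\<lambda>w. qRe (f w)) \<in> borel_measurable N" "(\<lambda>w. qIm1 (f w)) \<in> borel_measurable N"
      "(\<lambda>w. qIm2 (f w)) \<in> borel_measurable N" "(\<lambda>w. qIm3 (f w)) \<in> borel_measurable N"
      by simp_all
  qed
  have blk: "(\<lambda>w. qblock (f w) a b) \<in> borel_measurable N" if f: "f \<in> borel_measurable N" for f a b
    using sel[OF f] unfolding qblock_def Complex_eq
    by (cases "a = 0"; cases "b = 0")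
       (simp_all add: borel_measurable_add borel_measurable_times borel_measurable_of_real borel_measurable_uminus)
  define B where "B w = Matrix.mat n n (\<lambda>(i, j). A w i j)" for w
  have B: "B w \<in> carrier_mat n n" for w by (simp add: B_def)
  have "(\<lambda>w. det (study (B w))) \<in> borel_measurable N"
    unfolding det_def'[OF study_carrier[OF B]]
  proof (intro borel_measurable_sum borel_measurable_times borel_measurable_const borel_measurable_prod)
    fix p r assume "p \<in> {p. p permutes {0..<2 * n}}" "r \<in> {0..<2 * n}"
    then have rs: "r < 2 * n" "p r < 2 * n" by (auto dest: permutes_in_image[of p "{0..<2 * n}" r])
    then have "r div 2 < n" "p r div 2 < n" by auto
    then show "(\<lambda>w. study (B w) $$ (r, p r)) \<in> borel_measurable N"
      unfolding study_index[OF B rs] by (intro blk) (simp add: B_def assms)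
  qed
  then show ?thesis unfolding sdet_def B_def by simp
qed

subsection \<open>Givens rotations and the singular value decomposition\<close>

definition givens_row :: "nat \<Rightarrow> nat \<Rightarrow> real \<Rightarrow> quat \<Rightarrow> (nat \<Rightarrow> quat) \<Rightarrow> nat \<Rightarrow> quat" where
  "givens_row i j c s \<theta> = \<theta>(i := fst (givens c s (\<theta> i) (\<theta> j)), j := snd (givens c s (\<theta> i) (\<theta> j)))"

text \<open>Row \<open>r\<close> is the image of the \<open>r\<close>-th unit row, so multiplying by
  this matrix from the right applies \<open>givens_row\<close> to every row.\<close>

definition givens_mat :: "nat \<Rightarrow> nat \<Rightarrow> nat \<Rightarrow> real \<Rightarrow> quat \<Rightarrow> quat mat" where
  "givens_mat n i j c s = Matrix.mat n n (\<lambda>(r, k). givens_row i j c s (\<lambda>k. if r = k then 1 else 0) k)"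

lemma givens_mat_carrier [simp]: "givens_mat n i j c s \<in> carrier_mat n n"
  by (simp add: givens_mat_def)

lemma mat_mult_givens:
  assumes ij: "i < n" "j < n" "i \<noteq> j"
  shows "Matrix.mat p n (\<lambda>(r, k). A r k) * givens_mat n i j c s = Matrix.mat p n (\<lambda>(r, k). givens_row i j c s (A r) k)"
    (is "?A * ?G = ?B")
proof (rule eq_matI)
  fix r k assume "r < dim_row ?B" "k < dim_col ?B"
  then have rk: "r < p" "k < n" by simp_all
  have "(?A * ?G) $$ (r, k) = (\<Sum>l<n. ?A $$ (r, l) * ?G $$ (l, k))"
    by (rule index_mult_mat_sum) (use rk in auto)
  also have "\<dots> = (\<Sum>l<n. A r l * givens_row i j c s (\<lambda>k. if l = k then 1 else 0) k)"
    using rk by (intro sum.cong refl) (simp add: givens_mat_def)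
  also have "\<dots> = givens_row i j c s (A r) k"
  proof -
    have *: "(\<Sum>l<n. A r l * (if l = k then q else 0)) = A r k * q" if "k < n" for k q
      using that by (simp add: if_distrib[where f="\<lambda>x. _ * x"] cong: if_cong)
    have **: "(\<Sum>l<n. A r l * (c *\<^sub>R (if l = k then 1 else 0) + (if l = k' then 1 else 0) * q)) = c *\<^sub>R A r k + A r k' * q"
      if "k < n" "k' < n" for k k' q
    proof -
      have "(\<Sum>l<n. A r l * (c *\<^sub>R (if l = k then 1 else 0) + (if l = k' then 1 else 0) * q))
        = (\<Sum>l<n. A r l * (if l = k then of_real c else 0)) + (\<Sum>l<n. A r l * (if l = k' then q else 0))"
        unfolding sum.distrib[symmetric] by (intro sum.cong refl) (simp add: distrib_left of_real_def)
      then show ?thesis unfolding *[OF that(1)] *[OF that(2)] by (simp add: of_real_def)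
    qed
    show ?thesis
      using *[of k 1] **[of i j s] **[of j i "- qcnj s"] rk ij by (simp add: givens_row_def givens_def)
  qed
  finally show "(?A * ?G) $$ (r, k) = ?B $$ (r, k)" using rk by simp
qed (simp_all add: givens_mat_def)

lemma givens_inverse:
  assumes "c\<^sup>2 + (norm s)\<^sup>2 = 1"
  shows "givens c (- s) (fst (givens c s x y)) (snd (givens c s x y)) = (x, y)"
proof -
  have n: "(norm s)\<^sup>2 = 1 - c\<^sup>2" using assms by simp
  have "x * qcnj s * s = (1 - c\<^sup>2) *\<^sub>R x" "y * s * qcnj s = (1 - c\<^sup>2) *\<^sub>R y"
    using n by (simp_all only: mult.assoc qcnj_mult_self mult_qcnj) (simp_all add: of_real_def)
  then show ?thesis
    by (simp add: givens_def qcnj_uminus distrib_right left_diff_distrib scaleR_add_right scaleR_diff_right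
        scaleR_left_diff_distrib power2_eq_square)
qed

lemma givens_row_inverse:
  assumes "i \<noteq> j" "c\<^sup>2 + (norm s)\<^sup>2 = 1"
  shows "givens_row i j c (- s) (givens_row i j c s \<theta>) = \<theta>"
  using assms(1) by (auto simp: givens_row_def fun_eq_iff givens_inverse[OF assms(2)])

text \<open>Negating \<open>s\<close> gives both the adjoint and the inverse rotation.\<close>

lemma qunitary_givens_mat:
  assumes ij: "i < n" "j < n" "i \<noteq> j" and cs: "c\<^sup>2 + (norm s)\<^sup>2 = 1"
  shows "qunitary n (givens_mat n i j c s)"
proof -
  have adj: "qadjoint (givens_mat n i j c s) = givens_mat n i j c (- s)"
    using ij by (intro eq_matI)
      (auto simp: qadjoint_def givens_mat_def givens_row_def givens_def qcnj_add qcnj_minus qcnj_uminus qcnj_scaleR qcnj_mult)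
  have prod: "givens_mat n i j c s * givens_mat n i j c (- s) = 1\<^sub>m n" if "c\<^sup>2 + (norm s)\<^sup>2 = 1" for s
  proof -
    have "givens_mat n i j c s * givens_mat n i j c (- s)
      = Matrix.mat n n (\<lambda>(r, k). givens_row i j c (- s) (givens_row i j c s (\<lambda>k. if r = k then 1 else 0)) k)"
      unfolding givens_mat_def[of n i j c s] by (rule mat_mult_givens[OF ij])
    then show ?thesis
      unfolding givens_row_inverse[OF ij(3) that] by (auto intro!: eq_matI)
  qed
  show ?thesis
    unfolding qunitary_def adj using prod[OF cs] prod[of "- s"] cs by simp
qed

text \<open>If \<open>\<theta> m \<noteq> 0\<close>, a suitable rotation makes entry \<open>k\<close> vanish; otherwise a rotation by \<open>\<pi>/4\<close> first makes \<open>\<theta> m \<noteq> 0\<close>.\<close>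

lemma givens_row_induct:
  fixes \<theta> :: "nat \<Rightarrow> quat"
  assumes base: "\<And>\<theta>. (\<And>j. j < m \<Longrightarrow> \<theta> j = 0) \<Longrightarrow> P \<theta>"
    and step: "\<And>\<theta> k c s. k < m \<Longrightarrow> c > 0 \<Longrightarrow> c\<^sup>2 + (norm s)\<^sup>2 = 1 \<Longrightarrow> P (givens_row m k c s \<theta>) \<Longrightarrow> P \<theta>"
  shows "P \<theta>"
proof -
  have "P \<theta>" if "k \<le> m" "\<And>j. k \<le> j \<Longrightarrow> j < m \<Longrightarrow> \<theta> j = 0" for k \<theta>
    using that
  proof (induction k arbitrary: \<theta>)
    case 0
    then show ?case by (intro base) simp
  next
    case (Suc k)
    then have k: "k < m" by simp
    have nz: "P \<theta>" if supp: "\<And>j. Suc k \<le> j \<Longrightarrow> j < m \<Longrightarrow> \<theta> j = 0" and x0: "\<theta> m \<noteq> 0" for \<theta>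
    proof -
      define x y where "x = \<theta> m" and "y = \<theta> k"
      define N where "N = (norm x)\<^sup>2 + (norm y)\<^sup>2"
      have x: "norm x > 0" using x0 by (simp add: x_def)
      then have N: "N > 0" by (simp add: N_def add_pos_nonneg)
      \<comment> \<open>\<open>s\<close> is chosen to satisfy
        \<open>x * qcnj s = c *\<^sub>R y\<close>, which makes the second output vanish;
        \<open>c\<close> is then fixed by the normalisation.\<close>
      define c where "c = norm x / sqrt N"
      define s where "s = (c / (norm x)\<^sup>2) *\<^sub>R (qcnj y * x)"
      have c: "c > 0" using x N by (simp add: c_def)
      have c2: "c\<^sup>2 = (norm x)\<^sup>2 / N" using N by (simp add: c_def power_divide)
      have "(norm s)\<^sup>2 = c\<^sup>2 * (norm y)\<^sup>2 / (norm x)\<^sup>2"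
        using x by (simp add: s_def quat_norm_mult power_mult_distrib power_divide abs_mult field_simps power2_eq_square)
      also have "\<dots> = (norm y)\<^sup>2 / N" using x by (simp add: c2)
      finally have cs: "c\<^sup>2 + (norm s)\<^sup>2 = 1"
        using N x by (simp add: c2 N_def add_divide_distrib[symmetric])
      have "x * qcnj s = (c / (norm x)\<^sup>2) *\<^sub>R (x * qcnj x * y)"
        by (simp add: s_def qcnj_scaleR qcnj_mult mult.assoc)
      also have "\<dots> = c *\<^sub>R y"
        using x by (simp add: mult_qcnj of_real_def)
      finally have z: "snd (givens c s x y) = 0" by (simp add: givens_def)
      have "P (givens_row m k c s \<theta>)"
      proof (rule Suc.IH)
        show "givens_row m k c s \<theta> j = 0" if "k \<le> j" "j < m" for j
          using that supp[of j] z k by (cases "j = k") (auto simp: givens_row_def x_def y_def)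
      qed (use k in simp)
      then show ?thesis by (rule step[OF k c cs])
    qed
    show ?case
    proof (cases "\<theta> m = 0")
      case False
      then show ?thesis using Suc.prems by (intro nz) auto
    next
      case True
      show ?thesis
      proof (cases "\<theta> k = 0")
        case True
        show ?thesis
        proof (rule Suc.IH)
          show "\<theta> j = 0" if "k \<le> j" "j < m" for j
            using that Suc.prems(2)[of j] True by (cases "j = k") auto
        qed (use k in simp)
      next
        case False
        let ?c = "1 / sqrt 2" and ?s = "of_real (1 / sqrt 2) :: quat"
        have "P (givens_row m k ?c ?s \<theta>)"
        proof (rule nz)
          show "givens_row m k ?c ?s \<theta> j = 0" if "Suc k \<le> j" "j < m" for j
            using that Suc.prems(2)[of j] by (simp add: givens_row_def)
          show "givens_row m k ?c ?s \<theta> m \<noteq> 0"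
            using k True False by (simp add: givens_row_def givens_def of_real_def)
        qed
        then show ?thesis
          by (rule step[OF k, rotated 2]) (simp_all add: power_divide)
      qed
    qed
  qed
  from this[of m \<theta>] show ?thesis by simp
qed

section \<open>Unitary reduction of a row and singular values\<close>

definition row_mat :: "nat \<Rightarrow> (nat \<Rightarrow> quat) \<Rightarrow> quat mat" where
  "row_mat n \<theta> = Matrix.mat 1 n (\<lambda>(i, j). \<theta> j)"

definition row_norm_sq :: "quat mat \<Rightarrow> real" where
  "row_norm_sq Z = (\<Sum>j<dim_col Z. (norm (Z $$ (0, j)))\<^sup>2)"

lemma row_mat_carrier [simp]: "row_mat n \<theta> \<in> carrier_mat 1 n"
  by (simp add: row_mat_def)

lemma row_mat_eq: "Z \<in> carrier_mat 1 n \<Longrightarrow> Z = row_mat n (\<lambda>j. Z $$ (0, j))"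
  by (rule eq_matI) (auto simp: row_mat_def)

text \<open>\<open>R\<close> is the product of the Givens matrices that
  \<open>givens_row_induct\<close> runs through.\<close>

lemma ex_qunitary_row:
  "\<exists>R t. qunitary (Suc m) R \<and> row_mat (Suc m) \<theta> * R = row_mat (Suc m) (\<lambda>j. if j = m then t else 0)"
proof (induction \<theta> rule: givens_row_induct[where m=m])
  case (1 \<theta>)
  have "qunitary (Suc m) (1\<^sub>m (Suc m))"
    by (auto simp: qunitary_def qadjoint_def intro!: eq_matI)
  moreover have "row_mat (Suc m) \<theta> * 1\<^sub>m (Suc m) = row_mat (Suc m) (\<lambda>j. if j = m then \<theta> m else 0)"
    using right_mult_one_mat[OF row_mat_carrier[of "Suc m" \<theta>]] 1
    by (auto simp: row_mat_def intro!: eq_matI)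
  ultimately show ?case by blast
next
  case (2 \<theta> k c s)
  then obtain R t where R: "qunitary (Suc m) R"
    and eq: "row_mat (Suc m) (givens_row m k c s \<theta>) * R = row_mat (Suc m) (\<lambda>j. if j = m then t else 0)"
    by blast
  let ?G = "givens_mat (Suc m) m k c s"
  have G: "qunitary (Suc m) ?G" by (rule qunitary_givens_mat) (use 2 in auto)
  have cR: "R \<in> carrier_mat (Suc m) (Suc m)" using R by (simp add: qunitary_def)
  have "row_mat (Suc m) \<theta> * (?G * R) = row_mat (Suc m) \<theta> * ?G * R"
    by (rule assoc_mult_mat[OF row_mat_carrier givens_mat_carrier cR, symmetric])
  also have "row_mat (Suc m) \<theta> * ?G = row_mat (Suc m) (givens_row m k c s \<theta>)"
    unfolding row_mat_def using mat_mult_givens[of m "Suc m" k 1 "\<lambda>r. \<theta>" c s] 2 by simp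
  finally show ?case using qunitary_mult[OF G R] eq by auto
qed

lemma row_norm_sq_eq: "Z \<in> carrier_mat 1 n \<Longrightarrow> (Z * qadjoint Z) $$ (0, 0) = of_real (row_norm_sq Z)"
  by (subst index_mult_mat_sum[of _ 1 n _ 1])
     (auto simp: row_norm_sq_def qadjoint_index[of Z 1 n] mult_qcnj)

lemma row_norm_sq_qunitary:
  assumes Z: "Z \<in> carrier_mat 1 n" and U: "qunitary n U"
  shows "row_norm_sq (Z * U) = row_norm_sq Z"
proof -
  have c: "U \<in> carrier_mat n n" "qadjoint U \<in> carrier_mat n n" "qadjoint Z \<in> carrier_mat n 1"
    and u: "U * qadjoint U = 1\<^sub>m n"
    using U Z by (auto simp: qunitary_def)
  have "Z * U * qadjoint (Z * U) = Z * U * (qadjoint U * qadjoint Z)"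
    unfolding qadjoint_mult[OF Z c(1)] ..
  also have "\<dots> = Z * (U * (qadjoint U * qadjoint Z))"
    by (rule assoc_mult_mat[OF Z c(1) mult_carrier_mat[OF c(2,3)]])
  also have "U * (qadjoint U * qadjoint Z) = U * qadjoint U * qadjoint Z"
    by (rule assoc_mult_mat[OF c(1,2,3), symmetric])
  also have "\<dots> = qadjoint Z" unfolding u by (rule left_mult_one_mat[OF c(3)])
  finally have "of_real (row_norm_sq (Z * U)) = (of_real (row_norm_sq Z) :: quat)"
    using row_norm_sq_eq[OF mult_carrier_mat[OF Z c(1)]] row_norm_sq_eq[OF Z] by (simp only:)
  then show ?thesis by (simp only: of_real_eq_iff)
qed

lemma row_norm_sq_nonneg: "0 \<le> row_norm_sq Z"
  by (simp add: row_norm_sq_def sum_nonneg)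

text \<open>A continuous function attains its maximum on the compact unit sphere, and homogeneity
  extends the bound to all rows. The maximum is the square of the largest singular value.\<close>

lemma ex_max_row:
  assumes A: "A \<in> carrier_mat (Suc m) (Suc m)"
  shows "\<exists>x\<in>carrier_mat 1 (Suc m). row_norm_sq x = 1 \<and>
    (\<forall>z\<in>carrier_mat 1 (Suc m). row_norm_sq (z * A) \<le> row_norm_sq (x * A) * row_norm_sq z)"
proof -
  let ?n = "Suc m"
  define q where "q x = (\<Sum>i<?n. (norm (x i))\<^sup>2)" for x :: "nat \<Rightarrow> quat"
  define f where "f x = (\<Sum>j<?n. (norm (\<Sum>i<?n. x i * A $$ (i, j)))\<^sup>2)" for x :: "nat \<Rightarrow> quat"
  have rq: "row_norm_sq (row_mat ?n x) = q x" for x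
    by (simp add: row_norm_sq_def row_mat_def q_def del: sum.lessThan_Suc)
  have rf: "row_norm_sq (row_mat ?n x * A) = f x" for x
  proof -
    have "(row_mat ?n x * A) $$ (0, j) = (\<Sum>i<?n. x i * A $$ (i, j))" if "j < ?n" for j
      by (subst index_mult_mat_sum[OF row_mat_carrier A _ that]) (auto simp: row_mat_def simp del: sum.lessThan_Suc)
    then show ?thesis using A by (simp add: row_norm_sq_def f_def del: sum.lessThan_Suc)
  qed
  \<comment> \<open>Rows are functions on all natural numbers. Fixing the entries beyond the size at
    0 makes this a product of compact sets, hence compact.\<close>
  define K where "K = (\<Pi>\<^sub>E i\<in>UNIV. if i < ?n then cball (0::quat) 1 else {0})"
  define S where "S = K \<inter> {x. q x = 1}"
  have K: "compact K"
  proof -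
    have "compactin (product_topology (\<lambda>i::nat. euclidean :: quat topology) UNIV) K"
      unfolding K_def compactin_PiE by auto
    then show ?thesis unfolding euclidean_product_topology by simp
  qed
  have coord: "continuous_on T (\<lambda>x. x i)" for T :: "(nat \<Rightarrow> quat) set" and i
    by (rule continuous_on_product_coordinates[THEN continuous_on_subset]) simp
  have qc: "continuous_on T q" and fc: "continuous_on T f" for T
    unfolding q_def f_def by (intro continuous_intros coord)+
  have cS: "compact S"
    unfolding S_def
    by (intro compact_Int_closed K closed_Collect_eq qc continuous_on_const)
  have neS: "S \<noteq> {}"
  proof -
    have "(\<lambda>i. if i = m then 1 else 0) \<in> S"
      by (auto simp: S_def K_def q_def PiE_def extensional_def if_distrib[where f="\<lambda>x. (norm x)\<^sup>2"] cong: if_cong)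
    then show ?thesis by auto
  qed
  obtain x where x: "x \<in> S" and max: "\<And>y. y \<in> S \<Longrightarrow> f y \<le> f x"
    using continuous_attains_sup[OF cS neS fc] by blast
  have "f z \<le> f x * q z" for z
  proof (cases "q z = 0")
    case True
    then have "z i = 0" if "i < ?n" for i
      using that unfolding q_def by (subst (asm) sum_nonneg_eq_0_iff) auto
    then have "f z = 0" by (simp add: f_def del: sum.lessThan_Suc)
    then show ?thesis using True by simp
  next
    case False
    then have qp: "q z > 0" unfolding q_def by (simp add: less_le sum_nonneg del: sum.lessThan_Suc)
    define r where "r = 1 / sqrt (q z)"
    have r2: "r\<^sup>2 = 1 / q z" and r0: "r > 0" using qp by (simp_all add: r_def power_divide)
    define y where "y i = (if i < ?n then r *\<^sub>R z i else 0)" for i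
    have qy: "q y = 1"
    proof -
      have "q y = r\<^sup>2 * q z"
        by (simp add: q_def y_def power_mult_distrib sum_distrib_left del: sum.lessThan_Suc)
      then show ?thesis using qp by (simp add: r2)
    qed
    have fy: "f y = r\<^sup>2 * f z"
    proof -
      have "(\<Sum>i<?n. y i * A $$ (i, j)) = r *\<^sub>R (\<Sum>i<?n. z i * A $$ (i, j))" for j
        by (simp add: y_def scaleR_sum_right del: sum.lessThan_Suc)
      then show ?thesis
        by (simp add: f_def power_mult_distrib sum_distrib_left del: sum.lessThan_Suc)
    qed
    have "norm (y i) \<le> 1" if "i < ?n" for i
    proof -
      have "(norm (y i))\<^sup>2 \<le> q y"
        unfolding q_def using that by (intro member_le_sum) auto
      then show ?thesis using power2_le_imp_le[of "norm (y i)" 1] unfolding qy by simp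
    qed
    then have "y \<in> S" using qy by (auto simp: S_def K_def y_def PiE_def extensional_def)
    from max[OF this] show ?thesis using qp by (simp add: fy r2 field_simps)
  qed
  note f_le = this
  show ?thesis
  proof (intro bexI[of _ "row_mat ?n x"] conjI ballI)
    show "row_norm_sq (row_mat ?n x) = 1" using x by (simp add: rq S_def)
    fix z :: "quat mat" assume "z \<in> carrier_mat 1 ?n"
    then have z: "z = row_mat ?n (\<lambda>j. z $$ (0, j))" by (rule row_mat_eq)
    show "row_norm_sq (z * A) \<le> row_norm_sq (row_mat ?n x * A) * row_norm_sq z"
      by (subst (1 2) z) (simp only: rf rq f_le)
  qed (rule row_mat_carrier)
qed

definition diag_sum :: "nat \<Rightarrow> quat mat \<Rightarrow> quat \<Rightarrow> quat mat" where
  "diag_sum m C t = four_block_mat C (0\<^sub>m m 1) (0\<^sub>m 1 m) (Matrix.mat 1 1 (\<lambda>_. t))"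

lemma diag_sum_carrier: "C \<in> carrier_mat m m \<Longrightarrow> diag_sum m C t \<in> carrier_mat (Suc m) (Suc m)"
  unfolding diag_sum_def by (rule carrier_matI) auto

lemma diag_sum_mult:
  assumes "C \<in> carrier_mat m m" "D \<in> carrier_mat m m"
  shows "diag_sum m C t * diag_sum m D u = diag_sum m (C * D) (t * u)"
proof -
  have T: "Matrix.mat 1 1 (\<lambda>_. t) * Matrix.mat 1 1 (\<lambda>_. u) = Matrix.mat 1 1 (\<lambda>_. t * u)"
    by (rule eq_matI) (auto simp: scalar_prod_def)
  show ?thesis
    unfolding diag_sum_def
    by (subst mult_four_block_mat[of _ m m _ 1 _ 1 _ _ m _ 1])
       (use assms T in auto)
qed

lemma qadjoint_diag_sum:
  assumes "C \<in> carrier_mat m m"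
  shows "qadjoint (diag_sum m C t) = diag_sum m (qadjoint C) (qcnj t)"
  using assms by (intro eq_matI) (auto simp: diag_sum_def qadjoint_def)

lemma diag_sum_one: "diag_sum m (1\<^sub>m m) 1 = 1\<^sub>m (Suc m)"
  by (rule eq_matI) (auto simp: diag_sum_def)

lemma diag_sum_diag: "diag_sum m (mat_diag m f) (f m) = mat_diag (Suc m) f"
  by (rule eq_matI) (auto simp: diag_sum_def mat_diag_def less_Suc_eq)

lemma qunitary_diag_sum:
  assumes "qunitary m U" "norm t = 1"
  shows "qunitary (Suc m) (diag_sum m U t)"
  using assms
  by (auto simp: qunitary_def diag_sum_carrier qadjoint_diag_sum diag_sum_mult mult_qcnj qcnj_mult_self diag_sum_one)

text \<open>Rotate a unit row \<open>x\<close> maximising \<open>\<bar>x A\<bar>\<close> and its image to multiples of the last unit vector. Then the last row of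
  the transformed matrix vanishes off the diagonal, and by maximality so does the last column.\<close>

lemma ex_qsingular_values: "A \<in> carrier_mat n n \<Longrightarrow> \<exists>s. is_qsingular_values A s"
proof (induction n arbitrary: A)
  case 0
  have "qunitary 0 (1\<^sub>m 0)" by (auto simp: qunitary_def qadjoint_def)
  moreover have "A = 1\<^sub>m 0 * mat_diag 0 (\<lambda>i. of_real ([] ! i)) * qadjoint (1\<^sub>m 0)"
    using 0 by (intro eq_matI) (auto simp: mat_diag_def qadjoint_def)
  ultimately have "is_qsingular_values A []"
    using 0 unfolding is_qsingular_values_def by auto
  then show ?case by blast
next
  case (Suc m)
  let ?n = "Suc m"
  note A = Suc.prems
  obtain x where x: "x \<in> carrier_mat 1 ?n" and x1: "row_norm_sq x = 1"
    and max: "\<And>z. z \<in> carrier_mat 1 ?n \<Longrightarrow> row_norm_sq (z * A) \<le> row_norm_sq (x * A) * row_norm_sq z"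
    using ex_max_row[OF A] by blast
  define \<sigma> where "\<sigma> = sqrt (row_norm_sq (x * A))"
  have \<sigma>: "\<sigma> \<ge> 0" "\<sigma>\<^sup>2 = row_norm_sq (x * A)" by (simp_all add: \<sigma>_def row_norm_sq_nonneg)
  let ?e = "\<lambda>t. row_mat ?n (\<lambda>j. if j = m then t else 0)"
  have norm_e: "row_norm_sq (?e t) = (norm t)\<^sup>2" for t
    by (simp add: row_norm_sq_def row_mat_def if_distrib[where f="\<lambda>x. (norm x)\<^sup>2"] cong: if_cong)
  obtain L t where L: "qunitary ?n L" and xL: "x * L = ?e t"
    using ex_qunitary_row[of m "\<lambda>j. x $$ (0, j)"] row_mat_eq[OF x] by auto
  have t: "norm t = 1"
    using row_norm_sq_qunitary[OF x L] x1 norm_ge_zero[of t] unfolding xL norm_e by (auto simp: power2_eq_1_iff)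
  have cL: "L \<in> carrier_mat ?n ?n" "qadjoint L \<in> carrier_mat ?n ?n" using L by (auto simp: qunitary_def)
  \<comment> \<open>This is the last row of \<open>qadjoint L * A\<close>. The row
    \<open>x * A\<close> is \<open>t\<close> times it with \<open>norm t = 1\<close>, so its norm is
    \<sigma>.\<close>
  define y where "y = ?e 1 * (qadjoint L * A)"
  have y: "y \<in> carrier_mat 1 ?n" unfolding y_def by (rule mult_carrier_mat[OF row_mat_carrier mult_carrier_mat[OF cL(2) A]])
  have LLA: "L * (qadjoint L * A) = A"
    using L A cL assoc_mult_mat[OF cL A] by (simp add: qunitary_def)
  have ny: "row_norm_sq y = \<sigma>\<^sup>2"
  proof -
    have "x * A = x * L * (qadjoint L * A)"
      using assoc_mult_mat[OF x cL(1) mult_carrier_mat[OF cL(2) A]] by (simp add: LLA)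
    also have "\<dots> = ?e t * (qadjoint L * A)" by (simp add: xL)
    finally have "row_norm_sq (x * A) = row_norm_sq (?e t * (qadjoint L * A))" by simp
    moreover have "(?e t * (qadjoint L * A)) $$ (0, j) = t * y $$ (0, j)" if "j < ?n" for j
    proof -
      have e: "(?e u * (qadjoint L * A)) $$ (0, j) = u * (qadjoint L * A) $$ (m, j)" for u
        by (subst index_mult_mat_sum[OF row_mat_carrier mult_carrier_mat[OF cL(2) A] _ that])
           (auto simp: row_mat_def if_distrib[where f="\<lambda>x. x * _"] cong: if_cong)
      show ?thesis unfolding y_def e by simp
    qed
    ultimately show ?thesis
      using A y t unfolding \<sigma>(2) by (simp add: row_norm_sq_def quat_norm_mult del: sum.lessThan_Suc)
  qed
  obtain R \<beta> where R: "qunitary ?n R" and yR: "y * R = ?e \<beta>"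
    using ex_qunitary_row[of m "\<lambda>j. y $$ (0, j)"] row_mat_eq[OF y] by auto
  have cR: "R \<in> carrier_mat ?n ?n" "qadjoint R \<in> carrier_mat ?n ?n" using R by (auto simp: qunitary_def)
  have \<beta>: "norm \<beta> = \<sigma>"
    using row_norm_sq_qunitary[OF y R] ny \<sigma>(1) unfolding yR norm_e by (simp add: power2_eq_iff_nonneg)
  define B where "B = qadjoint L * A * R"
  have B: "B \<in> carrier_mat ?n ?n" unfolding B_def by (rule mult_carrier_mat[OF mult_carrier_mat[OF cL(2) A] cR(1)])
  have eB: "?e 1 * B = ?e \<beta>"
    unfolding B_def yR[symmetric] y_def
    by (rule assoc_mult_mat[OF row_mat_carrier mult_carrier_mat[OF cL(2) A] cR(1), symmetric])
  have row: "B $$ (m, j) = (if j = m then \<beta> else 0)" if "j < ?n" for j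
  proof -
    have "(?e 1 * B) $$ (0, j) = B $$ (m, j)"
      by (subst index_mult_mat_sum[OF row_mat_carrier B _ that])
         (auto simp: row_mat_def if_distrib[where f="\<lambda>x. x * _"] cong: if_cong)
    then show ?thesis unfolding eB using that by (simp add: row_mat_def)
  qed
  have maxB: "row_norm_sq (z * B) \<le> \<sigma>\<^sup>2 * row_norm_sq z" if z: "z \<in> carrier_mat 1 ?n" for z
  proof -
    have zL: "z * qadjoint L \<in> carrier_mat 1 ?n" by (rule mult_carrier_mat[OF z cL(2)])
    have "z * B = z * (qadjoint L * A) * R"
      unfolding B_def by (rule assoc_mult_mat[OF z mult_carrier_mat[OF cL(2) A] cR(1), symmetric])
    also have "z * (qadjoint L * A) = z * qadjoint L * A"
      by (rule assoc_mult_mat[OF z cL(2) A, symmetric])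
    finally have "row_norm_sq (z * B) = row_norm_sq (z * qadjoint L * A)"
      using row_norm_sq_qunitary[OF mult_carrier_mat[OF zL A] R] by simp
    also have "\<dots> \<le> \<sigma>\<^sup>2 * row_norm_sq (z * qadjoint L)"
      using max[OF zL] by (simp add: \<sigma>(2))
    also have "row_norm_sq (z * qadjoint L) = row_norm_sq z"
      by (rule row_norm_sq_qunitary[OF z qunitary_qadjoint[OF L]])
    finally show ?thesis .
  qed
  have col: "B $$ (i, m) = 0" if i: "i < m" for i
  proof -
    \<comment> \<open>Testing maximality on the adjoint of the last column: entry \<open>m\<close>
      of \<open>z * B\<close> is \<open>w\<close>, so
      \<open>w\<^sup>2 \<le> \<sigma>\<^sup>2 * w\<close>. But \<open>w\<close> already contains
      \<open>\<sigma>\<^sup>2\<close> from its diagonal entry, which leaves nothing for the entries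
      above.\<close>
    define z where "z = row_mat ?n (\<lambda>i. qcnj (B $$ (i, m)))"
    define w where "w = (\<Sum>i<?n. (norm (B $$ (i, m)))\<^sup>2)"
    have w: "row_norm_sq z = w"
      by (simp add: z_def w_def row_norm_sq_def row_mat_def del: sum.lessThan_Suc)
    have w0: "w \<ge> 0" by (simp add: w_def sum_nonneg)
    have "(z * B) $$ (0, m) = of_real w"
      unfolding z_def
      by (subst index_mult_mat_sum[OF row_mat_carrier B])
         (auto simp: row_mat_def w_def qcnj_mult_self simp del: sum.lessThan_Suc)
    then have "w\<^sup>2 \<le> row_norm_sq (z * B)"
      using B member_le_sum[of m "{..<?n}" "\<lambda>j. (norm ((z * B) $$ (0, j)))\<^sup>2"]
      by (simp add: row_norm_sq_def del: sum.lessThan_Suc)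
    also have "\<dots> \<le> \<sigma>\<^sup>2 * w"
      using maxB[of z] row_mat_carrier unfolding w[symmetric] z_def by blast
    finally have "w * w \<le> \<sigma>\<^sup>2 * w" by (simp add: power2_eq_square)
    then have "w = 0 \<or> w \<le> \<sigma>\<^sup>2" using w0 by (auto simp: mult_le_cancel_right)
    moreover have "w = (\<Sum>i<m. (norm (B $$ (i, m)))\<^sup>2) + \<sigma>\<^sup>2"
      using row[of m] by (simp add: w_def \<beta>)
    ultimately have "(\<Sum>i<m. (norm (B $$ (i, m)))\<^sup>2) \<le> 0"
      using zero_le_power2[of \<sigma>] by (elim disjE) linarith+
    moreover have "(norm (B $$ (i, m)))\<^sup>2 \<le> (\<Sum>i<m. (norm (B $$ (i, m)))\<^sup>2)"
      using i by (intro member_le_sum) auto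
    ultimately have "(norm (B $$ (i, m)))\<^sup>2 \<le> 0" by linarith
    then show ?thesis by simp
  qed
  define C where "C = Matrix.mat m m (\<lambda>(i, j). B $$ (i, j))"
  have C: "C \<in> carrier_mat m m" by (simp add: C_def)
  have BC: "B = diag_sum m C \<beta>"
    using B row col by (intro eq_matI) (auto simp: diag_sum_def C_def less_Suc_eq)
  obtain s where "is_qsingular_values C s" using Suc.IH[OF C] by blast
  then obtain U V where len: "length s = m" and s0: "\<forall>x\<in>set s. 0 \<le> x" and U: "qunitary m U" and V: "qunitary m V"
    and CUV: "C = U * mat_diag m (\<lambda>i. of_real (s ! i)) * qadjoint V"
    using C unfolding is_qsingular_values_def by auto
  \<comment> \<open>The unit phase of \<beta>, absorbed into the right unitary factor so that the
    new diagonal entry is the real number \<sigma>. If \<sigma> is 0 any unit serves, and 1 is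
    taken.\<close>
  define w where "w = (if \<sigma> = 0 then 1 else (1 / \<sigma>) *\<^sub>R \<beta>)"
  have w: "norm w = 1" "of_real \<sigma> * w = \<beta>"
    using \<beta> \<sigma>(1) by (auto simp: w_def of_real_def)
  let ?s = "s @ [\<sigma>]" and ?U = "L * diag_sum m U 1" and ?V = "R * diag_sum m V (qcnj w)"
  let ?D = "mat_diag m (\<lambda>i. of_real (s ! i)) :: quat mat"
  have cUV: "U \<in> carrier_mat m m" "V \<in> carrier_mat m m" "qadjoint V \<in> carrier_mat m m" "?D \<in> carrier_mat m m"
    using U V by (auto simp: qunitary_def)
  have diag: "mat_diag ?n (\<lambda>i. of_real (?s ! i)) = diag_sum m ?D (of_real \<sigma>)"
  proof -
    have "?D = mat_diag m (\<lambda>i. of_real (?s ! i))"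
      using len by (intro eq_matI) (auto simp: mat_diag_def nth_append)
    then show ?thesis using diag_sum_diag[of m "\<lambda>i. of_real (?s ! i)"] len by (simp add: nth_append)
  qed
  have B2: "B = diag_sum m U 1 * diag_sum m ?D (of_real \<sigma>) * qadjoint (diag_sum m V (qcnj w))"
    using cUV w by (simp add: BC CUV qadjoint_diag_sum diag_sum_mult)
  let ?P = "diag_sum m U 1" and ?Q = "diag_sum m ?D (of_real \<sigma>)" and ?W = "qadjoint (diag_sum m V (qcnj w))"
  have c3: "?P \<in> carrier_mat ?n ?n" "?Q \<in> carrier_mat ?n ?n" "?W \<in> carrier_mat ?n ?n" "diag_sum m V (qcnj w) \<in> carrier_mat ?n ?n"
    using cUV by (auto intro!: diag_sum_carrier qadjoint_carrier)
  have dA: "dim_row A = ?n" using A by simp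
  have "L * B * qadjoint R = A"
  proof -
    have "L * B = L * (qadjoint L * A) * R"
      unfolding B_def by (rule assoc_mult_mat[OF cL(1) mult_carrier_mat[OF cL(2) A] cR(1), symmetric])
    then have "L * B * qadjoint R = A * (R * qadjoint R)"
      unfolding LLA by (simp only: assoc_mult_mat[OF A cR])
    then show ?thesis using R A by (simp add: qunitary_def)
  qed
  moreover have "L * (?P * ?Q * ?W) * qadjoint R = L * ?P * ?Q * (?W * qadjoint R)"
  proof -
    note LP = mult_carrier_mat[OF cL(1) c3(1)]
    have "L * (?P * ?Q * ?W) = L * (?P * (?Q * ?W))"
      by (simp only: assoc_mult_mat[OF c3(1,2,3)])
    also have "\<dots> = L * ?P * ?Q * ?W"
      by (simp only: assoc_mult_mat[OF cL(1) c3(1) mult_carrier_mat[OF c3(2,3)], symmetric] assoc_mult_mat[OF LP c3(2,3)])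
    finally show ?thesis
      by (simp only: assoc_mult_mat[OF mult_carrier_mat[OF LP c3(2)] c3(3) cR(2)])
  qed
  moreover have "?W * qadjoint R = qadjoint ?V"
    by (rule qadjoint_mult[OF cR(1) c3(4), symmetric])
  ultimately have eq: "A = ?U * mat_diag ?n (\<lambda>i. of_real (?s ! i)) * qadjoint ?V"
    unfolding diag using B2 by simp
  have "qunitary ?n ?U" "qunitary ?n ?V"
    using qunitary_mult[OF L qunitary_diag_sum[OF U]] qunitary_mult[OF R qunitary_diag_sum[OF V]] w by auto
  moreover have "length ?s = ?n" "\<forall>x\<in>set ?s. 0 \<le> x" using len s0 \<sigma>(1) by auto
  ultimately have "is_qsingular_values A ?s"
    unfolding is_qsingular_values_def dA using eq by blast
  then show ?case by blast
qed

lemma Sdet_sq_eq_sdet: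
  assumes "A \<in> carrier_mat n n"
  shows "(Sdet A)\<^sup>2 = sdet A"
proof -
  have "is_qsingular_values A (qsingular_values A)"
    unfolding qsingular_values_def by (rule someI_ex[OF ex_qsingular_values[OF assms]])
  then show ?thesis using sdet_eq_singular_values[OF assms] by (simp add: Sdet_def)
qed

section \<open>Laplace transform of the Study determinant for a fixed last row\<close>

definition sdet_laplace :: "nat \<Rightarrow> real \<Rightarrow> (nat \<Rightarrow> quat) \<Rightarrow> real" where
  "sdet_laplace m s \<theta> = (\<integral>X. exp (- s * sdet (Matrix.mat (Suc m) (Suc m) (\<lambda>(i, j). add_row m \<theta> X i j))) \<partial>qcols m {..<Suc m})"

lemma measurable_sdet_add_row:
  assumes "f \<in> N \<rightarrow>\<^sub>M qcols m {..<Suc m}"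
  shows "(\<lambda>w. sdet (Matrix.mat (Suc m) (Suc m) (\<lambda>(i, j). add_row m \<theta> (f w) i j))) \<in> borel_measurable N"
  unfolding add_row_def
  by (rule measurable_sdet) (auto intro!: measurable_qcols_entry[OF assms] simp: less_Suc_eq)

text \<open>Rotating the fixed row and the random rows together is right multiplication by one
  unitary Givens matrix.\<close>

lemma sdet_add_row_rotate:
  assumes k: "k < m" and cs: "c\<^sup>2 + (norm s)\<^sup>2 = 1"
  shows "sdet (Matrix.mat (Suc m) (Suc m) (\<lambda>(i, j). add_row m (givens_row m k c s \<theta>) (rotate_cols m m k c s X) i j))
    = sdet (Matrix.mat (Suc m) (Suc m) (\<lambda>(i, j). add_row m \<theta> X i j))"
proof -
  let ?n = "Suc m"
  have ij: "m < ?n" "k < ?n" "m \<noteq> k" using k by auto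
  have "Matrix.mat ?n ?n (\<lambda>(i, j). add_row m (givens_row m k c s \<theta>) (rotate_cols m m k c s X) i j)
    = Matrix.mat ?n ?n (\<lambda>(i, j). givens_row m k c s (add_row m \<theta> X i) j)"
    using k by (intro eq_matI) (auto simp: add_row_def givens_row_def rotate_cols_def givens_col_def)
  also have "\<dots> = Matrix.mat ?n ?n (\<lambda>(i, j). add_row m \<theta> X i j) * givens_mat ?n m k c s"
    by (rule mat_mult_givens[OF ij, symmetric])
  finally show ?thesis
    by (simp add: sdet_mult[of _ ?n] sdet_qunitary[OF qunitary_givens_mat[OF ij cs]])
qed

lemma sum_norm_sq_givens_row:
  assumes "k < m" "c\<^sup>2 + (norm s)\<^sup>2 = 1"
  shows "(\<Sum>j<Suc m. (norm (givens_row m k c s \<theta> j))\<^sup>2) = (\<Sum>j<Suc m. (norm (\<theta> j))\<^sup>2)"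
  using sum_norm_sq_upd2[OF assms(1), of \<theta> "snd (givens c s (\<theta> m) (\<theta> k))" "fst (givens c s (\<theta> m) (\<theta> k))"]
    sum_norm_sq_upd2[OF assms(1), of \<theta> "\<theta> k" "\<theta> m"] norm_sq_givens[OF assms(2), of "\<theta> m" "\<theta> k"] assms(1)
  by (simp add: givens_row_def givens_def fun_upd_twist[of m k] del: sum.lessThan_Suc)

text \<open>Unlike \<open>cdet\<close>, \<open>sdet\<close> is invariant under quaternionic
  rotations of the columns. So \<theta> can be moved into entry \<open>m\<close> at no loss, without
  changing the law of \<open>X\<close> or the norm of \<theta>; there \<open>sdet_last_row\<close>
  splits it off.\<close>

lemma sdet_laplace_eq:
  "sdet_laplace m s \<theta>
    = (\<integral>X. exp (- s * (\<Sum>j<Suc m. (norm (\<theta> j))\<^sup>2) * sdet (Matrix.mat m m (\<lambda>(i, j). X j i))) \<partial>qcols m {..<Suc m})"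
proof (induction \<theta> rule: givens_row_induct[where m=m])
  case (1 \<theta>)
  have "sdet (Matrix.mat (Suc m) (Suc m) (\<lambda>(i, j). add_row m \<theta> X i j)) = sdet (Matrix.mat m m (\<lambda>(i, j). X j i)) * (norm (\<theta> m))\<^sup>2" for X
  proof -
    have "Matrix.mat m m (\<lambda>(i, j). add_row m \<theta> X i j) = Matrix.mat m m (\<lambda>(i, j). X j i)"
      by (rule eq_matI) (auto simp: add_row_def)
    moreover have "add_row m \<theta> X m j = \<theta> j" for j by (simp add: add_row_def)
    ultimately show ?thesis using sdet_last_row[of m "add_row m \<theta> X"] 1 by simp
  qed
  moreover have "(\<Sum>j<Suc m. (norm (\<theta> j))\<^sup>2) = (norm (\<theta> m))\<^sup>2" using 1 by simp
  ultimately show ?case by (simp add: sdet_laplace_def mult_ac)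
next
  case (2 \<theta> k c t)
  let ?P = "qcols m {..<Suc m}"
  have [measurable]: "(\<lambda>X. sdet (Matrix.mat (Suc m) (Suc m) (\<lambda>(i, j). add_row m \<theta> X i j))) \<in> borel_measurable ?P" for \<theta>
    by (rule measurable_sdet_add_row) (simp add: measurable_ident_sets)
  have "sdet_laplace m s (givens_row m k c t \<theta>)
    = (\<integral>X. exp (- s * sdet (Matrix.mat (Suc m) (Suc m) (\<lambda>(i, j). add_row m (givens_row m k c t \<theta>) (rotate_cols m m k c t X) i j))) \<partial>?P)"
    unfolding sdet_laplace_def by (rule integral_rotate_cols[symmetric]) (use 2 in auto)
  also have "\<dots> = sdet_laplace m s \<theta>"
    unfolding sdet_laplace_def sdet_add_row_rotate[OF 2(1,3)] ..
  finally show ?case using 2 by (simp only: sum_norm_sq_givens_row)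
qed

subsection \<open>Induction on the size\<close>

abbreviation square :: "nat \<Rightarrow> (nat \<times> nat) set" where
  "square n \<equiv> {..<n} \<times> {..<n}"

section \<open>Splitting a Gaussian matrix into its last row and the rest\<close>

lemma measurable_add_row:
  "(\<lambda>z. \<lambda>p\<in>square (Suc m). add_row m (fst z) (snd z) (fst p) (snd p))
    \<in> qvec {..<Suc m} \<Otimes>\<^sub>M qcols m {..<Suc m} \<rightarrow>\<^sub>M qvec (square (Suc m))"
proof (rule measurable_restrict)
  fix p assume "p \<in> square (Suc m)"
  then show "(\<lambda>z. add_row m (fst z) (snd z) (fst p) (snd p)) \<in> qvec {..<Suc m} \<Otimes>\<^sub>M qcols m {..<Suc m} \<rightarrow>\<^sub>M qgauss"
    unfolding measurable_qgauss_eq_borel add_row_def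
    by (cases "fst p = m")
       (auto intro!: measurable_qcols_entry[OF measurable_snd] measurable_qvec_component[OF _ measurable_fst])
qed

text \<open>Checked on boxes: the preimage of a box is a box for the row times a box for the
  columns, so its measure is the product over all entries.\<close>

lemma distr_add_row:
  "distr (qvec {..<Suc m} \<Otimes>\<^sub>M qcols m {..<Suc m}) (qvec (square (Suc m)))
     (\<lambda>z. \<lambda>p\<in>square (Suc m). add_row m (fst z) (snd z) (fst p) (snd p)) = qvec (square (Suc m))"
  (is "distr ?N _ ?f = _")
proof -
  let ?n = "Suc m"
  interpret product_sigma_finite "\<lambda>_::nat \<times> nat. qgauss" by (rule product_sigma_finite_qgauss)
  interpret p1: product_sigma_finite "\<lambda>_::nat. qgauss" by (rule product_sigma_finite_qgauss)
  interpret p2: product_sigma_finite "\<lambda>_::nat. qvec {..<m::nat}" by (rule product_sigma_finite_qvec)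
  interpret T: sigma_finite_measure "qcols m {..<?n}" by (rule prob_space_imp_sigma_finite[OF prob_space_qcols])
  note f = measurable_add_row[of m]
  show ?thesis
  proof (rule PiM_eqI)
    show "finite (square ?n)" by simp
    show "sets (distr ?N (qvec (square ?n)) ?f) = sets (qvec (square ?n))" by simp
    fix A assume "\<And>p. p \<in> square ?n \<Longrightarrow> A p \<in> sets qgauss"
    then have A: "A (i, j) \<in> sets borel" if "i < ?n" "j < ?n" for i j using that by auto
    let ?S = "\<Pi>\<^sub>E j\<in>{..<?n}. A (m, j)" and ?T = "\<Pi>\<^sub>E j\<in>{..<?n}. \<Pi>\<^sub>E i\<in>{..<m}. A (i, j)"
    have T: "(\<Pi>\<^sub>E i\<in>{..<m}. A (i, j)) \<in> sets (qvec {..<m})" if "j < ?n" for j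
      using that by (intro sets_PiM_I_finite) (auto intro!: A)
    have sT: "?S \<in> sets (qvec {..<?n})" "?T \<in> sets (qcols m {..<?n})"
      by (intro sets_PiM_I_finite; auto intro!: A T)+
    have "emeasure (distr ?N (qvec (square ?n)) ?f) (Pi\<^sub>E (square ?n) A) = emeasure ?N (?f -` Pi\<^sub>E (square ?n) A \<inter> space ?N)"
      by (rule emeasure_distr[OF f]) (use A in \<open>auto intro!: sets_PiM_I_finite\<close>)
    also have "?f -` Pi\<^sub>E (square ?n) A \<inter> space ?N = ?S \<times> ?T"
    proof (rule Set.set_eqI)
      fix z :: "(nat \<Rightarrow> quat) \<times> (nat \<Rightarrow> nat \<Rightarrow> quat)"
      obtain \<theta> X where z: "z = (\<theta>, X)" by (cases z)
      have "z \<in> ?f -` Pi\<^sub>E (square ?n) A \<inter> space ?N \<longleftrightarrow>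
        (\<forall>i<?n. \<forall>j<?n. add_row m \<theta> X i j \<in> A (i, j)) \<and> \<theta> \<in> extensional {..<?n} \<and>
        X \<in> extensional {..<?n} \<and> (\<forall>j<?n. X j \<in> extensional {..<m})"
        unfolding z by (auto simp: space_pair_measure space_PiM PiE_def Pi_def)
      also have "\<dots> \<longleftrightarrow> z \<in> ?S \<times> ?T"
        unfolding z by (auto simp: add_row_def PiE_def Pi_def less_Suc_eq all_conj_distrib)
      finally show "z \<in> ?f -` Pi\<^sub>E (square ?n) A \<inter> space ?N \<longleftrightarrow> z \<in> ?S \<times> ?T" .
    qed
    also have "emeasure ?N (?S \<times> ?T) = emeasure (qvec {..<?n}) ?S * emeasure (qcols m {..<?n}) ?T"
      by (rule T.emeasure_pair_measure_Times[OF sT])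
    also have "\<dots> = (\<Prod>j<?n. emeasure qgauss (A (m, j))) * (\<Prod>j<?n. \<Prod>i<m. emeasure qgauss (A (i, j)))"
    proof (rule arg_cong2[where f="(*)"])
      show "emeasure (qvec {..<?n}) ?S = (\<Prod>j<?n. emeasure qgauss (A (m, j)))"
        by (rule p1.emeasure_PiM) (auto intro!: A)
      have "emeasure (qcols m {..<?n}) ?T = (\<Prod>j<?n. emeasure (qvec {..<m}) (\<Pi>\<^sub>E i\<in>{..<m}. A (i, j)))"
        by (rule p2.emeasure_PiM) (auto intro!: T)
      also have "\<dots> = (\<Prod>j<?n. \<Prod>i<m. emeasure qgauss (A (i, j)))"
        by (intro prod.cong refl p1.emeasure_PiM) (auto intro!: A)
      finally show "emeasure (qcols m {..<?n}) ?T = (\<Prod>j<?n. \<Prod>i<m. emeasure qgauss (A (i, j)))" .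
    qed
    also have "(\<Prod>j<?n. \<Prod>i<m. emeasure qgauss (A (i, j))) = (\<Prod>i<m. \<Prod>j<?n. emeasure qgauss (A (i, j)))"
      by (rule prod.swap)
    also have "(\<Prod>j<?n. emeasure qgauss (A (m, j))) * (\<Prod>i<m. \<Prod>j<?n. emeasure qgauss (A (i, j)))
        = (\<Prod>i<?n. \<Prod>j<?n. emeasure qgauss (A (i, j)))"
      unfolding prod.lessThan_Suc[of "\<lambda>i. \<Prod>j<?n. emeasure qgauss (A (i, j))"] by (rule mult.commute)
    also have "\<dots> = (\<Prod>p\<in>square ?n. emeasure qgauss (A p))"
      by (subst prod.cartesian_product) (simp add: case_prod_unfold)
    finally show "emeasure (distr ?N (qvec (square ?n)) ?f) (Pi\<^sub>E (square ?n) A) = (\<Prod>p\<in>square ?n. emeasure qgauss (A p))" .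
  qed
qed

lemma measurable_drop_col:
  "(\<lambda>X. \<lambda>p\<in>square m. X (snd p) (fst p)) \<in> qcols m {..<Suc m} \<rightarrow>\<^sub>M qvec (square m)"
proof (rule measurable_restrict)
  fix p assume "p \<in> square m"
  then show "(\<lambda>X. X (snd p) (fst p)) \<in> qcols m {..<Suc m} \<rightarrow>\<^sub>M qgauss"
    unfolding measurable_qgauss_eq_borel
    by (intro measurable_qcols_entry[where C="{..<Suc m}"]) (auto simp: measurable_ident_sets)
qed

text \<open>Forgetting column \<open>m\<close> imposes no condition on it, so the preimage of a box
  has the whole space as its factor there, of mass 1.\<close>

lemma distr_drop_col:
  "distr (qcols m {..<Suc m}) (qvec (square m)) (\<lambda>X. \<lambda>p\<in>square m. X (snd p) (fst p)) = qvec (square m)"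
  (is "distr ?N _ ?f = _")
proof -
  let ?n = "Suc m"
  interpret product_sigma_finite "\<lambda>_::nat \<times> nat. qgauss" by (rule product_sigma_finite_qgauss)
  interpret p1: product_sigma_finite "\<lambda>_::nat. qgauss" by (rule product_sigma_finite_qgauss)
  interpret p2: product_sigma_finite "\<lambda>_::nat. qvec {..<m::nat}" by (rule product_sigma_finite_qvec)
  interpret P: prob_space "qvec {..<m}" by (rule prob_space_qvec)
  note f = measurable_drop_col[of m]
  show ?thesis
  proof (rule PiM_eqI)
    show "finite (square m)" by simp
    show "sets (distr ?N (qvec (square m)) ?f) = sets (qvec (square m))" by simp
    fix A assume "\<And>p. p \<in> square m \<Longrightarrow> A p \<in> sets qgauss"
    then have A: "A (i, j) \<in> sets borel" if "i < m" "j < m" for i j using that by auto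
    define B where "B j = (if j < m then \<Pi>\<^sub>E i\<in>{..<m}. A (i, j) else space (qvec {..<m}))" for j
    have B: "B j \<in> sets (qvec {..<m})" for j
      unfolding B_def by (auto intro!: sets_PiM_I_finite A)
    have "emeasure (distr ?N (qvec (square m)) ?f) (Pi\<^sub>E (square m) A) = emeasure ?N (?f -` Pi\<^sub>E (square m) A \<inter> space ?N)"
      by (rule emeasure_distr[OF f]) (use A in \<open>auto intro!: sets_PiM_I_finite\<close>)
    also have "?f -` Pi\<^sub>E (square m) A \<inter> space ?N = Pi\<^sub>E {..<?n} B"
    proof (rule Set.set_eqI)
      fix X :: "nat \<Rightarrow> nat \<Rightarrow> quat"
      have "X \<in> ?f -` Pi\<^sub>E (square m) A \<inter> space ?N \<longleftrightarrow>
        (\<forall>i<m. \<forall>j<m. X j i \<in> A (i, j)) \<and> X \<in> extensional {..<?n} \<and> (\<forall>j<?n. X j \<in> extensional {..<m})"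
        by (auto simp: space_PiM PiE_def Pi_def)
      also have "\<dots> \<longleftrightarrow> X \<in> Pi\<^sub>E {..<?n} B"
        by (auto simp: B_def PiE_def Pi_def space_PiM less_Suc_eq all_conj_distrib)
      finally show "X \<in> ?f -` Pi\<^sub>E (square m) A \<inter> space ?N \<longleftrightarrow> X \<in> Pi\<^sub>E {..<?n} B" .
    qed
    also have "emeasure ?N (Pi\<^sub>E {..<?n} B) = (\<Prod>j<?n. emeasure (qvec {..<m}) (B j))"
      using B by (intro p2.emeasure_PiM) auto
    also have "\<dots> = (\<Prod>j<m. emeasure (qvec {..<m}) (B j))"
      by (simp add: B_def P.emeasure_space_1)
    also have "\<dots> = (\<Prod>j<m. \<Prod>i<m. emeasure qgauss (A (i, j)))"
    proof (intro prod.cong refl)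
      fix j assume "j \<in> {..<m}"
      then show "emeasure (qvec {..<m}) (B j) = (\<Prod>i<m. emeasure qgauss (A (i, j)))"
        using p1.emeasure_PiM[of "{..<m}" "\<lambda>i. A (i, j)"] A by (simp add: B_def)
    qed
    also have "\<dots> = (\<Prod>i<m. \<Prod>j<m. emeasure qgauss (A (i, j)))"
      by (rule prod.swap)
    also have "\<dots> = (\<Prod>p\<in>square m. emeasure qgauss (A p))"
      by (subst prod.cartesian_product) (simp add: case_prod_unfold)
    finally show "emeasure (distr ?N (qvec (square m)) ?f) (Pi\<^sub>E (square m) A) = (\<Prod>p\<in>square m. emeasure qgauss (A p))" .
  qed
qed

lemma integral_drop_col:
  fixes F :: "(nat \<times> nat \<Rightarrow> quat) \<Rightarrow> real"
  assumes "F \<in> borel_measurable (qvec (square m))"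
  shows "(\<integral>X. F (\<lambda>p\<in>square m. X (snd p) (fst p)) \<partial>qcols m {..<Suc m}) = (\<integral>x. F x \<partial>qvec (square m))"
proof -
  from integral_distr[OF measurable_drop_col assms] show ?thesis unfolding distr_drop_col by simp
qed

lemma integral_split_row:
  fixes F :: "(nat \<times> nat \<Rightarrow> quat) \<Rightarrow> real"
  assumes F: "F \<in> borel_measurable (qvec (square (Suc m)))" and F1: "\<And>x. \<bar>F x\<bar> \<le> 1"
  defines "I \<equiv> \<lambda>\<theta>. \<integral>X. F (\<lambda>p\<in>square (Suc m). add_row m \<theta> X (fst p) (snd p)) \<partial>qcols m {..<Suc m}"
  shows "(\<integral>x. F x \<partial>qvec (square (Suc m))) = (\<integral>\<theta>. I \<theta> \<partial>qvec {..<Suc m})"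
    and "integrable (qvec {..<Suc m}) I"
proof -
  let ?n = "Suc m"
  interpret P1: prob_space "qvec {..<?n}" by (rule prob_space_qvec)
  interpret P2: prob_space "qcols m {..<?n}" by (rule prob_space_qcols)
  interpret P: pair_prob_space "qvec {..<?n}" "qcols m {..<?n}" ..
  let ?N = "qvec {..<?n} \<Otimes>\<^sub>M qcols m {..<?n}"
  let ?f = "\<lambda>z. \<lambda>p\<in>square ?n. add_row m (fst z) (snd z) (fst p) (snd p)"
  note f = measurable_add_row[of m]
  have int: "integrable ?N (\<lambda>z. F (?f z))"
    by (rule P.integrable_abs_le_1[OF measurable_compose[OF f F] F1])
  have "(\<integral>x. F x \<partial>qvec (square ?n)) = (\<integral>z. F (?f z) \<partial>?N)"
    using integral_distr[OF f F] unfolding distr_add_row by simp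
  also have "\<dots> = (\<integral>\<theta>. I \<theta> \<partial>qvec {..<?n})"
    using P.integral_fst'[OF int] by (simp add: I_def)
  finally show "(\<integral>x. F x \<partial>qvec (square ?n)) = (\<integral>\<theta>. I \<theta> \<partial>qvec {..<?n})" .
  show "integrable (qvec {..<?n}) I"
    using P.integrable_fst'[OF int] by (simp add: I_def)
qed

section \<open>Comparison of the two Laplace transforms\<close>

lemma measurable_cdet_square:
  "(\<lambda>x. cdet n (\<lambda>i j. x (i, j))) \<in> borel_measurable (qvec (square n))"
  by (rule measurable_cdet) (auto intro!: measurable_qvec_component[where R="square n"] simp: measurable_ident_sets)

lemma measurable_sdet_square:
  "(\<lambda>x. sdet (Matrix.mat n n (\<lambda>(i, j). x (i, j)))) \<in> borel_measurable (qvec (square n))"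
  by (rule measurable_sdet) (auto intro!: measurable_qvec_component[where R="square n"] simp: measurable_ident_sets)

text \<open>Given the last row \<theta>, concentrating it bounds the \<open>cdet\<close> transform
  from above and leaves the \<open>sdet\<close> transform equal. Both concentrated transforms are
  those of size \<open>m\<close> with \<open>s\<close> multiplied by the squared norm of \<theta>,
  which is why the induction keeps \<open>s\<close> arbitrary.\<close>

lemma cdet_le_sdet_laplace:
  "s \<ge> 0 \<Longrightarrow> (\<integral>x. exp (- s * (norm (cdet n (\<lambda>i j. x (i, j))))\<^sup>2) \<partial>qvec (square n))
    \<le> (\<integral>x. exp (- s * sdet (Matrix.mat n n (\<lambda>(i, j). x (i, j)))) \<partial>qvec (square n))"
proof (induction n arbitrary: s)
  case 0
  have "cdet 0 A = 1" for A by (simp add: cdet_def)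
  moreover have "Matrix.mat 0 0 f = 1\<^sub>m 0" for f :: "nat \<times> nat \<Rightarrow> quat" by (rule eq_matI) auto
  ultimately show ?case by (simp add: sdet_one)
next
  case (Suc m)
  let ?n = "Suc m"
  note [measurable] = measurable_cdet_square measurable_sdet_square
  define Fc where "Fc n s x = exp (- s * (norm (cdet n (\<lambda>i j. x (i, j))))\<^sup>2)" for n s and x :: "nat \<times> nat \<Rightarrow> quat"
  define Fs where "Fs n s x = exp (- s * sdet (Matrix.mat n n (\<lambda>(i, j). x (i, j))))" for n s and x :: "nat \<times> nat \<Rightarrow> quat"
  have m[measurable]: "Fc n s \<in> borel_measurable (qvec (square n))" "Fs n s \<in> borel_measurable (qvec (square n))" for n s
    unfolding Fc_def Fs_def by measurable
  have b: "\<bar>Fc n s x\<bar> \<le> 1" "\<bar>Fs n s x\<bar> \<le> 1" if "s \<ge> 0" for n s x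
    using that by (auto simp: Fc_def Fs_def)
  have Fc_row: "Fc ?n s (\<lambda>p\<in>square ?n. add_row m \<theta> X (fst p) (snd p)) = exp (- s * (norm (cdet ?n (add_row m \<theta> X)))\<^sup>2)" for \<theta> X
    unfolding Fc_def by (intro arg_cong[where f="\<lambda>z. exp (- s * (norm z)\<^sup>2)"] cdet_cong) auto
  have Fs_row: "Fs ?n s (\<lambda>p\<in>square ?n. add_row m \<theta> X (fst p) (snd p)) = exp (- s * sdet (Matrix.mat ?n ?n (\<lambda>(i, j). add_row m \<theta> X i j)))" for \<theta> X
    unfolding Fs_def by (intro arg_cong[where f="\<lambda>z. exp (- s * sdet z)"] eq_matI) auto
  have Fc_drop: "Fc m t (\<lambda>p\<in>square m. X (snd p) (fst p)) = exp (- t * (norm (cdet m (\<lambda>i j. X j i)))\<^sup>2)" for t and X :: "nat \<Rightarrow> nat \<Rightarrow> quat"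
    unfolding Fc_def by (intro arg_cong[where f="\<lambda>z. exp (- t * (norm z)\<^sup>2)"] cdet_cong) auto
  have Fs_drop: "Fs m t (\<lambda>p\<in>square m. X (snd p) (fst p)) = exp (- t * sdet (Matrix.mat m m (\<lambda>(i, j). X j i)))" for t and X :: "nat \<Rightarrow> nat \<Rightarrow> quat"
    unfolding Fs_def by (intro arg_cong[where f="\<lambda>z. exp (- t * sdet z)"] eq_matI) auto
  note split_c = integral_split_row[OF m(1)[of ?n s] b(1)[OF Suc.prems], unfolded Fc_row cdet_laplace_def[symmetric]]
  note split_s = integral_split_row[OF m(2)[of ?n s] b(2)[OF Suc.prems], unfolded Fs_row sdet_laplace_def[symmetric]]
  have "cdet_laplace m s \<theta> \<le> sdet_laplace m s \<theta>" for \<theta>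
  proof -
    define t where "t = s * (\<Sum>j<?n. (norm (\<theta> j))\<^sup>2)"
    have t: "t \<ge> 0" using Suc.prems by (simp add: t_def sum_nonneg del: sum.lessThan_Suc)
    have "cdet_laplace m s \<theta> \<le> (\<integral>X. exp (- t * (norm (cdet m (\<lambda>i j. X j i)))\<^sup>2) \<partial>qcols m {..<?n})"
      using cdet_laplace_le[OF Suc.prems, of m \<theta>] by (simp only: t_def mult_minus_left)
    also have "\<dots> = (\<integral>x. Fc m t x \<partial>qvec (square m))"
      unfolding Fc_drop[symmetric] by (rule integral_drop_col) measurable
    also have "\<dots> \<le> (\<integral>x. Fs m t x \<partial>qvec (square m))"
      unfolding Fc_def Fs_def by (rule Suc.IH[OF t])
    also have "\<dots> = (\<integral>X. exp (- t * sdet (Matrix.mat m m (\<lambda>(i, j). X j i))) \<partial>qcols m {..<?n})"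
      unfolding Fs_drop[symmetric] by (rule integral_drop_col[symmetric]) measurable
    also have "\<dots> = sdet_laplace m s \<theta>"
      unfolding sdet_laplace_eq by (simp only: t_def mult_minus_left)
    finally show ?thesis .
  qed
  then have "(\<integral>\<theta>. cdet_laplace m s \<theta> \<partial>qvec {..<?n}) \<le> (\<integral>\<theta>. sdet_laplace m s \<theta> \<partial>qvec {..<?n})"
    by (intro integral_mono split_c(2) split_s(2))
  then show ?case
    unfolding split_c(1)[symmetric] split_s(1)[symmetric] unfolding Fc_def Fs_def .
qed

subsection \<open>The law of a quaternionic Gaussian matrix\<close>

text \<open>Independence makes the joint law of the four coordinates a product, and the quaternion
  is recovered by the map that defines \<open>qgauss\<close>.\<close>

lemma distr_std_quat_gaussian:
  assumes M: "prob_space M" and X: "std_quat_gaussian M X"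
  shows "distr M borel X = qgauss" and "X \<in> borel_measurable M"
proof -
  interpret prob_space M by fact
  let ?B = "Basis :: quat set"
  let ?Y = "\<lambda>w. \<lambda>b\<in>?B. X w \<bullet> b"
  have ind: "indep_vars (\<lambda>_. borel) (\<lambda>b w. X w \<bullet> b) ?B"
    and dist: "\<And>b. b \<in> ?B \<Longrightarrow> distributed M lborel (\<lambda>w. X w \<bullet> b) (\<lambda>x. ennreal (normal_density 0 (1/2) x))"
    using X by (auto simp: std_quat_gaussian_def)
  have rv: "(\<lambda>w. X w \<bullet> b) \<in> borel_measurable M" if "b \<in> ?B" for b
    using ind that by (auto simp: indep_vars_def)
  have Xsum: "X = (\<lambda>w. \<Sum>b\<in>?B. (X w \<bullet> b) *\<^sub>R b)" by (simp add: euclidean_representation)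
  show Xm: "X \<in> borel_measurable M"
    by (subst Xsum) (intro borel_measurable_sum borel_measurable_scaleR rv borel_measurable_const)
  have Ym: "?Y \<in> M \<rightarrow>\<^sub>M (\<Pi>\<^sub>M b\<in>?B. borel)" by (rule measurable_restrict) (rule rv)
  have d: "distr M borel (\<lambda>w. X w \<bullet> b) = real_gauss" if "b \<in> ?B" for b
    using distributed_distr_eq_density[OF dist[OF that]] by (simp cong: distr_cong)
  have "distr M (\<Pi>\<^sub>M b\<in>?B. borel) ?Y = (\<Pi>\<^sub>M b\<in>?B. distr M borel (\<lambda>w. X w \<bullet> b))"
    using indep_vars_iff_distr_eq_PiM'[where I="?B" and M'="\<lambda>_. borel" and X="\<lambda>b w. X w \<bullet> b"] ind rv by auto
  also have "\<dots> = (\<Pi>\<^sub>M b\<in>?B. real_gauss)" by (intro PiM_cong refl d)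
  finally have Y: "distr M (\<Pi>\<^sub>M b\<in>?B. borel) ?Y = (\<Pi>\<^sub>M b\<in>?B. real_gauss)" .
  have "qgauss = distr (distr M (\<Pi>\<^sub>M b\<in>?B. borel) ?Y) borel (\<lambda>f. \<Sum>b\<in>?B. f b *\<^sub>R b)"
    unfolding qgauss_def Y ..
  also have "\<dots> = distr M borel ((\<lambda>f. \<Sum>b\<in>?B. f b *\<^sub>R b) \<circ> ?Y)"
    by (rule distr_distr[OF _ Ym]) measurable
  also have "\<dots> = distr M borel X"
    by (intro distr_cong refl) (simp add: euclidean_representation)
  finally show "distr M borel X = qgauss" by simp
qed

lemma distr_quat_gaussian_matrix:
  assumes M: "prob_space M" and G: "quat_gaussian_matrix M n G" and n: "n \<ge> 1"
  shows "distr M (qvec (square n)) (\<lambda>w. \<lambda>p\<in>square n. G w $$ p) = qvec (square n)"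
    and "(\<lambda>w. \<lambda>p\<in>square n. G w $$ p) \<in> M \<rightarrow>\<^sub>M qvec (square n)"
    and "\<And>i j. i < n \<Longrightarrow> j < n \<Longrightarrow> (\<lambda>w. G w $$ (i, j)) \<in> borel_measurable M"
proof -
  interpret prob_space M by fact
  have ind: "indep_vars (\<lambda>_. borel) (\<lambda>p w. G w $$ p) (square n)"
    and std: "\<And>i j. i < n \<Longrightarrow> j < n \<Longrightarrow> std_quat_gaussian M (\<lambda>w. G w $$ (i, j))"
    using G by (auto simp: quat_gaussian_matrix_def atLeast0LessThan)
  have rv: "(\<lambda>w. G w $$ p) \<in> borel_measurable M" and d: "distr M borel (\<lambda>w. G w $$ p) = qgauss"
    if "p \<in> square n" for p
    using that distr_std_quat_gaussian[OF M std] by auto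
  show "\<And>i j. i < n \<Longrightarrow> j < n \<Longrightarrow> (\<lambda>w. G w $$ (i, j)) \<in> borel_measurable M" by (rule rv) simp
  show "(\<lambda>w. \<lambda>p\<in>square n. G w $$ p) \<in> M \<rightarrow>\<^sub>M qvec (square n)"
    by (rule measurable_restrict) (simp add: measurable_qgauss_eq_borel rv)
  \<comment> \<open>The characterisation of independence by product laws asks for a nonempty index
    set; \<open>n \<ge> 1\<close> provides it.\<close>
  have ne: "square n \<noteq> {}" using n by (auto simp: lessThan_empty_iff)
  have "distr M (\<Pi>\<^sub>M p\<in>square n. borel) (\<lambda>w. \<lambda>p\<in>square n. G w $$ p) = (\<Pi>\<^sub>M p\<in>square n. distr M borel (\<lambda>w. G w $$ p))"
    using indep_vars_iff_distr_eq_PiM'[OF ne, where M'="\<lambda>_. borel" and X="\<lambda>p w. G w $$ p"] ind rv by auto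
  also have "\<dots> = qvec (square n)" by (intro PiM_cong refl d)
  finally have *: "distr M (\<Pi>\<^sub>M p\<in>square n. borel) (\<lambda>w. \<lambda>p\<in>square n. G w $$ p) = qvec (square n)" .
  have "distr M (qvec (square n)) (\<lambda>w. \<lambda>p\<in>square n. G w $$ p) = distr M (\<Pi>\<^sub>M p\<in>square n. borel) (\<lambda>w. \<lambda>p\<in>square n. G w $$ p)"
    by (rule distr_cong) (auto intro!: sets_PiM_cong)
  then show "distr M (qvec (square n)) (\<lambda>w. \<lambda>p\<in>square n. G w $$ p) = qvec (square n)"
    unfolding * .
qed

theorem theoremB1:
  fixes M :: "'w measure" and n :: nat and G :: "'w \<Rightarrow> quat mat"
  assumes "n \<ge> 1"
    and "prob_space M"
    and "quat_gaussian_matrix M n G"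
  shows "laplace_le M (\<lambda>w. (Sdet (G w))\<^sup>2) M (\<lambda>w. (norm (Cdet (G w)))\<^sup>2)"
proof -
  interpret prob_space M by fact
  note law = distr_quat_gaussian_matrix[OF assms(2,3,1)]
  have carrier: "G w \<in> carrier_mat n n" if "w \<in> space M" for w
    using assms(3) that by (simp add: quat_gaussian_matrix_def)
  \<comment> \<open>From here on the chosen singular values are replaced by a determinant in the
    entries, which is measurable and depends only on their joint law.\<close>
  have S: "(Sdet (G w))\<^sup>2 = sdet (Matrix.mat n n (\<lambda>(i, j). G w $$ (i, j)))" if "w \<in> space M" for w
  proof -
    have "Matrix.mat n n (\<lambda>(i, j). G w $$ (i, j)) = G w"
      using carrier[OF that] by (intro eq_matI) auto
    then show ?thesis using Sdet_sq_eq_sdet[OF carrier[OF that]] by simp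
  qed
  have C: "Cdet (G w) = cdet n (\<lambda>i j. G w $$ (i, j))" if "w \<in> space M" for w
    by (rule Cdet_eq_cdet[OF carrier[OF that]])
  have "(\<lambda>w. sdet (Matrix.mat n n (\<lambda>(i, j). G w $$ (i, j)))) \<in> borel_measurable M"
    by (rule measurable_sdet) (rule law(3))
  then have Sm: "(\<lambda>w. (Sdet (G w))\<^sup>2) \<in> borel_measurable M"
    using S by (simp cong: measurable_cong)
  have "(\<lambda>w. cdet n (\<lambda>i j. G w $$ (i, j))) \<in> borel_measurable M"
    by (rule measurable_cdet) (rule law(3))
  then have Cm: "(\<lambda>w. (norm (Cdet (G w)))\<^sup>2) \<in> borel_measurable M"
    using C by (simp cong: measurable_cong)
  have "(\<integral>w. exp (- s * (norm (Cdet (G w)))\<^sup>2) \<partial>M) \<le> (\<integral>w. exp (- s * (Sdet (G w))\<^sup>2) \<partial>M)" if s: "s \<ge> 0" for s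
  proof -
    note [measurable] = measurable_cdet_square measurable_sdet_square
    let ?Y = "\<lambda>w. \<lambda>p\<in>square n. G w $$ p"
    have "(\<integral>w. exp (- s * (norm (Cdet (G w)))\<^sup>2) \<partial>M) = (\<integral>w. exp (- s * (norm (cdet n (\<lambda>i j. ?Y w (i, j))))\<^sup>2) \<partial>M)"
    proof (intro Bochner_Integration.integral_cong refl)
      fix w assume w: "w \<in> space M"
      show "exp (- s * (norm (Cdet (G w)))\<^sup>2) = exp (- s * (norm (cdet n (\<lambda>i j. ?Y w (i, j))))\<^sup>2)"
        unfolding C[OF w] by (intro arg_cong[where f="\<lambda>z. exp (- s * (norm z)\<^sup>2)"] cdet_cong) auto
    qed
    also have "\<dots> = (\<integral>x. exp (- s * (norm (cdet n (\<lambda>i j. x (i, j))))\<^sup>2) \<partial>distr M (qvec (square n)) ?Y)"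
      by (rule integral_distr[OF law(2), symmetric]) measurable
    also have "\<dots> \<le> (\<integral>x. exp (- s * sdet (Matrix.mat n n (\<lambda>(i, j). x (i, j)))) \<partial>distr M (qvec (square n)) ?Y)"
      unfolding law(1) by (rule cdet_le_sdet_laplace[OF s])
    also have "\<dots> = (\<integral>w. exp (- s * sdet (Matrix.mat n n (\<lambda>(i, j). ?Y w (i, j)))) \<partial>M)"
      by (rule integral_distr[OF law(2)]) measurable
    also have "\<dots> = (\<integral>w. exp (- s * (Sdet (G w))\<^sup>2) \<partial>M)"
    proof (intro Bochner_Integration.integral_cong refl)
      fix w assume w: "w \<in> space M"
      show "exp (- s * sdet (Matrix.mat n n (\<lambda>(i, j). ?Y w (i, j)))) = exp (- s * (Sdet (G w))\<^sup>2)"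
        unfolding S[OF w] by (intro arg_cong[where f="\<lambda>z. exp (- s * sdet z)"] eq_matI) auto
    qed
    finally show ?thesis .
  qed
  then show ?thesis
    unfolding laplace_le_def using Sm Cm by auto
qed

end
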